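(* Let $\mathcal{H}=L^2(\mathcal{Z})$ and let $X_i=\mu_i+\varepsilon_i$, $i=1,\ldots,n$, where the errors $\{\varepsilon_i\}_{i\in\mathbb{Z}}$ satisfy the following two conditions. (A1) $\{\varepsilon_i\}_{i\in\mathbb{Z}}$ is a centered, strictly stationary sequence of $\mathcal{H}$-valued random variables with $\mathsf{E}\|\varepsilon_1\|^k<\infty$ for some $k>2$. With $C_r=\mathsf{E}[\varepsilon_0\otimes\varepsilon_r]$ one has $\sum_{r\in\mathbb{Z}}\|C_r\|<\infty$, and the long-run covariance operator $C_\varepsilon:=\sum_{r\in\mathbb{Z}}C_r$ is not the zero operator. Write its spectral decomposition as $C_\varepsilon=\sum_{p\ge1}\lambda_{p,\varepsilon}\,v_{p,\varepsilon}\otimes v_{p,\varepsilon}$, where $\lambda_{1,\varepsilon}\ge\lambda_{2,\varepsilon}\ge\cdots$ and $\{v_{p,\varepsilon}\}$ is an orthonormal basis of $\mathcal{H}$. Moreover $\sum_{p=1}^\infty\sum_{h\in\mathbb{Z}}|\mathsf{Cov}(\langle\varepsilon_0,v_{p,\varepsilon}\rangle,\langle\varepsilon_h,v_{p,\varepsilon}\rangle)|<\infty$. (A2) $\big\{n^{-1/2}\sum_{i=1}^{\lfloor tn\rfloor}\varepsilon_i,\ t\in[0,1]\big\}$ converges weakly in $D^{\mathcal{H}}[0,1]$ to an $\mathcal{H}$-valued Brownian motion $\{W_{C_\varepsilon}(t),\ t\in[0,1]\}$ with covariance operator $C_\varepsilon$. Let $\hat C_n$ be an estimator of $C_\varepsilon$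 (a random bounded self-adjoint positive semidefinite operator on $\mathcal{H}$ computed from $X_1,\ldots,X_n$) with $\|\hat C_n-C_\varepsilon\|=o_P(1)$ in operator norm, and let $\hat\lambda_1$ be the largest eigenvalue of $\hat C_n$. Define $$T_{n,\mathrm{WF}}(\hat C_n)=\max_{1\le k<n}\Big\|(\hat C_n+\hat\lambda_1\mathrm{Id})^{-1/2}\frac{1}{\sqrt n}\sum_{i=1}^k(X_i-\bar X_n)\Big\|,\qquad \bar X_n=\frac1n\sum_{i=1}^nX_i.$$ Then under the null hypothesis $H_0:\mu_1=\cdots=\mu_n$, as $n\to\infty$, $$T_{n,\mathrm{WF}}^2(\hat C_n)\xrightarrow{\mathcal D}\sup_{0\le t\le1}\sum_{p=1}^\infty\frac{\lambda_{p,\varepsilon}}{\lambda_{p,\varepsilon}+\lambda_{1,\varepsilon}}B_p^2(t),$$ where $B_1,B_2,\ldots$ are i.i.d. standard Brownian bridges.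
   Context: $\mathcal{H}=L^2(\mathcal{Z})$ is the real separable Hilbert space of square-integrable functions on a domain $\mathcal{Z}$ equipped with a $\sigma$-finite measure $\nu$, with inner product $\langle f,g\rangle=\int_{\mathcal{Z}}fg\,d\nu$ and norm $\|\cdot\|$. For $v,w\in\mathcal{H}$ the tensor product is the operator $(v\otimes w)(h)=\langle v,h\rangle w$. Operator norms are $\|B\|=\sup_h\|Bh\|/\|h\|$. $\mathrm{Id}$ is the identity operator, and for a positive definite bounded self-adjoint operator $A$, $A^{-1/2}$ is the unique positive definite operator with $A^{-1/2}AA^{-1/2}=\mathrm{Id}$. *)

theory Defs
  imports "HOL-Probability.Probability"
begin

definition tensor :: "'h::real_inner \<Rightarrow> 'h \<Rightarrow> ('h \<Rightarrow>\<^sub>L 'h)" where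
  "tensor v w = Blinfun (\<lambda>h. (v \<bullet> h) *\<^sub>R w)"

definition selfadjoint_op :: "('h::real_inner \<Rightarrow>\<^sub>L 'h) \<Rightarrow> bool" where
  "selfadjoint_op A \<longleftrightarrow> (\<forall>x y. (A x) \<bullet> y = x \<bullet> (A y))"

definition psd_op :: "('h::real_inner \<Rightarrow>\<^sub>L 'h) \<Rightarrow> bool" where
  "psd_op A \<longleftrightarrow> selfadjoint_op A \<and> (\<forall>x. 0 \<le> (A x) \<bullet> x)"

definition posdef_op :: "('h::real_inner \<Rightarrow>\<^sub>L 'h) \<Rightarrow> bool" where
  "posdef_op A \<longleftrightarrow> selfadjoint_op A \<and> (\<forall>x. x \<noteq> 0 \<longrightarrow> 0 < (A x) \<bullet> x)"

definition inv_sqrt_op :: "('h::real_inner \<Rightarrow>\<^sub>L 'h) \<Rightarrow> ('h \<Rightarrow>\<^sub>L 'h)" where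
  "inv_sqrt_op A = (THE B. posdef_op B \<and> B o\<^sub>L A o\<^sub>L B = id_blinfun)"

definition is_eigenvalue :: "('h::real_normed_vector \<Rightarrow>\<^sub>L 'h) \<Rightarrow> real \<Rightarrow> bool" where
  "is_eigenvalue A l \<longleftrightarrow> (\<exists>x. x \<noteq> 0 \<and> A x = l *\<^sub>R x)"

definition cov_op :: "'a measure \<Rightarrow> (int \<Rightarrow> 'a \<Rightarrow> 'h::{real_inner,banach,second_countable_topology})
     \<Rightarrow> int \<Rightarrow> ('h \<Rightarrow>\<^sub>L 'h)" where
  "cov_op M eps r = Blinfun (\<lambda>h. \<integral>\<omega>. (tensor (eps 0 \<omega>) (eps r \<omega>)) h \<partial>M)"

definition covariance_rv :: "'a measure \<Rightarrow> ('a \<Rightarrow> real) \<Rightarrow> ('a \<Rightarrow> real) \<Rightarrow> real" where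
  "covariance_rv M X Y =
     (\<integral>\<omega>. (X \<omega> - (\<integral>\<eta>. X \<eta> \<partial>M)) * (Y \<omega> - (\<integral>\<eta>. Y \<eta> \<partial>M)) \<partial>M)"

definition centered_normal :: "'a measure \<Rightarrow> ('a \<Rightarrow> real) \<Rightarrow> real \<Rightarrow> bool" where
  "centered_normal N X v \<longleftrightarrow>
     (if v = 0 then X \<in> borel_measurable N \<and> (AE \<omega> in N. X \<omega> = 0)
      else distributed N lborel X (normal_density 0 (sqrt v)))"

definition is_H_brownian_motion ::
  "'a measure \<Rightarrow> ('a \<Rightarrow> real \<Rightarrow> 'h::{real_inner,banach,second_countable_topology})
     \<Rightarrow> ('h \<Rightarrow>\<^sub>L 'h) \<Rightarrow> bool" where
  "is_H_brownian_motion N W C \<longleftrightarrow>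
     (\<forall>t\<in>{0..1}. (\<lambda>\<omega>. W \<omega> t) \<in> borel_measurable N) \<and>
     (\<forall>\<omega>\<in>space N. W \<omega> 0 = 0 \<and> continuous_on {0..1} (W \<omega>)) \<and>
     (\<forall>(m::nat) (ts::nat \<Rightarrow> real) (hs::nat \<Rightarrow> 'h). (\<forall>j<m. ts j \<in> {0..1}) \<longrightarrow>
        centered_normal N (\<lambda>\<omega>. \<Sum>j<m. W \<omega> (ts j) \<bullet> hs j)
          (\<Sum>j<m. \<Sum>l<m. min (ts j) (ts l) * ((C (hs j)) \<bullet> hs l)))"

definition is_brownian_bridge :: "'a measure \<Rightarrow> ('a \<Rightarrow> real \<Rightarrow> real) \<Rightarrow> bool" where
  "is_brownian_bridge N B \<longleftrightarrow>
     (\<forall>t\<in>{0..1}. (\<lambda>\<omega>. B \<omega> t) \<in> borel_measurable N) \<and>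
     (\<forall>\<omega>\<in>space N. continuous_on {0..1} (B \<omega>)) \<and>
     (\<forall>(m::nat) (ts::nat \<Rightarrow> real) (cs::nat \<Rightarrow> real). (\<forall>j<m. ts j \<in> {0..1}) \<longrightarrow>
        centered_normal N (\<lambda>\<omega>. \<Sum>j<m. cs j * B \<omega> (ts j))
          (\<Sum>j<m. \<Sum>l<m. cs j * cs l * (min (ts j) (ts l) - ts j * ts l)))"

definition cadlag01 :: "(real \<Rightarrow> 'h::real_normed_vector) set" where
  "cadlag01 = {x. (\<forall>t\<in>{0..<1}. continuous (at_right t) x) \<and>
                   (\<forall>t\<in>{0<..1}. \<exists>l. (x \<longlongrightarrow> l) (at_left t))}"

definition time_changes01 :: "(real \<Rightarrow> real) set" where
  "time_changes01 = {g. strict_mono_on {0..1} g \<and> continuous_on {0..1} g \<and> g 0 = 0 \<and> g 1 = 1}"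

definition skorokhod_dist :: "(real \<Rightarrow> 'h::real_normed_vector) \<Rightarrow> (real \<Rightarrow> 'h) \<Rightarrow> real" where
  "skorokhod_dist x y = (INF g\<in>time_changes01.
      max (SUP t\<in>{0..1}. \<bar>g t - t\<bar>) (SUP t\<in>{0..1}. norm (x (g t) - y t)))"

definition skorokhod_continuous :: "((real \<Rightarrow> 'h::real_normed_vector) \<Rightarrow> real) \<Rightarrow> bool" where
  "skorokhod_continuous f \<longleftrightarrow> (\<forall>x\<in>cadlag01. \<forall>e>0. \<exists>d>0. \<forall>y\<in>cadlag01.
      skorokhod_dist x y < d \<longrightarrow> \<bar>f y - f x\<bar> < e)"

definition D_weak_conv :: "'a measure \<Rightarrow> (nat \<Rightarrow> 'a \<Rightarrow> real \<Rightarrow> 'h::real_normed_vector)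
     \<Rightarrow> 'b measure \<Rightarrow> ('b \<Rightarrow> real \<Rightarrow> 'h) \<Rightarrow> bool" where
  "D_weak_conv M S N W \<longleftrightarrow>
     (\<forall>f::(real \<Rightarrow> 'h) \<Rightarrow> real. bounded (f ` cadlag01) \<and> skorokhod_continuous f \<longrightarrow>
        (\<lambda>n. \<integral>\<omega>. f (S n \<omega>) \<partial>M) \<longlonglongrightarrow> (\<integral>\<omega>. f (W \<omega>) \<partial>N))"

definition strictly_stationary :: "'a measure \<Rightarrow> (int \<Rightarrow> 'a \<Rightarrow> 'h::topological_space) \<Rightarrow> bool" where
  "strictly_stationary M eps \<longleftrightarrow> (\<forall>s::int.
     distr M (PiM UNIV (\<lambda>_. borel)) (\<lambda>\<omega> i. eps (i + s) \<omega>) =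
     distr M (PiM UNIV (\<lambda>_. borel)) (\<lambda>\<omega> i. eps i \<omega>))"

end

theory Submission
  imports Defs
begin

text \<open>The functional limit theorem and continuous mapping give the limit of the maximum formed with the
  limiting operator \<open>(C + \<lambda>\<^sub>1)\<close> to the power \<open>-1/2\<close>; by Parseval its square is
  \<open>sup\<^sub>t \<Sum>\<^sub>p \<langle>W(t) - t W(1), v\<^sub>p\<rangle>\<^sup>2 / (\<lambda>\<^sub>p + \<lambda>\<^sub>1)\<close>, and the coordinates of the tied-down Brownian
  motion \<open>W\<close> are independent bridges scaled by the square roots of the \<open>\<lambda>\<^sub>p\<close>. Since the \<open>\<lambda>\<^sub>p\<close> are
  summable, \<open>C\<close> is compact, so the top of the spectrum of an operator close to \<open>C\<close> is an eigenvalue close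
  to \<open>\<lambda>\<^sub>1\<close>; hence the inverse root of the estimated operator is consistent in operator norm, and as
  the partial sum process is tight, replacing it by its limit changes the statistic negligibly.\<close>

section \<open>Operators on a real Hilbert space\<close>

text \<open>Measurability, which the overview does not mention, shapes much of the work.
  \<open>lamhat\<close> is given only pointwise as a largest eigenvalue and
  \<open>inv_sqrt_op\<close> only by a definite description, while \<open>distr\<close> is
  meaningful only for measurable maps. The underlying measure need not be complete, so measurable
  projection is out of reach; existential statements over uncountable sets are instead reduced by
  compactness to countable ones. Inverse square roots are built by explicit iterations from a fixed
  starting point: the iterates give existence, and their convergence carries measurability to the
  limit. Norm estimates rest on approximate eigenvectors, so no spectral theorem enters.

  The Brownian motion of (A2) and the bridges of the conclusion live on unrelated probability
  spaces. They are compared through the joint law of countably many real coordinates, at a dense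
  sequence of times. The bridge series is seen to have bounded sums only almost surely, by
  transferring a sure event from the other space. That the \<open>lam p\<close> are nonnegative and
  tend to zero is derived from (A1).\<close>

text \<open>Unit vectors that nearly attain the norm \<open>d\<close> of a self-adjoint operator are
  approximate eigenvectors of its square: by expansion, the squared norm of
  \<open>A (A x) - d^2 x\<close> is at most \<open>d^2 (d^2 - |A x|^2)\<close>. They stand in for
  eigenvectors, which need not exist.\<close>

lemma norm_approx_vectors:
  fixes A :: "'h::real_inner \<Rightarrow>\<^sub>L 'h"
  assumes sa: "selfadjoint_op A" and nz: "A \<noteq> 0"
  obtains x :: "nat \<Rightarrow> 'h" where "\<And>n. norm (x n) = 1"
    "(\<lambda>n. norm (A (x n))) \<longlonglongrightarrow> norm A"
    "(\<lambda>n. A (A (x n)) - (norm A)\<^sup>2 *\<^sub>R x n) \<longlonglongrightarrow> 0"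
proof -
  define d where "d = norm A"
  have dpos: "d > 0" using nz by (simp add: d_def)
  have ex: "\<exists>x. norm x = 1 \<and> d - e < norm (A x)" if e: "0 < e" "e \<le> d" for e
  proof (rule ccontr)
    assume "\<not> ?thesis"
    then have H: "norm x = 1 \<Longrightarrow> norm (A x) \<le> d - e" for x by force
    have "norm (A x) \<le> (d - e) * norm x" for x
    proof (cases "x = 0")
      case False
      have "norm (A (x /\<^sub>R norm x)) \<le> d - e" by (rule H) (use False in simp)
      then show ?thesis using False by (simp add: blinfun.scaleR_right field_simps)
    qed simp
    then have "d \<le> d - e" unfolding d_def
      by (intro norm_blinfun_bound) (use e in \<open>auto simp: d_def\<close>)
    then show False using e by simp
  qed
  have "\<exists>x. norm x = 1 \<and> d - d / real (Suc n) < norm (A x)" for n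
    by (rule ex) (use dpos in \<open>auto simp: field_simps\<close>)
  then obtain x where x: "\<And>n. norm (x n) = 1" "\<And>n. d - d / real (Suc n) < norm (A (x n))"
    by metis
  have up: "norm (A (x n)) \<le> d" for n
    using norm_blinfun[of A "x n"] x(1)[of n] by (simp add: d_def)
  have lim0: "(\<lambda>n. d / real (Suc n)) \<longlonglongrightarrow> 0"
    by (rule LIMSEQ_Suc[OF lim_const_over_n])
  have lim1: "(\<lambda>n. norm (A (x n))) \<longlonglongrightarrow> d"
  proof (rule real_tendsto_sandwich)
    show "(\<lambda>n. d - d / real (Suc n)) \<longlonglongrightarrow> d" using tendsto_diff[OF tendsto_const lim0, of d] by simp
    show "(\<lambda>n. d) \<longlonglongrightarrow> d" by simp
  qed (use x(2) up in \<open>auto intro!: always_eventually less_imp_le\<close>)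
  have bd: "(norm (A (A (x n)) - d\<^sup>2 *\<^sub>R x n))\<^sup>2 \<le> d\<^sup>2 * (d\<^sup>2 - (norm (A (x n)))\<^sup>2)" for n
  proof -
    have 1: "A (A (x n)) \<bullet> x n = (norm (A (x n)))\<^sup>2"
      using sa by (simp add: selfadjoint_op_def power2_norm_eq_inner)
    have "norm (A (A (x n))) \<le> d * norm (A (x n))" unfolding d_def by (rule norm_blinfun)
    then have 2: "(norm (A (A (x n))))\<^sup>2 \<le> d\<^sup>2 * (norm (A (x n)))\<^sup>2"
      by (metis norm_ge_zero power_mono power_mult_distrib)
    have 3: "x n \<bullet> x n = 1" using x(1)[of n] by (simp add: dot_square_norm)
    have "(norm (A (A (x n)) - d\<^sup>2 *\<^sub>R x n))\<^sup>2
        = (norm (A (A (x n))))\<^sup>2 - 2 * d\<^sup>2 * (A (A (x n)) \<bullet> x n) + (d\<^sup>2)\<^sup>2 * (x n \<bullet> x n)"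
      unfolding power2_norm_eq_inner by (simp add: inner_diff inner_commute algebra_simps power2_eq_square)
    then show ?thesis using 1 2 3 by (simp add: power2_eq_square algebra_simps)
  qed
  have "(\<lambda>n. (norm (A (A (x n)) - d\<^sup>2 *\<^sub>R x n))\<^sup>2) \<longlonglongrightarrow> 0"
  proof (rule Lim_null_comparison)
    show "(\<lambda>n. d\<^sup>2 * (d\<^sup>2 - (norm (A (x n)))\<^sup>2)) \<longlonglongrightarrow> 0"
      using tendsto_mult[OF tendsto_const[of "d\<^sup>2"] tendsto_diff[OF tendsto_const[of "d\<^sup>2"] tendsto_power[OF lim1, of 2]]]
      by simp
  qed (use bd in \<open>auto intro!: always_eventually\<close>)
  then have "(\<lambda>n. sqrt ((norm (A (A (x n)) - d\<^sup>2 *\<^sub>R x n))\<^sup>2)) \<longlonglongrightarrow> sqrt 0"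
    by (rule tendsto_real_sqrt)
  then have "(\<lambda>n. A (A (x n)) - d\<^sup>2 *\<^sub>R x n) \<longlonglongrightarrow> 0"
    by (simp add: tendsto_norm_zero_iff)
  then show ?thesis using that[OF x(1)] lim1 by (simp add: d_def)
qed

text \<open>In the factorisation \<open>A^2 - s^2 = (A + s) (A - s)\<close> with
  \<open>s = norm A\<close>, positivity makes the first factor bounded below by \<open>s\<close>, so
  it can be cancelled.\<close>

lemma norm_psd_approx:
  fixes A :: "'h::real_inner \<Rightarrow>\<^sub>L 'h"
  assumes psd: "psd_op A" and nz: "A \<noteq> 0"
  obtains x :: "nat \<Rightarrow> 'h" where "\<And>n. norm (x n) = 1"
    "(\<lambda>n. A (x n) - norm A *\<^sub>R x n) \<longlonglongrightarrow> 0"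
proof -
  define s where "s = norm A"
  have s: "s > 0" using nz by (simp add: s_def)
  from psd have sa: "selfadjoint_op A" by (simp add: psd_op_def)
  obtain x where x: "\<And>n. norm (x n) = 1" "(\<lambda>n. A (A (x n)) - (norm A)\<^sup>2 *\<^sub>R x n) \<longlonglongrightarrow> 0"
    using norm_approx_vectors[OF sa nz] by metis
  define y where "y n = A (x n) - s *\<^sub>R x n" for n
  have Ay: "A (y n) + s *\<^sub>R y n = A (A (x n)) - (norm A)\<^sup>2 *\<^sub>R x n" for n
    by (simp add: y_def s_def blinfun.diff_right blinfun.scaleR_right power2_eq_square scaleR_right_diff_distrib)
  have low: "s * norm z \<le> norm (A z + s *\<^sub>R z)" for z
  proof (cases "z = 0")
    case False
    have "s * norm z * norm z \<le> A z \<bullet> z + s * (z \<bullet> z)"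
      using psd by (simp add: psd_op_def dot_square_norm power2_eq_square)
    also have "\<dots> = (A z + s *\<^sub>R z) \<bullet> z" by (simp add: inner_add)
    also have "\<dots> \<le> norm (A z + s *\<^sub>R z) * norm z" by (rule norm_cauchy_schwarz)
    finally show ?thesis using False by simp
  qed simp
  have "(\<lambda>n. (1 / s) * norm (A (y n) + s *\<^sub>R y n)) \<longlonglongrightarrow> (1 / s) * 0"
    by (intro tendsto_mult tendsto_const tendsto_norm_zero) (use x(2) in \<open>simp add: Ay\<close>)
  then have "(\<lambda>n. (1 / s) * norm (A (y n) + s *\<^sub>R y n)) \<longlonglongrightarrow> 0" by simp
  then have "y \<longlonglongrightarrow> 0"
    by (rule tendsto_0_le[where K = 1]) (use low s in \<open>auto intro!: always_eventually simp: field_simps\<close>)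
  then show ?thesis using that[OF x(1)] by (simp add: y_def[abs_def] s_def)
qed

text \<open>On approximate eigenvectors for the value \<open>norm A\<close> the quadratic form
  approaches the norm, so a bound on the form is a bound on the norm.\<close>

lemma norm_psd_le:
  fixes A :: "'h::real_inner \<Rightarrow>\<^sub>L 'h"
  assumes psd: "psd_op A" and r: "\<And>x. A x \<bullet> x \<le> r * (x \<bullet> x)" and "0 \<le> r"
  shows "norm A \<le> r"
proof (cases "A = 0")
  case False
  obtain x where x: "\<And>n. norm (x n) = 1" "(\<lambda>n. A (x n) - norm A *\<^sub>R x n) \<longlonglongrightarrow> 0"
    using norm_psd_approx[OF psd False] by metis
  have xx: "x n \<bullet> x n = 1" for n using x(1)[of n] by (simp add: dot_square_norm)
  have "norm A - r \<le> norm (A (x n) - norm A *\<^sub>R x n)" for n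
  proof -
    have "norm A - r \<le> - ((A (x n) - norm A *\<^sub>R x n) \<bullet> x n)"
      using r[of "x n"] by (simp add: inner_diff xx)
    also have "\<dots> \<le> norm (A (x n) - norm A *\<^sub>R x n) * norm (x n)"
      using Cauchy_Schwarz_ineq2 abs_le_D2 by blast
    finally show ?thesis by (simp add: x)
  qed
  then have "norm A - r \<le> 0"
    by (intro LIMSEQ_le_const[OF tendsto_norm_zero[OF x(2)]]) auto
  then show ?thesis by simp
qed (use \<open>0 \<le> r\<close> in simp)

text \<open>With \<open>D = P - Q\<close>, the identity \<open>P^2 - Q^2 = P D + D Q\<close> is
  paired with \<open>D x\<close>, where \<open>x\<close> nearly attains the norm \<open>d\<close> of
  \<open>D\<close>. As \<open>D (D x)\<close> is close to \<open>d^2 x\<close>, both terms become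
  quadratic forms, bounded below in the limit by \<open>p d^2\<close> and \<open>q d^2\<close>.
  \<open>P\<close> and \<open>Q\<close> never have to commute.\<close>

lemma square_root_op_diff:
  fixes P Q :: "'h::real_inner \<Rightarrow>\<^sub>L 'h"
  assumes P: "selfadjoint_op P" "\<And>x. p * (x \<bullet> x) \<le> P x \<bullet> x"
    and Q: "selfadjoint_op Q" "\<And>x. q * (x \<bullet> x) \<le> Q x \<bullet> x"
  shows "(p + q) * norm (P - Q) \<le> norm ((P o\<^sub>L P) - (Q o\<^sub>L Q))"
proof (cases "P - Q = 0")
  case False
  define D where "D = P - Q"
  define d where "d = norm D"
  define E where "E = (P o\<^sub>L P) - (Q o\<^sub>L Q)"
  have d: "d > 0" using False by (simp add: D_def d_def)
  have sa: "selfadjoint_op D"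
    using P(1) Q(1) by (simp add: selfadjoint_op_def D_def blinfun.diff_left inner_diff)
  obtain x where x: "\<And>n. norm (x n) = 1" "(\<lambda>n. norm (D (x n))) \<longlonglongrightarrow> d"
      "(\<lambda>n. D (D (x n)) - d\<^sup>2 *\<^sub>R x n) \<longlonglongrightarrow> 0"
    unfolding d_def by (rule norm_approx_vectors[OF sa]) (use False in \<open>auto simp: D_def\<close>)
  have ineq: "p * (norm (D (x n)))\<^sup>2 + d\<^sup>2 * q
      \<le> norm E * norm (D (x n)) + norm Q * norm (D (D (x n)) - d\<^sup>2 *\<^sub>R x n)" for n
  proof -
    have xx: "x n \<bullet> x n = 1" using x(1)[of n] by (simp add: dot_square_norm)
    have E: "E (x n) = P (D (x n)) + D (Q (x n))"
      by (simp add: E_def D_def blinfun.diff_left blinfun.diff_right)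
    have "p * (norm (D (x n)))\<^sup>2 \<le> P (D (x n)) \<bullet> D (x n)"
      using P(2)[of "D (x n)"] by (simp add: power2_norm_eq_inner)
    moreover have "d\<^sup>2 * q \<le> d\<^sup>2 * (Q (x n) \<bullet> x n)"
      using Q(2)[of "x n"] by (intro mult_left_mono) (auto simp: xx)
    moreover have "D (Q (x n)) \<bullet> D (x n) = Q (x n) \<bullet> D (D (x n))"
      using sa by (simp add: selfadjoint_op_def)
    moreover have "Q (x n) \<bullet> D (D (x n)) = d\<^sup>2 * (Q (x n) \<bullet> x n) + Q (x n) \<bullet> (D (D (x n)) - d\<^sup>2 *\<^sub>R x n)"
      by (simp add: inner_diff_right)
    moreover have "\<bar>Q (x n) \<bullet> (D (D (x n)) - d\<^sup>2 *\<^sub>R x n)\<bar> \<le> norm Q * norm (D (D (x n)) - d\<^sup>2 *\<^sub>R x n)"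
    proof -
      have "\<bar>Q (x n) \<bullet> (D (D (x n)) - d\<^sup>2 *\<^sub>R x n)\<bar> \<le> norm (Q (x n)) * norm (D (D (x n)) - d\<^sup>2 *\<^sub>R x n)"
        by (rule Cauchy_Schwarz_ineq2)
      also have "\<dots> \<le> norm Q * norm (D (D (x n)) - d\<^sup>2 *\<^sub>R x n)"
        using norm_blinfun[of Q "x n"] x(1)[of n] by (intro mult_right_mono) auto
      finally show ?thesis .
    qed
    moreover have "E (x n) \<bullet> D (x n) \<le> norm E * norm (D (x n))"
    proof -
      have "E (x n) \<bullet> D (x n) \<le> norm (E (x n)) * norm (D (x n))" by (rule norm_cauchy_schwarz)
      also have "\<dots> \<le> norm E * norm (D (x n))"
        using norm_blinfun[of E "x n"] x(1)[of n] by (intro mult_right_mono) auto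
      finally show ?thesis .
    qed
    ultimately show ?thesis by (simp add: E inner_add_left)
  qed
  have "p * d\<^sup>2 + d\<^sup>2 * q \<le> norm E * d + norm Q * 0"
  proof (rule LIMSEQ_le)
    show "(\<lambda>n. p * (norm (D (x n)))\<^sup>2 + d\<^sup>2 * q) \<longlonglongrightarrow> p * d\<^sup>2 + d\<^sup>2 * q"
      by (intro tendsto_intros x)
    show "(\<lambda>n. norm E * norm (D (x n)) + norm Q * norm (D (D (x n)) - d\<^sup>2 *\<^sub>R x n))
        \<longlonglongrightarrow> norm E * d + norm Q * 0"
      by (intro tendsto_intros x tendsto_norm_zero)
  qed (use ineq in auto)
  then have "((p + q) * d) * d \<le> norm E * d" by (simp add: power2_eq_square algebra_simps)
  then show ?thesis using d by (simp add: d_def D_def E_def)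
qed simp

section \<open>Square roots and inverses by contraction iteration\<close>

text \<open>Convergence of the iterates from a prescribed \<open>x0\<close>, and not only existence
  of the fixed point, is what later passes measurability to the limit.\<close>

lemma contraction_iterates:
  fixes f :: "'a::complete_space \<Rightarrow> 'a"
  assumes S: "closed S" "x0 \<in> S" "f ` S \<subseteq> S" and c: "0 \<le> c" "c < 1"
    and lip: "\<And>x y. x \<in> S \<Longrightarrow> y \<in> S \<Longrightarrow> dist (f x) (f y) \<le> c * dist x y"
  obtains z where "z \<in> S" "f z = z" "(\<lambda>k. (f ^^ k) x0) \<longlonglongrightarrow> z"
proof -
  have "\<exists>!x\<in>S. f x = x"
    by (rule Banach_fix[OF _ _ c]) (use S lip in \<open>auto simp: complete_eq_closed\<close>)
  then obtain z where z: "z \<in> S" "f z = z" by auto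
  have it: "(f ^^ k) x0 \<in> S" for k by (induction k) (use S in auto)
  have d: "dist ((f ^^ k) x0) z \<le> c ^ k * dist x0 z" for k
  proof (induction k)
    case (Suc k)
    have "dist ((f ^^ Suc k) x0) z = dist (f ((f ^^ k) x0)) (f z)" by (simp add: z)
    also have "\<dots> \<le> c * dist ((f ^^ k) x0) z" by (intro lip it z)
    also have "\<dots> \<le> c * (c ^ k * dist x0 z)" using Suc c by (intro mult_left_mono) auto
    finally show ?case by simp
  qed simp
  have "(\<lambda>k. c ^ k * dist x0 z) \<longlonglongrightarrow> 0 * dist x0 z"
    by (intro tendsto_mult LIMSEQ_realpow_zero tendsto_const) (use c in auto)
  then have "(\<lambda>k. dist ((f ^^ k) x0) z) \<longlonglongrightarrow> 0"
    using Lim_null_comparison[of "\<lambda>k. dist ((f ^^ k) x0) z" "\<lambda>k. c ^ k * dist x0 z" sequentially] d by simp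
  then have "(\<lambda>k. (f ^^ k) x0) \<longlonglongrightarrow> z" unfolding tendsto_dist_iff[of _ z] .
  then show ?thesis using that z by blast
qed

lemma closed_selfadjoint: "closed {Z :: 'h::real_inner \<Rightarrow>\<^sub>L 'h. selfadjoint_op Z}"
  unfolding closed_sequential_limits
proof safe
  fix Z :: "nat \<Rightarrow> 'h \<Rightarrow>\<^sub>L 'h" and L
  assume Z: "\<forall>n. Z n \<in> {Z. selfadjoint_op Z}" "Z \<longlonglongrightarrow> L"
  have lim: "(\<lambda>n. Z n x) \<longlonglongrightarrow> L x" for x
    by (intro blinfun.tendsto Z tendsto_const)
  show "selfadjoint_op L" unfolding selfadjoint_op_def
  proof safe
    fix x y
    have "(\<lambda>n. Z n x \<bullet> y) \<longlonglongrightarrow> L x \<bullet> y" by (intro tendsto_inner lim tendsto_const)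
    moreover have "(\<lambda>n. Z n x \<bullet> y) \<longlonglongrightarrow> x \<bullet> L y"
      using tendsto_inner[OF tendsto_const[of x] lim[of y]] Z(1) by (simp add: selfadjoint_op_def)
    ultimately show "L x \<bullet> y = x \<bullet> L y" by (rule LIMSEQ_unique)
  qed
qed

definition sqrt_iter :: "('h::real_inner \<Rightarrow>\<^sub>L 'h) \<Rightarrow> nat \<Rightarrow> 'h \<Rightarrow>\<^sub>L 'h" where
  "sqrt_iter S k = ((\<lambda>Z. (1/2) *\<^sub>R (S + (Z o\<^sub>L Z))) ^^ k) 0"

text \<open>The \<open>k\<close>-th iterate is the sum of \<open>Z^i\<close> over
  \<open>i < k\<close>, so the limit is the Neumann series for the inverse of
  \<open>1 - Z\<close>.\<close>

definition neumann_iter :: "('h::real_inner \<Rightarrow>\<^sub>L 'h) \<Rightarrow> nat \<Rightarrow> 'h \<Rightarrow>\<^sub>L 'h" where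
  "neumann_iter Z k = ((\<lambda>J. id_blinfun + (Z o\<^sub>L J)) ^^ k) 0"

text \<open>If \<open>Z = (S + Z\<^sup>2) / 2\<close>, then \<open>(1 - Z)\<^sup>2 = 1 - S\<close>.\<close>

lemma sqrt_iter_limit:
  fixes S :: "'h::{real_inner,banach} \<Rightarrow>\<^sub>L 'h"
  assumes sa: "selfadjoint_op S" and S: "norm S < 1"
  obtains Z :: "'h \<Rightarrow>\<^sub>L 'h" where "sqrt_iter S \<longlonglongrightarrow> Z" "selfadjoint_op Z" "norm Z < 1" "S + (Z o\<^sub>L Z) = 2 *\<^sub>R Z"
proof -
  \<comment> \<open>The smaller root of \<open>norm S + r * r = 2 * r\<close>: the ball of radius
    \<open>r\<close> is mapped into itself, and the iteration contracts there with factor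
    \<open>r\<close>.\<close>
  define r where "r = 1 - sqrt (1 - norm S)"
  have r: "0 \<le> r" "r < 1" using S by (auto simp: r_def)
  have rr: "norm S + r * r = 2 * r"
    using S by (simp add: r_def algebra_simps)
  let ?f = "\<lambda>Z::'h \<Rightarrow>\<^sub>L 'h. (1/2) *\<^sub>R (S + (Z o\<^sub>L Z))"
  let ?X = "{Z::'h \<Rightarrow>\<^sub>L 'h. norm Z \<le> r} \<inter> {Z. selfadjoint_op Z}"
  obtain Z where Z: "Z \<in> ?X" "?f Z = Z" "(\<lambda>k. (?f ^^ k) 0) \<longlonglongrightarrow> Z"
  proof (rule contraction_iterates[of ?X 0 ?f r])
    show "closed ?X"
      by (intro closed_Int closed_selfadjoint closed_Collect_le continuous_intros)
    show "0 \<in> ?X" using r by (simp add: selfadjoint_op_def)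
    show "?f ` ?X \<subseteq> ?X"
    proof safe
      fix Z :: "'h \<Rightarrow>\<^sub>L 'h"
      assume Z: "norm Z \<le> r" "selfadjoint_op Z"
      have "norm (S + (Z o\<^sub>L Z)) \<le> norm S + norm (Z o\<^sub>L Z)" by (rule norm_triangle_ineq)
      also have "\<dots> \<le> norm S + norm Z * norm Z" using norm_blinfun_compose[of Z Z] by simp
      also have "\<dots> \<le> norm S + r * r" using Z r by (intro add_left_mono mult_mono) auto
      finally show "norm (?f Z) \<le> r" using rr by simp
      show "selfadjoint_op (?f Z)"
        using Z(2) sa by (simp add: selfadjoint_op_def blinfun.add_left blinfun.scaleR_left inner_add)
    qed
    fix Z Y assume "Z \<in> ?X" "Y \<in> ?X"
    then have b: "norm Z \<le> r" "norm Y \<le> r" by auto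
    have "?f Z - ?f Y = (1/2) *\<^sub>R ((Z o\<^sub>L (Z - Y)) + ((Z - Y) o\<^sub>L Y))"
      by (rule blinfun_eqI) (simp add: blinfun.diff_left blinfun.add_left blinfun.scaleR_left
          blinfun.diff_right algebra_simps)
    then have "dist (?f Z) (?f Y) = (1/2) * norm ((Z o\<^sub>L (Z - Y)) + ((Z - Y) o\<^sub>L Y))"
      by (simp add: dist_norm)
    also have "\<dots> \<le> (1/2) * (norm Z * norm (Z - Y) + norm (Z - Y) * norm Y)"
      by (intro mult_left_mono norm_triangle_le add_mono norm_blinfun_compose) auto
    also have "\<dots> \<le> (1/2) * (r * norm (Z - Y) + norm (Z - Y) * r)"
      by (intro mult_left_mono add_mono mult_right_mono b) auto
    finally show "dist (?f Z) (?f Y) \<le> r * dist Z Y" by (simp add: dist_norm)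
  qed (use r in auto)
  have "2 *\<^sub>R ?f Z = 2 *\<^sub>R Z" using Z(2) by (rule arg_cong)
  then have "S + (Z o\<^sub>L Z) = 2 *\<^sub>R Z" by simp
  then show ?thesis using that[of Z] Z r by (auto simp: sqrt_iter_def[abs_def])
qed

text \<open>The fixed point equation yields a right inverse of \<open>1 - Z\<close>. Since
  \<open>Z\<close> is self-adjoint, so is this inverse, and taking adjoints makes it a left inverse
  as well.\<close>

lemma neumann_iter_limit:
  fixes Z :: "'h::{real_inner,banach} \<Rightarrow>\<^sub>L 'h"
  assumes sa: "selfadjoint_op Z" and Z: "norm Z < 1"
  obtains J :: "'h \<Rightarrow>\<^sub>L 'h" where "neumann_iter Z \<longlonglongrightarrow> J" "selfadjoint_op J"
    "\<And>x. J x - Z (J x) = x" "\<And>x. J (x - Z x) = x"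
proof -
  let ?f = "\<lambda>J::'h \<Rightarrow>\<^sub>L 'h. id_blinfun + (Z o\<^sub>L J)"
  obtain J where J: "?f J = J" "(\<lambda>k. (?f ^^ k) 0) \<longlonglongrightarrow> J"
  proof (rule contraction_iterates[of UNIV 0 ?f "norm Z"])
    show "dist (?f x) (?f y) \<le> norm Z * dist x y" for x y
      using norm_blinfun_compose[of Z "x - y"]
      by (simp add: dist_norm bounded_bilinear.diff_right[OF bounded_bilinear_blinfun_compose])
  qed (use Z in auto)
  have 1: "J x - Z (J x) = x" for x
    using arg_cong[OF J(1), of "\<lambda>B. B x"] by (simp add: blinfun.add_left algebra_simps)
  have saJ: "J x \<bullet> y = x \<bullet> J y" for x y
  proof -
    have "J x \<bullet> (J y - Z (J y)) = (J x - Z (J x)) \<bullet> J y"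
      using sa by (simp add: selfadjoint_op_def inner_diff)
    then show ?thesis by (simp add: 1)
  qed
  have "J (x - Z x) = x" for x
  proof -
    have "J (x - Z x) \<bullet> y = x \<bullet> y" for y
    proof -
      have "J (x - Z x) \<bullet> y = (x - Z x) \<bullet> J y" by (rule saJ)
      also have "\<dots> = x \<bullet> (J y - Z (J y))" using sa by (simp add: selfadjoint_op_def inner_diff)
      finally show ?thesis by (simp add: 1)
    qed
    then show ?thesis by (metis vector_eq_rdot)
  qed
  then show ?thesis using that[of J] J 1 saJ
    by (simp add: neumann_iter_def[abs_def] selfadjoint_op_def)
qed

section \<open>Coercive operators and their inverse square roots\<close>

text \<open>The lower bound is explicit because in infinite dimensions \<open>posdef_op\<close>
  alone yields no bounded inverse. \<open>coercive_op 0\<close> coincides with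
  \<open>psd_op\<close>.\<close>

definition coercive_op :: "real \<Rightarrow> ('h::real_inner \<Rightarrow>\<^sub>L 'h) \<Rightarrow> bool" where
  "coercive_op c A \<longleftrightarrow> selfadjoint_op A \<and> (\<forall>x. c * (x \<bullet> x) \<le> A x \<bullet> x)"

lemma quadratic_form_le_norm: "(A :: 'h::real_inner \<Rightarrow>\<^sub>L 'h) x \<bullet> x \<le> norm A * (x \<bullet> x)"
proof -
  have "A x \<bullet> x \<le> norm (A x) * norm x" by (rule norm_cauchy_schwarz)
  also have "\<dots> \<le> (norm A * norm x) * norm x" by (intro mult_right_mono norm_blinfun) auto
  finally show ?thesis by (simp add: dot_square_norm power2_eq_square)
qed

text \<open>Dividing by \<open>b = norm A + 1\<close> gives \<open>S = 1 - A / b\<close> norm below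
  1, the summand 1 keeping \<open>b\<close> positive. Then \<open>1 - Z\<close> is the root of
  \<open>A / b\<close>, \<open>J\<close> is its inverse, and the factor \<open>1 / sqrt b\<close>
  undoes the scaling.\<close>

lemma inv_sqrt_construction:
  fixes A :: "'h::{real_inner,banach} \<Rightarrow>\<^sub>L 'h"
  assumes A: "coercive_op c A" and c: "c > 0"
  obtains Z J :: "'h \<Rightarrow>\<^sub>L 'h" where "sqrt_iter (id_blinfun - (1 / (norm A + 1)) *\<^sub>R A) \<longlonglongrightarrow> Z" "neumann_iter Z \<longlonglongrightarrow> J"
    "\<exists>q>0. coercive_op q ((1 / sqrt (norm A + 1)) *\<^sub>R J)"
    "((1 / sqrt (norm A + 1)) *\<^sub>R J) o\<^sub>L A o\<^sub>L ((1 / sqrt (norm A + 1)) *\<^sub>R J) = id_blinfun"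
proof -
  define b where "b = norm A + 1"
  define S where "S = id_blinfun - (1 / b) *\<^sub>R A"
  have b: "b > 0" by (simp add: b_def add_nonneg_pos)
  have S_app: "S x = x - (1 / b) *\<^sub>R A x" for x by (simp add: S_def blinfun.diff_left blinfun.scaleR_left)
  from A have saA: "selfadjoint_op A" by (simp add: coercive_op_def)
  then have saS: "selfadjoint_op S" by (simp add: selfadjoint_op_def S_app inner_diff)
  \<comment> \<open>The maximum with 0 covers the trivial space, where \<open>c\<close> may exceed
    \<open>b\<close>.\<close>
  have "norm S \<le> max 0 (1 - c / b)"
  proof (rule norm_psd_le)
    have "A x \<bullet> x \<le> b * (x \<bullet> x)" for x
      using quadratic_form_le_norm[of A x] unfolding b_def distrib_right
      by (smt (verit) inner_ge_zero mult_1)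
    then have "0 \<le> S x \<bullet> x" for x using b by (simp add: S_app inner_diff field_simps)
    then show "psd_op S" using saS by (simp add: psd_op_def)
    fix x
    have "c * (x \<bullet> x) \<le> A x \<bullet> x" using A by (simp add: coercive_op_def)
    then have "S x \<bullet> x \<le> (1 - c / b) * (x \<bullet> x)"
      using b by (simp add: S_app inner_diff field_simps)
    also have "\<dots> \<le> max 0 (1 - c / b) * (x \<bullet> x)" by (intro mult_right_mono) auto
    finally show "S x \<bullet> x \<le> max 0 (1 - c / b) * (x \<bullet> x)" .
  qed auto
  also have "\<dots> < 1" using b c by simp
  finally have "norm S < 1" .
  then obtain Z where
    Z: "sqrt_iter S \<longlonglongrightarrow> Z" "selfadjoint_op Z" "norm Z < 1" "S + (Z o\<^sub>L Z) = 2 *\<^sub>R Z"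
    using sqrt_iter_limit[OF saS] by blast
  obtain J where
    J: "neumann_iter Z \<longlonglongrightarrow> J" "selfadjoint_op J" "\<And>x. J x - Z (J x) = x" "\<And>x. J (x - Z x) = x"
    by (rule neumann_iter_limit[OF Z(2,3)]) blast
  define B where "B = (1 / sqrt b) *\<^sub>R J"
  have B_app: "B x = (1 / sqrt b) *\<^sub>R J x" for x by (simp add: B_def blinfun.scaleR_left)
  have A_eq: "A x = b *\<^sub>R ((x - Z x) - Z (x - Z x))" for x
  proof -
    have "S x + Z (Z x) = 2 *\<^sub>R Z x"
      using arg_cong[OF Z(4), of "\<lambda>B. B x"] by (simp add: blinfun.add_left blinfun.scaleR_left)
    then have "(1 / b) *\<^sub>R A x = x + Z (Z x) - 2 *\<^sub>R Z x" by (simp add: S_app algebra_simps)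
    then have "b *\<^sub>R ((1 / b) *\<^sub>R A x) = b *\<^sub>R (x + Z (Z x) - 2 *\<^sub>R Z x)" by simp
    then show ?thesis using b by (simp add: blinfun.diff_right scaleR_2 algebra_simps)
  qed
  have BAB: "B o\<^sub>L A o\<^sub>L B = id_blinfun"
  proof (rule blinfun_eqI)
    fix x
    have "J (A (J x)) = b *\<^sub>R x"
      using A_eq[of "J x"] by (simp add: J(3,4) blinfun.scaleR_right)
    then show "(B o\<^sub>L A o\<^sub>L B) x = id_blinfun x"
      using b by (simp add: B_app blinfun.scaleR_right)
  qed
  \<comment> \<open>For \<open>z = J x\<close> the form of \<open>J\<close> at \<open>x\<close> is
    at least \<open>1 - norm Z\<close> times \<open>z \<bullet> z\<close>, while
    \<open>x = z - Z z\<close> has norm at most twice that of \<open>z\<close>; squaring the 2 gives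
    the 4.\<close>
  define q where "q = (1 - norm Z) / (4 * sqrt b)"
  have q: "q > 0" using Z(3) b by (simp add: q_def)
  have "coercive_op q B" unfolding coercive_op_def
  proof safe
    show "selfadjoint_op B" using J(2) by (simp add: selfadjoint_op_def B_app)
    fix x
    define z where "z = J x"
    have x: "x = z - Z z" by (simp add: z_def J(3))
    have "norm x \<le> norm z + norm (Z z)" unfolding x by (rule norm_triangle_ineq4)
    also have "\<dots> \<le> 2 * norm z"
      using norm_blinfun[of Z z] Z(3) mult_right_mono[of "norm Z" 1 "norm z"] by simp
    finally have "(norm x)\<^sup>2 \<le> (2 * norm z)\<^sup>2" by (intro power_mono) auto
    then have xz: "x \<bullet> x \<le> 4 * (z \<bullet> z)" by (simp add: power2_norm_eq_inner power_mult_distrib)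
    have "(1 - norm Z) * (z \<bullet> z) \<le> z \<bullet> x"
      using quadratic_form_le_norm[of Z z] by (simp add: x inner_diff inner_commute algebra_simps)
    then have "(1 - norm Z) * (z \<bullet> z) / sqrt b \<le> (z \<bullet> x) / sqrt b"
      using b by (intro divide_right_mono) auto
    then have "(1 - norm Z) * (z \<bullet> z) / sqrt b \<le> B x \<bullet> x"
      by (simp add: B_app z_def)
    moreover have "q * (x \<bullet> x) \<le> q * (4 * (z \<bullet> z))" using xz q by simp
    moreover have "q * (4 * (z \<bullet> z)) = (1 - norm Z) * (z \<bullet> z) / sqrt b" by (simp add: q_def)
    ultimately show "q * (x \<bullet> x) \<le> B x \<bullet> x" by linarith
  qed
  then show ?thesis using that[of Z J] Z(1) J(1) BAB q unfolding B_def S_def b_def by blast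
qed

text \<open>\<open>B A B = 1\<close> makes \<open>B\<close> injective and onto, so
  \<open>B^2\<close> is a two-sided inverse of \<open>A\<close>.\<close>

lemma inv_sqrt_square:
  fixes A B :: "'h::real_inner \<Rightarrow>\<^sub>L 'h"
  assumes "B o\<^sub>L A o\<^sub>L B = id_blinfun"
  shows "A (B (B x)) = x" "B (B (A x)) = x"
proof -
  have id: "B (A (B y)) = y" for y using arg_cong[OF assms, of "\<lambda>F. F y"] by simp
  have inj: "y = z" if "B y = B z" for y z using id[of y] id[of z] that by metis
  show "A (B (B x)) = x" by (rule inj) (rule id)
  show "B (B (A x)) = x" by (metis id)
qed

text \<open>The resolvent identity \<open>B^2 - B0^2 = B^2 (A0 - A) B0^2\<close> bounds the
  difference of the squares, each square having norm at most \<open>1 / c\<close>;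
  \<open>square_root_op_diff\<close> then removes the squares. The factor \<open>q\<close> comes
  from \<open>B0\<close> alone, so it stays fixed while \<open>B\<close> varies.\<close>

lemma inv_sqrt_diff:
  fixes A A0 B B0 :: "'h::real_inner \<Rightarrow>\<^sub>L 'h"
  assumes A: "coercive_op c A" "coercive_op c A0" and c: "c > 0"
    and B: "coercive_op 0 B" "B o\<^sub>L A o\<^sub>L B = id_blinfun"
    and B0: "coercive_op q B0" "B0 o\<^sub>L A0 o\<^sub>L B0 = id_blinfun" "0 \<le> q"
  shows "q * norm (B - B0) \<le> norm (A - A0) / c\<^sup>2"
proof -
  have sq: "norm (F (F x)) \<le> norm x / c"
    if "coercive_op c G" "F o\<^sub>L G o\<^sub>L F = id_blinfun" for F G :: "'h \<Rightarrow>\<^sub>L 'h" and x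
  proof -
    define y where "y = F (F x)"
    have x: "G y = x" using inv_sqrt_square(1)[OF that(2)] by (simp add: y_def)
    have "c * norm y * norm y \<le> G y \<bullet> y"
      using that(1) unfolding coercive_op_def
      by (metis dot_square_norm mult.assoc power2_eq_square)
    also have "\<dots> \<le> norm x * norm y" unfolding x by (rule norm_cauchy_schwarz)
    finally have "c * norm y \<le> norm x" by (cases "y = 0") auto
    then show ?thesis using c by (simp add: y_def field_simps)
  qed
  have "(0 + q) * norm (B - B0) \<le> norm ((B o\<^sub>L B) - (B0 o\<^sub>L B0))"
    using B(1) B0(1) by (intro square_root_op_diff) (auto simp: coercive_op_def)
  also have "\<dots> \<le> norm (A - A0) / c\<^sup>2"
  proof (rule norm_blinfun_bound)
    fix x
    have "((B o\<^sub>L B) - (B0 o\<^sub>L B0)) x = B (B ((A0 - A) (B0 (B0 x))))"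
      using inv_sqrt_square(1)[OF B0(2), of x] inv_sqrt_square(2)[OF B(2), of "B0 (B0 x)"]
      by (simp add: blinfun.diff_left blinfun.diff_right)
    also have "norm \<dots> \<le> norm ((A0 - A) (B0 (B0 x))) / c" by (rule sq[OF A(1) B(2)])
    also have "\<dots> \<le> (norm (A0 - A) * norm (B0 (B0 x))) / c"
      using c by (intro divide_right_mono norm_blinfun) auto
    also have "\<dots> \<le> (norm (A0 - A) * (norm x / c)) / c"
      using c by (intro divide_right_mono mult_left_mono sq[OF A(2) B0(2)]) auto
    finally show "norm (((B o\<^sub>L B) - (B0 o\<^sub>L B0)) x) \<le> norm (A - A0) / c\<^sup>2 * norm x"
      by (simp add: power2_eq_square norm_minus_commute)
  qed simp
  finally show ?thesis by simp
qed

text \<open>Uniqueness among positive definite solutions is the perturbation bound with equal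
  operators, whose right-hand side vanishes.\<close>

lemma inv_sqrt_op_eqI:
  fixes A B :: "'h::real_inner \<Rightarrow>\<^sub>L 'h"
  assumes A: "coercive_op c A" "c > 0" and B: "coercive_op q B" "q > 0"
    and BAB: "B o\<^sub>L A o\<^sub>L B = id_blinfun"
  shows "inv_sqrt_op A = B"
  unfolding inv_sqrt_op_def
proof (rule the_equality)
  have "0 < B x \<bullet> x" if "x \<noteq> 0" for x
  proof -
    have "0 < q * (x \<bullet> x)" using B(2) that by simp
    also have "\<dots> \<le> B x \<bullet> x" using B(1) by (simp add: coercive_op_def)
    finally show ?thesis .
  qed
  then show "posdef_op B \<and> B o\<^sub>L A o\<^sub>L B = id_blinfun"
    using B(1) BAB by (simp add: posdef_op_def coercive_op_def)
next
  fix B' assume B': "posdef_op B' \<and> B' o\<^sub>L A o\<^sub>L B' = id_blinfun"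
  have "0 \<le> B' x \<bullet> x" for x
    using B' by (cases "x = 0") (auto simp: posdef_op_def intro: less_imp_le)
  then have "coercive_op 0 B'" using B' by (simp add: posdef_op_def coercive_op_def)
  then have "q * norm (B' - B) \<le> norm (A - A) / c\<^sup>2"
    using A B BAB B' by (intro inv_sqrt_diff) auto
  then show "B' = B" using B(2) by (simp add: mult_le_0_iff)
qed

lemma inv_sqrt_op_coercive:
  fixes A :: "'h::{real_inner,banach} \<Rightarrow>\<^sub>L 'h"
  assumes A: "coercive_op c A" "c > 0"
  obtains q where "q > 0" "coercive_op q (inv_sqrt_op A)"
    "inv_sqrt_op A o\<^sub>L A o\<^sub>L inv_sqrt_op A = id_blinfun"
proof -
  obtain Z J q where *: "q > 0" "coercive_op q ((1 / sqrt (norm A + 1)) *\<^sub>R J)"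
    "((1 / sqrt (norm A + 1)) *\<^sub>R J) o\<^sub>L A o\<^sub>L ((1 / sqrt (norm A + 1)) *\<^sub>R J) = id_blinfun"
    by (rule inv_sqrt_construction[OF A]) blast
  then show ?thesis using that inv_sqrt_op_eqI[OF A *(2,1,3)] by simp
qed

lemma inv_sqrt_op_limit:
  fixes A :: "'h::{real_inner,banach} \<Rightarrow>\<^sub>L 'h"
  assumes A: "coercive_op c A" "c > 0"
  obtains Z J :: "'h \<Rightarrow>\<^sub>L 'h" where "sqrt_iter (id_blinfun - (1 / (norm A + 1)) *\<^sub>R A) \<longlonglongrightarrow> Z"
    "neumann_iter Z \<longlonglongrightarrow> J" "inv_sqrt_op A = (1 / sqrt (norm A + 1)) *\<^sub>R J"
proof -
  obtain Z J q where *: "sqrt_iter (id_blinfun - (1 / (norm A + 1)) *\<^sub>R A) \<longlonglongrightarrow> Z"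
    "neumann_iter Z \<longlonglongrightarrow> J" "q > 0" "coercive_op q ((1 / sqrt (norm A + 1)) *\<^sub>R J)"
    "((1 / sqrt (norm A + 1)) *\<^sub>R J) o\<^sub>L A o\<^sub>L ((1 / sqrt (norm A + 1)) *\<^sub>R J) = id_blinfun"
    by (rule inv_sqrt_construction[OF A]) blast
  then show ?thesis using that inv_sqrt_op_eqI[OF A *(4,3,5)] by blast
qed

text \<open>\<open>B A B = 1\<close> would force \<open>A\<close> to be injective, so no candidate
  exists and the description collapses to one fixed default operator.\<close>

lemma inv_sqrt_op_kernel:
  fixes A :: "'h::real_inner \<Rightarrow>\<^sub>L 'h"
  assumes "A x = 0" "x \<noteq> 0"
  shows "inv_sqrt_op A = (THE B. False)"
proof -
  have "B o\<^sub>L A o\<^sub>L B \<noteq> id_blinfun" for B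
    using inv_sqrt_square(2)[of B A x] assms by auto
  then show ?thesis by (simp add: inv_sqrt_op_def)
qed

lemma coercive_psd_shift:
  assumes "psd_op A"
  shows "coercive_op l (A + l *\<^sub>R id_blinfun)"
  using assms unfolding psd_op_def coercive_op_def selfadjoint_op_def
  by (auto simp: blinfun.add_left blinfun.scaleR_left inner_add)

lemma eigenvalue_le_norm:
  assumes "is_eigenvalue A l"
  shows "l \<le> norm A"
proof -
  obtain x where x: "x \<noteq> 0" "A x = l *\<^sub>R x" using assms by (auto simp: is_eigenvalue_def)
  have "\<bar>l\<bar> * norm x \<le> norm A * norm x" using norm_blinfun[of A x] by (simp add: x)
  then show ?thesis using x(1) by simp
qed

lemma eigenvalue_psd_nonneg:
  fixes A :: "'h::real_inner \<Rightarrow>\<^sub>L 'h"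
  assumes "is_eigenvalue A l" "psd_op A"
  shows "0 \<le> l"
proof -
  obtain x where x: "x \<noteq> 0" "A x = l *\<^sub>R x" using assms by (auto simp: is_eigenvalue_def)
  have "0 \<le> A x \<bullet> x" using assms(2) by (simp add: psd_op_def)
  moreover have "0 < x \<bullet> x" using x(1) by simp
  ultimately show ?thesis by (simp add: x(2) zero_le_mult_iff)
qed

lemma tensor_apply: "tensor v w h = (v \<bullet> h) *\<^sub>R w"
proof -
  have "bounded_linear (\<lambda>h. (v \<bullet> h) *\<^sub>R w)"
    by (rule bounded_linear_compose[OF bounded_linear_scaleR_left bounded_linear_inner_right])
  then show ?thesis by (simp add: tensor_def bounded_linear_Blinfun_apply)
qed

section \<open>Orthonormal bases and compact spectral decompositions\<close>

locale orthonormal_basis =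
  fixes v :: "nat \<Rightarrow> 'h::real_inner"
  assumes orthonormal: "v p \<bullet> v q = (if p = q then 1 else 0)"
    and complete: "closure (span (range v)) = UNIV"
begin

text \<open>The partial sums fix each finite combination once \<open>n\<close> is large and never
  increase norms (Bessel), so density of the span extends convergence to every
  \<open>x\<close>.\<close>

lemma expansion: "(\<lambda>p. (x \<bullet> v p) *\<^sub>R v p) sums x"
proof -
  define Pn where "Pn n x = (\<Sum>p<n. (x \<bullet> v p) *\<^sub>R v p)" for n x
  have Pn_diff: "Pn n (x - y) = Pn n x - Pn n y" for n x y
    by (simp add: Pn_def inner_diff_left scaleR_left_diff_distrib sum_subtractf)
  have inner_Pn: "z \<bullet> Pn n x = (\<Sum>p<n. (x \<bullet> v p) * (z \<bullet> v p))" for n x z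
    by (simp add: Pn_def inner_sum_right)
  have Pn_v: "Pn n x \<bullet> v q = x \<bullet> v q" if "q < n" for n q x
    using that by (simp add: Pn_def inner_sum_left orthonormal if_distrib cong: if_cong)
  have bessel: "norm (Pn n x) \<le> norm x" for n x
  proof -
    have "Pn n x \<bullet> Pn n x = x \<bullet> Pn n x" by (simp add: inner_Pn Pn_v)
    also have "\<dots> \<le> norm x * norm (Pn n x)" by (rule norm_cauchy_schwarz)
    finally show ?thesis
      by (cases "Pn n x = 0") (auto simp: dot_square_norm power2_eq_square)
  qed
  have "\<exists>N. \<forall>n\<ge>N. Pn n y = y" if "y \<in> span (range v)" for y
    using that
  proof (induction rule: span_induct_alt)
    case base show ?case by (simp add: Pn_def)
  next
    case (step c a y)
    then obtain N k where N: "\<forall>n\<ge>N. Pn n y = y" and a: "a = v k" by auto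
    have "Pn n (c *\<^sub>R a + y) = c *\<^sub>R a + y" if "n \<ge> max N (Suc k)" for n
    proof -
      have "Pn n (c *\<^sub>R a + y) = c *\<^sub>R Pn n a + Pn n y"
        by (simp add: Pn_def inner_add_left scaleR_left_distrib sum.distrib scaleR_sum_right)
      moreover have "Pn n a = a"
        using that by (simp add: Pn_def a orthonormal if_distrib[of "\<lambda>c. c *\<^sub>R _"] cong: if_cong)
      ultimately show ?thesis using N that by simp
    qed
    then show ?case by blast
  qed
  note ev = this
  have "(\<lambda>n. Pn n x) \<longlonglongrightarrow> x"
  proof (rule LIMSEQ_I)
    fix e :: real assume e: "e > 0"
    have "x \<in> closure (span (range v))" by (simp add: complete)
    then obtain y where y: "y \<in> span (range v)" "dist y x < e / 2"
      using e closure_approachable by (metis half_gt_zero)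
    then obtain N where N: "\<forall>n\<ge>N. Pn n y = y" using ev by blast
    have "norm (Pn n x - x) < e" if "n \<ge> N" for n
    proof -
      have "Pn n x - x = Pn n (x - y) - (x - y)" using N that by (simp add: Pn_diff)
      also have "norm \<dots> \<le> norm (Pn n (x - y)) + norm (x - y)" by (rule norm_triangle_ineq4)
      also have "\<dots> \<le> 2 * norm (x - y)" using bessel[of n "x - y"] by simp
      also have "\<dots> < e" using y(2) by (simp add: dist_norm norm_minus_commute)
      finally show ?thesis .
    qed
    then show "\<exists>N. \<forall>n\<ge>N. norm (Pn n x - x) < e" by blast
  qed
  then show ?thesis by (simp add: sums_def Pn_def)
qed

lemma parseval: "(\<lambda>p. (x \<bullet> v p) * (y \<bullet> v p)) sums (x \<bullet> y)"
  using bounded_linear.sums[OF bounded_linear_inner_right[of x] expansion[of y]]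
  by (simp add: mult.commute)

lemma parseval_square: "(\<lambda>p. (x \<bullet> v p)\<^sup>2) sums (x \<bullet> x)"
  using parseval[of x x] by (simp add: power2_eq_square)

text \<open>Finitely many coordinates are enough for the later compactness argument, so repeated
  extraction replaces a diagonal sequence.\<close>

lemma coordinates_subseq:
  fixes x :: "nat \<Rightarrow> 'h"
  assumes "\<And>n. norm (x n) \<le> 1"
  shows "\<exists>r. strict_mono r \<and> (\<forall>p<P. convergent (\<lambda>n. x (r n) \<bullet> v p))"
proof (induction P)
  case 0 show ?case by (rule exI[of _ id]) (simp add: strict_mono_def)
next
  case (Suc P)
  then obtain r where r: "strict_mono r" "\<forall>p<P. convergent (\<lambda>n. x (r n) \<bullet> v p)" by blast
  have "norm (v P) = 1" by (simp add: norm_eq_sqrt_inner orthonormal)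
  then have "norm (x (r n) \<bullet> v P) \<le> 1" for n
    using Cauchy_Schwarz_ineq2[of "x (r n)" "v P"] assms[of "r n"] by simp
  then have "bounded (range (\<lambda>n. x (r n) \<bullet> v P))" by (intro boundedI[where B = 1]) auto
  then obtain l s where s: "strict_mono s" "((\<lambda>n. x (r n) \<bullet> v P) \<circ> s) \<longlonglongrightarrow> l"
    using bounded_imp_convergent_subsequence by blast
  have "convergent (\<lambda>n. x ((r \<circ> s) n) \<bullet> v p)" if "p < Suc P" for p
  proof (cases "p = P")
    case True then show ?thesis using s(2) by (auto simp: convergent_def o_def)
  next
    case False
    then show ?thesis using that r(2) convergent_subseq_convergent[OF _ s(1), of "\<lambda>n. x (r n) \<bullet> v p"]
      by (simp add: o_def)
  qed
  then show ?case using strict_mono_o[OF r(1) s(1)] by blast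
qed

end

text \<open>\<open>lam_nonneg\<close>, \<open>lam_lim\<close> and \<open>lam_0\<close> are not
  assumed in (A1) but derived from it in \<open>long_run_variance_spectral\<close>;
  \<open>lam_lim\<close> carries the compactness of \<open>C\<close>.\<close>

locale spectral_decomposition = orthonormal_basis v
  for v :: "nat \<Rightarrow> 'h::{real_inner,banach}" +
  fixes lam :: "nat \<Rightarrow> real" and C :: "'h \<Rightarrow>\<^sub>L 'h"
  assumes lam_decreasing: "\<And>p. lam (Suc p) \<le> lam p"
    and lam_nonneg: "\<And>p. 0 \<le> lam p"
    and lam_lim: "lam \<longlonglongrightarrow> 0"
    and lam_0: "0 < lam 0"
    and spectral: "\<And>h. (\<lambda>p. (lam p * (h \<bullet> v p)) *\<^sub>R v p) sums C h"
begin

lemma lam_antimono: "p \<le> q \<Longrightarrow> lam q \<le> lam p"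
  using lift_Suc_antimono_le[of lam] lam_decreasing by blast

lemma inner_C: "(\<lambda>p. lam p * (x \<bullet> v p) * (y \<bullet> v p)) sums (C x \<bullet> y)"
  using bounded_linear.sums[OF bounded_linear_inner_left[of y] spectral[of x]]
  by (simp add: inner_commute)

lemma C_selfadjoint: "selfadjoint_op C"
  unfolding selfadjoint_op_def
proof safe
  fix x y
  have "(\<lambda>p. lam p * (x \<bullet> v p) * (y \<bullet> v p)) sums (C y \<bullet> x)"
    using inner_C[of y x] by (simp add: ac_simps)
  then show "C x \<bullet> y = x \<bullet> C y" using sums_unique2[OF inner_C] by (simp add: inner_commute)
qed

lemma C_v: "C (v q) = lam q *\<^sub>R v q"
proof -
  have "(\<lambda>p. (lam p * (v q \<bullet> v p)) *\<^sub>R v p) = (\<lambda>p. if p = q then lam q *\<^sub>R v q else 0)"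
    by (auto simp: orthonormal)
  then show ?thesis using spectral[of "v q"] sums_single[of q "\<lambda>p. lam q *\<^sub>R v q"]
    by (simp add: sums_unique2)
qed

lemma C_psd: "psd_op C"
  unfolding psd_op_def
proof (intro conjI allI C_selfadjoint)
  fix x
  have "(\<lambda>p. lam p * (x \<bullet> v p)\<^sup>2) sums (C x \<bullet> x)"
    using inner_C[of x x] by (simp add: power2_eq_square ac_simps)
  from sums_le[OF _ sums_zero this] show "0 \<le> C x \<bullet> x"
    using lam_nonneg by auto
qed

lemma norm_C: "norm C = lam 0"
proof (rule antisym)
  show "norm C \<le> lam 0"
  proof (rule norm_psd_le[OF C_psd])
    fix x
    have "(\<lambda>p. lam p * (x \<bullet> v p)\<^sup>2) sums (C x \<bullet> x)"
      using inner_C[of x x] by (simp add: power2_eq_square ac_simps)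
    moreover have "(\<lambda>p. lam 0 * (x \<bullet> v p)\<^sup>2) sums (lam 0 * (x \<bullet> x))"
      by (intro sums_mult parseval_square)
    ultimately show "C x \<bullet> x \<le> lam 0 * (x \<bullet> x)"
      by (rule sums_le[rotated]) (auto intro!: mult_right_mono lam_antimono)
  qed (rule lam_nonneg)
  have "is_eigenvalue C (lam 0)"
    unfolding is_eigenvalue_def using C_v[of 0] orthonormal[of 0 0]
    by (metis inner_zero_left zero_neq_one)
  then show "lam 0 \<le> norm C" by (rule eigenvalue_le_norm)
qed

definition tail_op :: "nat \<Rightarrow> 'h \<Rightarrow>\<^sub>L 'h" where
  "tail_op P = C - (\<Sum>p<P. lam p *\<^sub>R tensor (v p) (v p))"

lemma tail_op_apply: "tail_op P x = C x - (\<Sum>p<P. (lam p * (x \<bullet> v p)) *\<^sub>R v p)"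
  by (simp add: tail_op_def blinfun.diff_left blinfun.sum_left blinfun.scaleR_left tensor_apply inner_commute)

text \<open>The form of the remainder is a tail of the diagonal series, where every weight is at
  most \<open>lam P\<close>; Parseval bounds the rest. Hence \<open>C\<close> is a norm limit of
  finite rank operators.\<close>

lemma norm_tail_op: "norm (tail_op P) \<le> lam P"
proof (rule norm_psd_le)
  have inner_tail: "(\<lambda>p. lam (p + P) * (x \<bullet> v (p + P)) * (y \<bullet> v (p + P))) sums (tail_op P x \<bullet> y)" for x y
    using sums_split_initial_segment[OF inner_C[of x y], of P]
    by (simp add: tail_op_apply inner_diff_left inner_sum_left inner_commute[of "v _"])
  show "psd_op (tail_op P)" unfolding psd_op_def
  proof safe
    show "selfadjoint_op (tail_op P)" unfolding selfadjoint_op_def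
    proof safe
      fix x y
      have "(\<lambda>p. lam (p + P) * (x \<bullet> v (p + P)) * (y \<bullet> v (p + P))) sums (tail_op P y \<bullet> x)"
        using inner_tail[of y x] by (simp add: ac_simps)
      then show "tail_op P x \<bullet> y = x \<bullet> tail_op P y"
        using sums_unique2[OF inner_tail] by (simp add: inner_commute)
    qed
    fix x
    have "(\<lambda>p. lam (p + P) * (x \<bullet> v (p + P))\<^sup>2) sums (tail_op P x \<bullet> x)"
      using inner_tail[of x x] by (simp add: power2_eq_square ac_simps)
    from sums_le[OF _ sums_zero this] show "0 \<le> tail_op P x \<bullet> x"
      using lam_nonneg by auto
  qed
  fix x
  have 1: "(\<lambda>p. lam (p + P) * (x \<bullet> v (p + P))\<^sup>2) sums (tail_op P x \<bullet> x)"
    using inner_tail[of x x] by (simp add: power2_eq_square ac_simps)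
  have 2: "(\<lambda>p. (x \<bullet> v (p + P))\<^sup>2) sums (x \<bullet> x - (\<Sum>p<P. (x \<bullet> v p)\<^sup>2))"
    using sums_split_initial_segment[OF parseval_square] by simp
  have "tail_op P x \<bullet> x \<le> lam P * (x \<bullet> x - (\<Sum>p<P. (x \<bullet> v p)\<^sup>2))"
    by (rule sums_le[OF _ 1 sums_mult[OF 2]]) (auto intro!: mult_right_mono lam_antimono)
  also have "\<dots> \<le> lam P * (x \<bullet> x)"
    by (intro mult_left_mono lam_nonneg) (simp add: sum_nonneg)
  finally show "tail_op P x \<bullet> x \<le> lam P * (x \<bullet> x)" .
qed (rule lam_nonneg)

text \<open>Operators close to the compact operator \<open>C\<close> need not be compact, but the top of their
  spectrum lies above their essential spectrum.\<close>

lemma norm_is_eigenvalue: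
  fixes A :: "'h \<Rightarrow>\<^sub>L 'h"
  assumes psd: "psd_op A" and d: "norm (A - C) \<le> d" "2 * d < lam 0"
  shows "is_eigenvalue A (norm A)"
proof -
  define s where "s = norm A"
  have "norm C \<le> norm A + norm (A - C)"
    by (metis norm_minus_commute norm_triangle_sub)
  then have s: "lam 0 - d \<le> s" using d by (simp add: s_def norm_C)
  have dn: "0 \<le> d" using d(1) norm_ge_zero order_trans by blast
  have "A \<noteq> 0" using s d dn by (auto simp: s_def)
  then obtain x where x: "\<And>n. norm (x n) = 1" "(\<lambda>n. A (x n) - s *\<^sub>R x n) \<longlonglongrightarrow> 0"
    unfolding s_def using norm_psd_approx[OF psd] by metis
  have "\<forall>\<^sub>F P in sequentially. lam P < s - d"
    using lam_lim by (rule order_tendstoD) (use s d in linarith)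
  then obtain P where P: "lam P < s - d" by (auto simp: eventually_sequentially)
  define g where "g = s - d - lam P"
  have g: "g > 0" using P by (simp add: g_def)
  obtain r where r: "strict_mono r" "\<forall>p<P. convergent (\<lambda>n. x (r n) \<bullet> v p)"
    using coordinates_subseq[of x P] x(1) by auto
  define CP where "CP y = (\<Sum>p<P. (lam p * (y \<bullet> v p)) *\<^sub>R v p)" for y
  \<comment> \<open>\<open>w n\<close> is \<open>s\<close> minus \<open>A - C\<close> minus the tail
    operator, applied to \<open>x (r n)\<close>. As \<open>s \<ge> lam 0 - d > d\<close>, a tail
    with \<open>lam P < s - d\<close> exists and makes that operator bounded below by
    \<open>g\<close>. Convergence of \<open>w\<close>, from finitely many coordinates and a
    vanishing residual, thus makes \<open>x (r n)\<close> itself Cauchy.\<close>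
  define w where "w n = CP (x (r n)) - (A (x (r n)) - s *\<^sub>R x (r n))" for n
  have "convergent (\<lambda>n. CP (x (r n)))"
    unfolding CP_def
  proof (intro convergent_sum)
    fix p assume "p \<in> {..<P}"
    then obtain l where "(\<lambda>n. x (r n) \<bullet> v p) \<longlonglongrightarrow> l" using r(2) by (auto simp: convergent_def)
    then have "(\<lambda>n. (lam p * (x (r n) \<bullet> v p)) *\<^sub>R v p) \<longlonglongrightarrow> (lam p * l) *\<^sub>R v p"
      by (intro tendsto_intros)
    then show "convergent (\<lambda>n. (lam p * (x (r n) \<bullet> v p)) *\<^sub>R v p)" by (auto simp: convergent_def)
  qed
  moreover have sub0: "(\<lambda>n. A (x (r n)) - s *\<^sub>R x (r n)) \<longlonglongrightarrow> 0"
    using LIMSEQ_subseq_LIMSEQ[OF x(2) r(1)] by (simp add: o_def)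
  ultimately have "convergent w" unfolding w_def
    by (intro convergent_diff[OF _ convergentI[OF sub0]])
  then have Cw: "Cauchy w" by (simp add: Cauchy_convergent_iff)
  have low: "g * norm (x (r n) - x (r m)) \<le> norm (w n - w m)" for n m
  proof -
    define y where "y = x (r n) - x (r m)"
    have CPd: "CP (x (r n)) - CP (x (r m)) = CP y"
      by (simp add: CP_def y_def inner_diff_left right_diff_distrib scaleR_left_diff_distrib sum_subtractf)
    have "w n - w m = CP y - (A y - s *\<^sub>R y)"
      using CPd by (simp add: w_def y_def blinfun.diff_right scaleR_right_diff_distrib algebra_simps)
    also have "\<dots> = s *\<^sub>R y - ((A - C) y + tail_op P y)"
      by (simp add: CP_def tail_op_apply blinfun.diff_left)
    finally have eq: "w n - w m = s *\<^sub>R y - ((A - C) y + tail_op P y)" .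
    have "norm ((A - C) y + tail_op P y) \<le> norm (A - C) * norm y + norm (tail_op P) * norm y"
      by (intro norm_triangle_le add_mono norm_blinfun)
    also have "\<dots> \<le> d * norm y + lam P * norm y"
      by (intro add_mono mult_right_mono d norm_tail_op) auto
    finally have "norm (s *\<^sub>R y) - (d * norm y + lam P * norm y) \<le> norm (w n - w m)"
      unfolding eq using norm_triangle_ineq2[of "s *\<^sub>R y" "(A - C) y + tail_op P y"] by linarith
    moreover have "norm (s *\<^sub>R y) = s * norm y" by (simp add: s_def)
    ultimately show ?thesis by (simp add: g_def y_def algebra_simps)
  qed
  have "Cauchy (\<lambda>n. x (r n))"
  proof (rule metric_CauchyI)
    fix e :: real assume "e > 0"
    then have "e * g > 0" using g by simp
    then obtain M where M: "\<And>m n. m \<ge> M \<Longrightarrow> n \<ge> M \<Longrightarrow> dist (w m) (w n) < e * g"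
      using metric_CauchyD[OF Cw] by blast
    have "dist (x (r m)) (x (r n)) < e" if "m \<ge> M" "n \<ge> M" for m n
    proof -
      have "g * dist (x (r m)) (x (r n)) < e * g"
        using low[of m n] M[OF that] by (simp add: dist_norm)
      then show ?thesis using g by (simp add: mult.commute)
    qed
    then show "\<exists>M. \<forall>m\<ge>M. \<forall>n\<ge>M. dist (x (r m)) (x (r n)) < e" by blast
  qed
  then obtain z where z: "(\<lambda>n. x (r n)) \<longlonglongrightarrow> z"
    using Cauchy_convergent_iff convergent_def by blast
  have "(\<lambda>n. A (x (r n)) - s *\<^sub>R x (r n)) \<longlonglongrightarrow> A z - s *\<^sub>R z"
    by (intro tendsto_intros blinfun.tendsto z)
  then have "A z - s *\<^sub>R z = 0" using sub0 LIMSEQ_unique by blast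
  moreover have "norm z = 1"
    using tendsto_norm[OF z] x(1) LIMSEQ_unique[OF _ tendsto_const] by fastforce
  ultimately show ?thesis unfolding is_eigenvalue_def s_def[symmetric]
    by (intro exI[of _ z]) auto
qed

text \<open>The largest eigenvalue is the norm of \<open>A\<close>, and the norm is Lipschitz in the
  operator.\<close>

lemma top_eigenvalue_close:
  assumes "psd_op A" "norm (A - C) \<le> d" "2 * d < lam 0"
    and "is_eigenvalue A l" "\<And>l'. is_eigenvalue A l' \<Longrightarrow> l' \<le> l"
  shows "\<bar>l - lam 0\<bar> \<le> d"
proof -
  have "l = norm A"
    using norm_is_eigenvalue[OF assms(1-3)] assms(4,5) eigenvalue_le_norm
    by (meson antisym)
  moreover have "\<bar>norm A - norm C\<bar> \<le> norm (A - C)" by (rule norm_triangle_ineq3)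
  ultimately show ?thesis using assms(2) by (simp add: norm_C)
qed

section \<open>Consistency of the inverse square root\<close>

definition limit_op :: "'h \<Rightarrow>\<^sub>L 'h" where
  "limit_op = inv_sqrt_op (C + lam 0 *\<^sub>R id_blinfun)"

text \<open>The squared norm is the quadratic form of \<open>limit_op\<close> applied twice. That
  square inverts \<open>C + lam 0\<close> and is diagonal in the basis, so Parseval gives the series
  without computing \<open>limit_op\<close> itself.\<close>

lemma norm_limit_op: "(\<lambda>p. (x \<bullet> v p)\<^sup>2 / (lam p + lam 0)) sums (norm (limit_op x))\<^sup>2"
proof -
  let ?A = "C + lam 0 *\<^sub>R id_blinfun"
  obtain q where B: "coercive_op q limit_op" "limit_op o\<^sub>L ?A o\<^sub>L limit_op = id_blinfun"
    unfolding limit_op_def using inv_sqrt_op_coercive[OF coercive_psd_shift[OF C_psd] lam_0] by metis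
  have pos: "lam p + lam 0 > 0" for p using lam_nonneg[of p] lam_0 by simp
  have "limit_op (limit_op (v p)) = (1 / (lam p + lam 0)) *\<^sub>R v p" for p
  proof -
    have "limit_op (limit_op (?A (v p))) = v p" by (rule inv_sqrt_square(2)[OF B(2)])
    then have "(lam p + lam 0) *\<^sub>R limit_op (limit_op (v p)) = v p"
      by (simp add: blinfun.add_left blinfun.scaleR_left C_v scaleR_left_distrib[symmetric] blinfun.scaleR_right)
    then have "(1 / (lam p + lam 0)) *\<^sub>R ((lam p + lam 0) *\<^sub>R limit_op (limit_op (v p)))
        = (1 / (lam p + lam 0)) *\<^sub>R v p" by simp
    then show ?thesis using pos[of p] by simp
  qed
  then have "limit_op (limit_op x) \<bullet> v p = (x \<bullet> v p) / (lam p + lam 0)" for p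
    using B(1) by (simp add: coercive_op_def selfadjoint_op_def)
  moreover have "limit_op (limit_op x) \<bullet> x = (norm (limit_op x))\<^sup>2"
    using B(1) by (simp add: coercive_op_def selfadjoint_op_def power2_norm_eq_inner)
  ultimately show ?thesis
    using parseval[of "limit_op (limit_op x)" x] by (simp add: power2_eq_square)
qed

text \<open>A deterministic modulus of continuity at \<open>C\<close>: consistency in probability
  passes to the inverse root without selecting subsequences.\<close>

lemma inv_sqrt_op_continuous:
  assumes "e > 0"
  obtains d where "d > 0" and "\<And>A l. psd_op A \<Longrightarrow> norm (A - C) \<le> d \<Longrightarrow> is_eigenvalue A l \<Longrightarrow>
    (\<And>l'. is_eigenvalue A l' \<Longrightarrow> l' \<le> l) \<Longrightarrow>
    norm (inv_sqrt_op (A + l *\<^sub>R id_blinfun) - limit_op) \<le> e"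
proof -
  let ?CL = "C + lam 0 *\<^sub>R id_blinfun"
  define c where "c = lam 0 / 2"
  have c: "c > 0" using lam_0 by (simp add: c_def)
  have coer_mono: "coercive_op c F" if "coercive_op l F" "c \<le> l" for l and F :: "'h \<Rightarrow>\<^sub>L 'h"
    using that unfolding coercive_op_def by (meson inner_ge_zero mult_right_mono order_trans)
  have A0: "coercive_op c ?CL"
    by (rule coer_mono[OF coercive_psd_shift[OF C_psd]]) (use lam_0 in \<open>simp add: c_def\<close>)
  obtain q where q: "q > 0" "coercive_op q limit_op" "limit_op o\<^sub>L ?CL o\<^sub>L limit_op = id_blinfun"
    unfolding limit_op_def using inv_sqrt_op_coercive[OF A0 c] by metis
  \<comment> \<open>The bound \<open>lam 0 / 4\<close> ensures \<open>2 * d < lam 0\<close> and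
    \<open>c \<le> l\<close>; the other one makes an operator error of at most \<open>2 * d\<close>
    cost at most \<open>q * e\<close> after division by \<open>c\<^sup>2\<close>.\<close>
  define d where "d = min (lam 0 / 4) (e * q * c\<^sup>2 / 2)"
  have d: "d > 0" using lam_0 assms q c by (simp add: d_def)
  show ?thesis
  proof (rule that[OF d])
    fix A l assume A: "psd_op A" "norm (A - C) \<le> d" "is_eigenvalue A l"
      "\<And>l'. is_eigenvalue A l' \<Longrightarrow> l' \<le> l"
    let ?A = "A + l *\<^sub>R id_blinfun"
    have "2 * d < lam 0" using lam_0 by (simp add: d_def min_def)
    then have l: "\<bar>l - lam 0\<bar> \<le> d" using top_eigenvalue_close[OF A(1,2) _ A(3,4)] by blast
    have "d \<le> lam 0 / 4" by (simp add: d_def)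
    then have "c \<le> l" using l lam_0 by (simp add: c_def)
    then have cA: "coercive_op c ?A" by (rule coer_mono[OF coercive_psd_shift[OF A(1)]])
    obtain q' where B: "q' > 0" "coercive_op q' (inv_sqrt_op ?A)"
      "inv_sqrt_op ?A o\<^sub>L ?A o\<^sub>L inv_sqrt_op ?A = id_blinfun"
      using inv_sqrt_op_coercive[OF cA c] by metis
    have "0 \<le> inv_sqrt_op ?A x \<bullet> x" for x
      using B(1,2) unfolding coercive_op_def
      by (meson inner_ge_zero less_imp_le mult_nonneg_nonneg order_trans)
    then have B0: "coercive_op 0 (inv_sqrt_op ?A)"
      using B(2) by (simp add: coercive_op_def)
    have "q * norm (inv_sqrt_op ?A - limit_op) \<le> norm (?A - ?CL) / c\<^sup>2"
      using q by (intro inv_sqrt_diff[OF cA A0 c B0 B(3)]) auto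
    also have "norm (?A - ?CL) \<le> 2 * d"
    proof -
      have "?A - ?CL = (A - C) + (l - lam 0) *\<^sub>R id_blinfun" by (simp add: scaleR_left_diff_distrib)
      also have "norm \<dots> \<le> norm (A - C) + norm ((l - lam 0) *\<^sub>R (id_blinfun :: 'h \<Rightarrow>\<^sub>L 'h))"
        by (rule norm_triangle_ineq)
      also have "norm ((l - lam 0) *\<^sub>R (id_blinfun :: 'h \<Rightarrow>\<^sub>L 'h)) \<le> \<bar>l - lam 0\<bar> * 1"
        unfolding norm_scaleR by (intro mult_left_mono norm_blinfun_bound) auto
      finally show ?thesis using A(2) l by simp
    qed
    also have "2 * d \<le> e * q * c\<^sup>2" by (simp add: d_def min_def)
    finally have "q * norm (inv_sqrt_op ?A - limit_op) \<le> q * e"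
      using c by (simp add: divide_right_mono mult.commute)
    then show "norm (inv_sqrt_op ?A - limit_op) \<le> e" using q(1) by simp
  qed
qed

end

section \<open>Measurability of operators, eigenvalues and suprema\<close>

text \<open>The form in which the hypothesis on \<open>Chat\<close> is stated. The operator space is
  in general not separable in norm, so Borel measurability into it would be a stronger
  demand.\<close>

definition strongly_measurable :: "'a measure \<Rightarrow> ('a \<Rightarrow> 'h::real_normed_vector \<Rightarrow>\<^sub>L 'h) \<Rightarrow> bool" where
  "strongly_measurable M F \<longleftrightarrow> (\<forall>h. (\<lambda>\<omega>. F \<omega> h) \<in> borel_measurable M)"

lemma strongly_measurable_apply:
  fixes F :: "'a \<Rightarrow> 'h::{real_normed_vector,second_countable_topology} \<Rightarrow>\<^sub>L 'h"
  assumes F: "strongly_measurable M F" and f: "f \<in> borel_measurable M"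
  shows "(\<lambda>\<omega>. F \<omega> (f \<omega>)) \<in> borel_measurable M"
proof -
  obtain s where s: "\<And>i. simple_function M (s i)" "\<And>x. x \<in> space M \<Longrightarrow> (\<lambda>i. s i x) \<longlonglongrightarrow> f x"
    using borel_measurable_implies_sequence_metric[OF f, of 0] by blast
  show ?thesis
  proof (rule borel_measurable_LIMSEQ_metric)
    fix i
    have "countable (s i ` space M)"
      using s(1)[of i] by (simp add: simple_function_def countable_finite)
    moreover from this have "s i \<in> measurable M (count_space (s i ` space M))"
      using s(1)[of i] by (subst measurable_count_space_eq_countable) (auto simp: simple_function_def)
    ultimately show "(\<lambda>\<omega>. F \<omega> (s i \<omega>)) \<in> borel_measurable M"
      using measurable_compose_countable'[where f = "\<lambda>h \<omega>. F \<omega> h" and g = "s i"] F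
      unfolding strongly_measurable_def by blast
  next
    fix \<omega> assume "\<omega> \<in> space M"
    then show "(\<lambda>i. F \<omega> (s i \<omega>)) \<longlonglongrightarrow> F \<omega> (f \<omega>)"
      by (rule blinfun.tendsto[OF tendsto_const s(2)])
  qed
qed

lemma strongly_measurable_const: "strongly_measurable M (\<lambda>\<omega>. A)"
  by (simp add: strongly_measurable_def)

lemma strongly_measurable_add:
  fixes F :: "'a \<Rightarrow> 'h::{real_normed_vector,second_countable_topology} \<Rightarrow>\<^sub>L 'h"
  assumes "strongly_measurable M F" "strongly_measurable M G"
  shows "strongly_measurable M (\<lambda>\<omega>. F \<omega> + G \<omega>)"
  using assms by (auto simp: strongly_measurable_def blinfun.add_left intro: borel_measurable_add)

lemma strongly_measurable_diff:
  fixes F :: "'a \<Rightarrow> 'h::{real_normed_vector,second_countable_topology} \<Rightarrow>\<^sub>L 'h"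
  assumes "strongly_measurable M F" "strongly_measurable M G"
  shows "strongly_measurable M (\<lambda>\<omega>. F \<omega> - G \<omega>)"
  using assms by (auto simp: strongly_measurable_def blinfun.diff_left intro: borel_measurable_diff)

lemma strongly_measurable_scaleR:
  fixes F :: "'a \<Rightarrow> 'h::{real_normed_vector,second_countable_topology} \<Rightarrow>\<^sub>L 'h"
  assumes "c \<in> borel_measurable M" "strongly_measurable M F"
  shows "strongly_measurable M (\<lambda>\<omega>. c \<omega> *\<^sub>R F \<omega>)"
  using assms by (auto simp: strongly_measurable_def blinfun.scaleR_left intro: borel_measurable_scaleR)

lemma strongly_measurable_compose:
  fixes F :: "'a \<Rightarrow> 'h::{real_normed_vector,second_countable_topology} \<Rightarrow>\<^sub>L 'h"
  assumes "strongly_measurable M F" "strongly_measurable M G"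
  shows "strongly_measurable M (\<lambda>\<omega>. F \<omega> o\<^sub>L G \<omega>)"
  using assms strongly_measurable_apply[OF assms(1)] by (simp add: strongly_measurable_def)

lemma strongly_measurable_LIMSEQ:
  fixes F :: "nat \<Rightarrow> 'a \<Rightarrow> 'h::{real_normed_vector,second_countable_topology} \<Rightarrow>\<^sub>L 'h"
  assumes "\<And>k. strongly_measurable M (F k)" "\<And>\<omega>. \<omega> \<in> space M \<Longrightarrow> (\<lambda>k. F k \<omega>) \<longlonglongrightarrow> G \<omega>"
  shows "strongly_measurable M G"
  unfolding strongly_measurable_def
proof
  fix h
  show "(\<lambda>\<omega>. G \<omega> h) \<in> borel_measurable M"
  proof (rule borel_measurable_LIMSEQ_metric)
    show "(\<lambda>\<omega>. F k \<omega> h) \<in> borel_measurable M" for k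
      using assms(1) by (simp add: strongly_measurable_def)
    show "(\<lambda>k. F k \<omega> h) \<longlonglongrightarrow> G \<omega> h" if "\<omega> \<in> space M" for \<omega>
      by (rule blinfun.tendsto[OF assms(2)[OF that] tendsto_const])
  qed
qed

text \<open>Separability lets an operator bound be tested on a countable dense set, so a sublevel
  set of the norm is a countable intersection.\<close>

lemma borel_measurable_norm_op:
  fixes F :: "'a \<Rightarrow> 'h::{real_normed_vector,second_countable_topology} \<Rightarrow>\<^sub>L 'h"
  assumes F: "strongly_measurable M F"
  shows "(\<lambda>\<omega>. norm (F \<omega>)) \<in> borel_measurable M"
proof -
  obtain D :: "'h set" where D: "countable D" "UNIV \<subseteq> closure D"
    by (rule separable[of "UNIV :: 'h set"])
  have *: "norm (F \<omega>) \<le> c \<longleftrightarrow> 0 \<le> c \<and> (\<forall>h\<in>D. norm (F \<omega> h) \<le> c * norm h)" for \<omega> c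
  proof
    assume "norm (F \<omega>) \<le> c"
    then show "0 \<le> c \<and> (\<forall>h\<in>D. norm (F \<omega> h) \<le> c * norm h)"
      using norm_blinfun[of "F \<omega>"] by (meson mult_right_mono norm_ge_zero order_trans)
  next
    assume R: "0 \<le> c \<and> (\<forall>h\<in>D. norm (F \<omega> h) \<le> c * norm h)"
    have "closed {h. norm (F \<omega> h) \<le> c * norm h}"
      by (intro closed_Collect_le continuous_on_norm continuous_on_mult_left continuous_on_id
          linear_continuous_on[OF blinfun.bounded_linear_right])
    then have "closure D \<subseteq> {h. norm (F \<omega> h) \<le> c * norm h}"
      using R by (intro closure_minimal) auto
    then show "norm (F \<omega>) \<le> c" using D(2) R by (intro norm_blinfun_bound) auto
  qed
  have [measurable]: "(\<lambda>\<omega>. F \<omega> h) \<in> borel_measurable M" for h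
    using F by (simp add: strongly_measurable_def)
  show ?thesis
    unfolding borel_measurable_iff_le *
  proof
    fix c :: real
    have "{\<omega>\<in>space M. \<forall>h\<in>D. norm (F \<omega> h) \<le> c * norm h} \<in> sets M"
      by (intro sets.sets_Collect_countable_All'[OF _ D(1)]) measurable
    then show "{\<omega>\<in>space M. 0 \<le> c \<and> (\<forall>h\<in>D. norm (F \<omega> h) \<le> c * norm h)} \<in> sets M"
      by (cases "0 \<le> c") auto
  qed
qed

section \<open>Existential statements over compact sets\<close>

text \<open>Points of \<open>D\<close> satisfying the \<open>n\<close>-th condition up to
  \<open>1 / Suc n\<close> accumulate, by compactness, at a common witness; monotonicity in
  \<open>n\<close> lets earlier conditions survive in the limit. For countable \<open>D\<close> the
  existential over \<open>I\<close> becomes a countable condition.\<close>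

lemma decreasing_compact_witness:
  fixes f :: "nat \<Rightarrow> 'x::metric_space \<Rightarrow> real"
  assumes I: "compact I" and D: "D \<subseteq> I" "I \<subseteq> closure D"
    and cont: "\<And>n. continuous_on I (f n)"
    and dec: "\<And>n x. x \<in> I \<Longrightarrow> f (Suc n) x \<le> f n x"
  shows "(\<exists>x\<in>I. \<forall>n. r \<le> f n x) \<longleftrightarrow> (\<forall>n. \<exists>x\<in>D. r - 1 / real (Suc n) < f n x)"
proof
  assume "\<exists>x\<in>I. \<forall>n. r \<le> f n x"
  then obtain x where x: "x \<in> I" "\<And>n. r \<le> f n x" by blast
  show "\<forall>n. \<exists>x\<in>D. r - 1 / real (Suc n) < f n x"
  proof
    fix n
    obtain d where d: "d > 0" "\<And>y. y \<in> I \<Longrightarrow> dist y x < d \<Longrightarrow> dist (f n y) (f n x) < 1 / real (Suc n)"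
      using cont[of n] x(1) unfolding continuous_on_iff by (metis of_nat_0_less_iff zero_less_Suc zero_less_divide_1_iff)
    have "x \<in> closure D" using D x(1) by blast
    then obtain y where "y \<in> D" "dist y x < d" using d(1) by (auto simp: closure_approachable)
    then have "y \<in> D" "r - 1 / real (Suc n) < f n y"
      using d(2)[of y] D(1) x(2)[of n] by (auto simp: dist_real_def)
    then show "\<exists>x\<in>D. r - 1 / real (Suc n) < f n x" by blast
  qed
next
  assume "\<forall>n. \<exists>x\<in>D. r - 1 / real (Suc n) < f n x"
  then obtain x where x: "\<And>n. x n \<in> D" "\<And>n. r - 1 / real (Suc n) < f n (x n)" by metis
  have dec': "f n y \<le> f m y" if "m \<le> n" "y \<in> I" for m n y
    using lift_Suc_antimono_le[of "\<lambda>n. f n y", OF dec[OF that(2)] that(1)] .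
  obtain l s where l: "l \<in> I" "strict_mono s" "(x \<circ> s) \<longlonglongrightarrow> l"
    using I x(1) D(1) unfolding compact_def by (metis subsetD)
  have "r \<le> f n l" for n
  proof -
    have 1: "(\<lambda>k. f n (x (s k))) \<longlonglongrightarrow> f n l"
      by (rule continuous_on_tendsto_compose[OF cont[of n] _ l(1)])
        (use l(3) x(1) D(1) in \<open>auto simp: o_def intro!: always_eventually\<close>)
    have "(\<lambda>k. r - 1 / real (Suc k)) \<longlonglongrightarrow> r - 0"
      by (intro tendsto_diff tendsto_const LIMSEQ_Suc[OF lim_const_over_n])
    from LIMSEQ_subseq_LIMSEQ[OF this l(2)]
    have 2: "(\<lambda>k. r - 1 / real (Suc (s k))) \<longlonglongrightarrow> r" by (simp add: o_def)
    have "r - 1 / real (Suc (s k)) \<le> f n (x (s k))" if "n \<le> k" for k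
      using x(2)[of "s k"] dec'[of n "s k" "x (s k)"] seq_suble[OF l(2), of k] that x(1) D(1)
      by force
    then show ?thesis by (intro LIMSEQ_le[OF 2 1]) blast
  qed
  then show "\<exists>x\<in>I. \<forall>n. r \<le> f n x" using l(1) by blast
qed

text \<open>This replaces measurable projection, which would yield measurability only for the
  completed measure.\<close>

lemma sets_compact_witness:
  fixes f :: "nat \<Rightarrow> 'a \<Rightarrow> 'x::{metric_space,second_countable_topology} \<Rightarrow> real"
  assumes I: "compact I" and S: "S \<in> sets M"
    and cont: "\<And>n \<omega>. \<omega> \<in> S \<Longrightarrow> continuous_on I (f n \<omega>)"
    and dec: "\<And>n \<omega> x. \<omega> \<in> S \<Longrightarrow> x \<in> I \<Longrightarrow> f (Suc n) \<omega> x \<le> f n \<omega> x"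
    and meas: "\<And>n x. x \<in> I \<Longrightarrow> (\<lambda>\<omega>. f n \<omega> x) \<in> borel_measurable M"
  shows "{\<omega>\<in>S. \<exists>x\<in>I. \<forall>n. r \<le> f n \<omega> x} \<in> sets M"
proof -
  obtain D where D: "countable D" "D \<subseteq> I" "I \<subseteq> closure D" by (rule separable[of I])
  have "{\<omega>\<in>S. \<exists>x\<in>I. \<forall>n. r \<le> f n \<omega> x}
      = S \<inter> {\<omega>\<in>space M. \<forall>n. \<exists>x\<in>D. r - 1 / real (Suc n) < f n \<omega> x}"
    using decreasing_compact_witness[OF I D(2,3), of "\<lambda>n. f n _"] cont dec sets.sets_into_space[OF S]
    by blast
  also have "\<dots> \<in> sets M"
  proof (intro sets.Int S sets.sets_Collect_countable_All sets.sets_Collect_countable_Ex'[OF _ D(1)])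
    show "{\<omega>\<in>space M. r - 1 / real (Suc n) < f n \<omega> x} \<in> sets M" if "x \<in> D" for n x
    proof -
      have [measurable]: "(\<lambda>\<omega>. f n \<omega> x) \<in> borel_measurable M" using meas D(2) that by blast
      show ?thesis by measurable
    qed
  qed
  finally show ?thesis .
qed

section \<open>Measurability of the largest eigenvalue\<close>

text \<open>For \<open>norm A \<le> K\<close> and \<open>0 \<le> x \<le> K\<close> the scale
  \<open>2 * K\<close> bounds the norm of \<open>A - x\<close>, so the operator lies between 0 and
  1. Squaring puts the value 1 exactly at the spectral point \<open>x\<close>, approached from
  either side.\<close>

definition eig_op :: "real \<Rightarrow> ('h::real_normed_vector \<Rightarrow>\<^sub>L 'h) \<Rightarrow> real \<Rightarrow> 'h \<Rightarrow>\<^sub>L 'h" where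
  "eig_op K A x = id_blinfun - (1 / (2 * K)\<^sup>2) *\<^sub>R ((A - x *\<^sub>R id_blinfun) o\<^sub>L (A - x *\<^sub>R id_blinfun))"

lemma eig_op_psd:
  fixes A :: "'h::real_inner \<Rightarrow>\<^sub>L 'h"
  assumes A: "selfadjoint_op A" "norm A \<le> K" and K: "K > 0" and x: "0 \<le> x" "x \<le> K"
  shows "psd_op (eig_op K A x)" "norm (eig_op K A x) \<le> 1"
proof -
  define G where "G = A - x *\<^sub>R id_blinfun"
  have T: "eig_op K A x y = y - (1 / (2 * K)\<^sup>2) *\<^sub>R G (G y)" for y
    by (simp add: eig_op_def G_def blinfun.diff_left blinfun.scaleR_left)
  have saG: "selfadjoint_op G"
    using A(1) by (simp add: selfadjoint_op_def G_def blinfun.diff_left blinfun.scaleR_left inner_diff)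
  have nG: "norm G \<le> 2 * K"
  proof -
    have "norm G \<le> norm A + norm (x *\<^sub>R (id_blinfun :: 'h \<Rightarrow>\<^sub>L 'h))"
      unfolding G_def by (rule norm_triangle_ineq4)
    also have "norm (x *\<^sub>R (id_blinfun :: 'h \<Rightarrow>\<^sub>L 'h)) \<le> \<bar>x\<bar> * 1"
      unfolding norm_scaleR by (intro mult_left_mono norm_blinfun_bound) auto
    finally show ?thesis using A(2) x by simp
  qed
  have Q: "eig_op K A x y \<bullet> y = y \<bullet> y - (norm (G y) / (2 * K))\<^sup>2" for y
    using saG by (simp add: T inner_diff selfadjoint_op_def power2_norm_eq_inner power_divide)
  have "0 \<le> eig_op K A x y \<bullet> y" for y
  proof -
    have "norm (G y) \<le> 2 * K * norm y"
      using norm_blinfun[of G y] nG by (meson mult_right_mono norm_ge_zero order_trans)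
    then have "norm (G y) / (2 * K) \<le> norm y" using K by (simp add: field_simps)
    then have "(norm (G y) / (2 * K))\<^sup>2 \<le> (norm y)\<^sup>2" using K by (intro power_mono) auto
    then show ?thesis by (simp add: Q power2_norm_eq_inner)
  qed
  then show psd: "psd_op (eig_op K A x)"
    using saG by (simp add: psd_op_def selfadjoint_op_def T inner_diff)
  show "norm (eig_op K A x) \<le> 1"
    by (rule norm_psd_le[OF psd]) (auto simp: Q)
qed

text \<open>The powers of \<open>T = 1 - ((A - x) / 2K)\<^sup>2\<close> converge strongly to the projection onto the eigenspace
  of \<open>A\<close> for \<open>x\<close>, so eigenvalues are detected by quantities depending continuously on \<open>x\<close>.\<close>

lemma is_eigenvalue_iff_powers:
  fixes A :: "'h::{real_inner,banach} \<Rightarrow>\<^sub>L 'h"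
  assumes A: "selfadjoint_op A" "norm A \<le> K" and K: "K > 0" and x: "0 \<le> x" "x \<le> K"
    and D: "closure D = UNIV"
  shows "is_eigenvalue A x \<longleftrightarrow>
    (\<exists>\<phi>\<in>D. \<exists>m. \<forall>n. 1 / real (Suc m) \<le> norm ((blinfun_apply (eig_op K A x) ^^ n) \<phi>))"
proof -
  define T where "T = eig_op K A x"
  define G where "G = A - x *\<^sub>R id_blinfun"
  have T_app: "T y = y - (1 / (2 * K)\<^sup>2) *\<^sub>R G (G y)" for y
    by (simp add: T_def eig_op_def G_def blinfun.diff_left blinfun.scaleR_left)
  have psdT: "psd_op T" and nT: "norm T \<le> 1"
    using eig_op_psd[OF A K x] by (simp_all add: T_def)
  have saT: "T y \<bullet> z = y \<bullet> T z" for y z using psdT by (simp add: psd_op_def selfadjoint_op_def)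
  have saG: "G y \<bullet> z = y \<bullet> G z" for y z
    using A(1) by (simp add: selfadjoint_op_def G_def blinfun.diff_left blinfun.scaleR_left inner_diff)
  let ?T = "\<lambda>n. (blinfun_apply T ^^ n)"
  have saTn: "?T n y \<bullet> z = y \<bullet> ?T n z" for n y z
    by (induction n arbitrary: y z) (simp_all add: saT funpow_swap1)
  have fixT: "T y = y \<longleftrightarrow> A y = x *\<^sub>R y" for y
  proof
    assume "T y = y"
    then have "G (G y) = 0" using K by (simp add: T_app)
    then have "G y \<bullet> G y = 0" using saG[of y "G y"] by simp
    then show "A y = x *\<^sub>R y" by (simp add: G_def blinfun.diff_left blinfun.scaleR_left)
  next
    assume "A y = x *\<^sub>R y"
    then show "T y = y" by (simp add: T_app G_def blinfun.diff_left blinfun.scaleR_left blinfun.zero_right)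
  qed
  show ?thesis unfolding T_def[symmetric]
  proof
    assume "is_eigenvalue A x"
    then obtain y where y: "y \<noteq> 0" "T y = y" by (auto simp: is_eigenvalue_def fixT)
    have Tny: "?T n y = y" for n by (induction n) (simp_all add: y)
    have "y \<in> closure D" by (simp add: D)
    \<comment> \<open>Closeness below \<open>norm y\<close> forces a positive inner product with
      \<open>y\<close>. The self-adjoint powers fix \<open>y\<close> and so preserve this inner
      product, which keeps the images of \<open>\<phi>\<close> away from zero.\<close>
    then obtain \<phi> where phi: "\<phi> \<in> D" "dist \<phi> y < norm y" using y(1)
      by (metis closure_approachable zero_less_norm_iff)
    have pos: "0 < \<phi> \<bullet> y"
    proof -
      have "(y - \<phi>) \<bullet> y \<le> norm (y - \<phi>) * norm y" by (rule norm_cauchy_schwarz)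
      also have "\<dots> < norm y * norm y"
        using phi(2) y(1) by (intro mult_strict_right_mono) (auto simp: dist_norm norm_minus_commute)
      finally show ?thesis by (simp add: inner_diff dot_square_norm power2_eq_square)
    qed
    then have "0 < (\<phi> \<bullet> y) / norm y" using y(1) by simp
    then obtain m where m: "1 / real (Suc m) < (\<phi> \<bullet> y) / norm y"
      using nat_approx_posE by blast
    have "1 / real (Suc m) \<le> norm (?T n \<phi>)" for n
    proof -
      have "\<phi> \<bullet> y = ?T n \<phi> \<bullet> y" by (simp add: saTn Tny)
      also have "\<dots> \<le> norm (?T n \<phi>) * norm y" by (rule norm_cauchy_schwarz)
      finally have "(\<phi> \<bullet> y) / norm y \<le> norm (?T n \<phi>)" using y(1) by (simp add: field_simps)
      then show ?thesis using m by simp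
    qed
    then show "\<exists>\<phi>\<in>D. \<exists>m. \<forall>n. 1 / real (Suc m) \<le> norm (?T n \<phi>)" using phi(1) by blast
  next
    assume "\<exists>\<phi>\<in>D. \<exists>m. \<forall>n. 1 / real (Suc m) \<le> norm (?T n \<phi>)"
    then obtain \<phi> m where low: "\<And>n. 1 / real (Suc m) \<le> norm (?T n \<phi>)" by blast
    define b where "b n = (norm (?T n \<phi>))\<^sup>2" for n
    have "norm (?T (Suc n) \<phi>) \<le> norm (?T n \<phi>)" for n
      using norm_blinfun[of T "?T n \<phi>"] mult_right_mono[OF nT, of "norm (?T n \<phi>)"] by simp
    then have "b (Suc n) \<le> b n" for n unfolding b_def by (intro power_mono) auto
    then have "decseq b" by (simp add: decseq_Suc_iff)
    then have "convergent b" using decseq_convergent[of b 0] by (auto simp: b_def convergent_def)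
    then have Cb: "Cauchy b" by (rule convergent_Cauchy)
    \<comment> \<open>Even powers are used because their inner products are
      \<open>b (n + k)\<close>; convergence of the single real sequence \<open>b\<close> then makes
      \<open>u\<close> Cauchy.\<close>
    define u where "u n = ?T (2 * n) \<phi>" for n
    have u_inner: "u n \<bullet> u k = b (n + k)" for n k
    proof -
      have "u n \<bullet> u k = \<phi> \<bullet> ?T (2 * n) (?T (2 * k) \<phi>)" by (simp add: u_def saTn)
      also have "?T (2 * n) (?T (2 * k) \<phi>) = ?T (n + k) (?T (n + k) \<phi>)"
      proof -
        have "2 * n + 2 * k = (n + k) + (n + k)" by simp
        then show ?thesis by (metis funpow_add o_apply)
      qed
      also have "\<phi> \<bullet> \<dots> = b (n + k)" by (simp add: saTn[symmetric] b_def power2_norm_eq_inner)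
      finally show ?thesis .
    qed
    have "Cauchy u"
    proof (rule metric_CauchyI)
      fix e :: real assume e: "e > 0"
      then have "e\<^sup>2 / 2 > 0" by simp
      then obtain N where N: "\<And>i j. i \<ge> N \<Longrightarrow> j \<ge> N \<Longrightarrow> dist (b i) (b j) < e\<^sup>2 / 2"
        using metric_CauchyD[OF Cb] by blast
      have "dist (u i) (u j) < e" if "i \<ge> N" "j \<ge> N" for i j
      proof -
        have "(dist (u i) (u j))\<^sup>2 = b (i + i) - 2 * b (i + j) + b (j + j)"
          unfolding dist_norm power2_norm_eq_inner
          using u_inner[of i i] u_inner[of i j] u_inner[of j j]
          by (simp add: inner_diff inner_commute)
        also have "\<dots> < e\<^sup>2"
        proof -
          have "dist (b (i + i)) (b (i + j)) < e\<^sup>2 / 2" "dist (b (j + j)) (b (i + j)) < e\<^sup>2 / 2"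
            by (rule N; use that in simp)+
          then show ?thesis unfolding dist_real_def by linarith
        qed
        finally show ?thesis using e by (simp add: power_less_imp_less_base)
      qed
      then show "\<exists>M. \<forall>m\<ge>M. \<forall>n\<ge>M. dist (u m) (u n) < e" by blast
    qed
    then obtain y where y: "u \<longlonglongrightarrow> y" using Cauchy_convergent_iff convergent_def by blast
    have "1 / real (Suc m) \<le> norm (u n)" for n unfolding u_def by (rule low)
    then have "1 / real (Suc m) \<le> norm y"
      by (intro LIMSEQ_le_const[OF tendsto_norm[OF y]]) blast
    then have y0: "y \<noteq> 0" by (auto simp: divide_simps)
    have "(\<lambda>n. T (T (u n))) \<longlonglongrightarrow> T (T y)" by (intro blinfun.tendsto tendsto_const y)
    moreover have "T (T (u n)) = u (Suc n)" for n by (simp add: u_def)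
    ultimately have TT: "T (T y) = y" using LIMSEQ_Suc[OF y] LIMSEQ_unique by fastforce
    \<comment> \<open>The limit is so far fixed only by the square of \<open>T\<close>. The defect
      \<open>z\<close> satisfies \<open>T z = - z\<close>, which positivity of \<open>T\<close>
      excludes unless \<open>z = 0\<close>.\<close>
    define z where "z = T y - y"
    have Tz: "T z = - z" by (simp add: z_def blinfun.diff_right TT)
    have "0 \<le> T z \<bullet> z" using psdT by (simp add: psd_op_def)
    then have "z \<bullet> z \<le> 0" by (simp add: Tz)
    then have "z = 0" by (metis antisym inner_eq_zero_iff inner_ge_zero)
    then have "A y = x *\<^sub>R y" using fixT by (simp add: z_def)
    then show "is_eigenvalue A x" using y0 by (auto simp: is_eigenvalue_def)
  qed
qed

lemma strongly_measurable_eig_op: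
  fixes A :: "'a \<Rightarrow> 'h::{real_inner,second_countable_topology} \<Rightarrow>\<^sub>L 'h"
  assumes "strongly_measurable M A"
  shows "strongly_measurable M (\<lambda>\<omega>. eig_op K (A \<omega>) x)"
  unfolding eig_op_def
  by (intro strongly_measurable_diff strongly_measurable_scaleR strongly_measurable_compose
      strongly_measurable_const assms borel_measurable_const)

lemma continuous_on_eig_op_power:
  "continuous_on S (\<lambda>x. (blinfun_apply (eig_op K A x) ^^ n) \<phi>)"
proof (induction n)
  case (Suc n)
  have "continuous_on S (\<lambda>x. eig_op K A x)"
    unfolding eig_op_def
    by (intro continuous_on_diff continuous_on_const continuous_on_scaleR continuous_on_id
        bounded_bilinear.continuous_on[OF bounded_bilinear_blinfun_compose])
  from blinfun.continuous_on[OF this Suc] show ?case by simp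
qed simp

text \<open>The maximal eigenvalue reaches \<open>c\<close> exactly if some eigenvalue does. On
  events where the norm is at most \<open>Suc K\<close> the candidates fill a compact interval and
  the scale in \<open>eig_op\<close> is constant, so \<open>sets_compact_witness\<close>
  applies.\<close>

lemma borel_measurable_max_eigenvalue:
  fixes A :: "'a \<Rightarrow> 'h::{real_inner,banach,second_countable_topology} \<Rightarrow>\<^sub>L 'h"
  assumes A: "strongly_measurable M A" and psd: "\<And>\<omega>. \<omega> \<in> space M \<Longrightarrow> psd_op (A \<omega>)"
    and l: "\<And>\<omega>. \<omega> \<in> space M \<Longrightarrow> is_eigenvalue (A \<omega>) (l \<omega>)"
    and l_max: "\<And>\<omega> x. \<omega> \<in> space M \<Longrightarrow> is_eigenvalue (A \<omega>) x \<Longrightarrow> x \<le> l \<omega>"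
  shows "l \<in> borel_measurable M"
  unfolding borel_measurable_iff_ge
proof
  fix c :: real
  obtain D :: "'h set" where D: "countable D" "UNIV \<subseteq> closure D"
    by (rule separable[of "UNIV :: 'h set"])
  define S where "S K = {\<omega>\<in>space M. norm (A \<omega>) \<le> real (Suc K)}" for K :: nat
  have [measurable]: "(\<lambda>\<omega>. norm (A \<omega>)) \<in> borel_measurable M" by (rule borel_measurable_norm_op[OF A])
  have S: "S K \<in> sets M" for K unfolding S_def by measurable
  define f where "f K \<phi> n \<omega> x = norm ((blinfun_apply (eig_op (real (Suc K)) (A \<omega>) x) ^^ n) \<phi>)"
    for K :: nat and \<phi> n \<omega> x
  \<comment> \<open>Starting at \<open>max c 0\<close> loses nothing, as eigenvalues of positive
    semidefinite operators are nonnegative.\<close>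
  define I where "I K = {max c 0..real (Suc K)}" for K :: nat
  define E where "E K \<phi> m = {\<omega>\<in>S K. \<exists>x\<in>I K. \<forall>n. 1 / real (Suc m) \<le> f K \<phi> n \<omega> x}" for K \<phi> m
  have E: "E K \<phi> m \<in> sets M" for K \<phi> and m :: nat
    unfolding E_def
  proof (rule sets_compact_witness)
    show "compact (I K)" by (simp add: I_def)
    show "continuous_on (I K) (f K \<phi> n \<omega>)" for n \<omega>
      unfolding f_def by (intro continuous_on_norm continuous_on_eig_op_power)
    show "(\<lambda>\<omega>. f K \<phi> n \<omega> x) \<in> borel_measurable M" for n x
    proof -
      have "(\<lambda>\<omega>. (blinfun_apply (eig_op (real (Suc K)) (A \<omega>) x) ^^ n) \<phi>) \<in> borel_measurable M"
        by (induction n) (auto intro: strongly_measurable_apply[OF strongly_measurable_eig_op[OF A]])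
      then show ?thesis unfolding f_def by (rule measurable_compose[OF _ borel_measurable_norm])
    qed
    fix n \<omega> x assume w: "\<omega> \<in> S K" and x: "x \<in> I K"
    let ?T = "eig_op (real (Suc K)) (A \<omega>) x"
    have "norm ?T \<le> 1"
      using w x psd[of \<omega>] by (intro eig_op_psd) (auto simp: S_def I_def psd_op_def)
    then show "f K \<phi> (Suc n) \<omega> x \<le> f K \<phi> n \<omega> x"
      using norm_blinfun[of ?T "(blinfun_apply ?T ^^ n) \<phi>"]
        mult_right_mono[of "norm ?T" 1 "norm ((blinfun_apply ?T ^^ n) \<phi>)"]
      by (simp add: f_def)
  qed (rule S)
  have "{\<omega>\<in>space M. c \<le> l \<omega>} = (\<Union>K. \<Union>\<phi>\<in>D. \<Union>m. E K \<phi> m)"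
  proof (intro equalityI subsetI)
    fix \<omega> assume "\<omega> \<in> {\<omega>\<in>space M. c \<le> l \<omega>}"
    then have w: "\<omega> \<in> space M" "c \<le> l \<omega>" by auto
    obtain K where K: "norm (A \<omega>) \<le> real K" using real_arch_simple by blast
    have lI: "0 \<le> l \<omega>" "l \<omega> \<le> real (Suc K)"
      using eigenvalue_psd_nonneg[OF l psd] eigenvalue_le_norm[OF l] w K by force+
    have "selfadjoint_op (A \<omega>)" using psd[OF w(1)] by (simp add: psd_op_def)
    then obtain \<phi> m where "\<phi> \<in> D" "\<forall>n. 1 / real (Suc m) \<le> f K \<phi> n \<omega> (l \<omega>)"
      using is_eigenvalue_iff_powers[of "A \<omega>" "real (Suc K)" "l \<omega>" D] l[OF w(1)] lI K D(2)
      by (auto simp: f_def)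
    then have "\<omega> \<in> E K \<phi> m" using w K lI by (auto simp: E_def S_def I_def)
    then show "\<omega> \<in> (\<Union>K. \<Union>\<phi>\<in>D. \<Union>m. E K \<phi> m)" using \<open>\<phi> \<in> D\<close> by blast
  next
    fix \<omega> assume "\<omega> \<in> (\<Union>K. \<Union>\<phi>\<in>D. \<Union>m. E K \<phi> m)"
    then obtain K \<phi> m x where *: "\<phi> \<in> D" "\<omega> \<in> S K" "x \<in> I K" "\<forall>n. 1 / real (Suc m) \<le> f K \<phi> n \<omega> x"
      by (auto simp: E_def)
    then have w: "\<omega> \<in> space M" by (simp add: S_def)
    have "selfadjoint_op (A \<omega>)" using psd[OF w] by (simp add: psd_op_def)
    then have "is_eigenvalue (A \<omega>) x"
      using is_eigenvalue_iff_powers[of "A \<omega>" "real (Suc K)" x D] * D(2)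
      unfolding S_def I_def f_def by auto
    then have "x \<le> l \<omega>" using l_max w by blast
    then show "\<omega> \<in> {\<omega>\<in>space M. c \<le> l \<omega>}" using w *(3) by (simp add: I_def)
  qed
  also have "\<dots> \<in> sets M"
    using D(1) E by (intro sets.countable_UN sets.countable_UN' image_subsetI) auto
  finally show "{\<omega>\<in>space M. c \<le> l \<omega>} \<in> sets M" .
qed

section \<open>Measurability of the inverse square root\<close>

lemma strongly_measurable_sqrt_iter:
  fixes S :: "'a \<Rightarrow> 'h::{real_inner,second_countable_topology} \<Rightarrow>\<^sub>L 'h"
  assumes "strongly_measurable M S"
  shows "strongly_measurable M (\<lambda>\<omega>. sqrt_iter (S \<omega>) k)"
  unfolding sqrt_iter_def
proof (induction k)
  case 0 show ?case using strongly_measurable_const[of M 0] by simp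
next
  case (Suc k)
  then show ?case using assms
    by (auto intro!: strongly_measurable_scaleR strongly_measurable_add strongly_measurable_compose)
qed

lemma strongly_measurable_neumann_iter:
  fixes Z :: "'a \<Rightarrow> 'h::{real_inner,second_countable_topology} \<Rightarrow>\<^sub>L 'h"
  assumes "strongly_measurable M Z"
  shows "strongly_measurable M (\<lambda>\<omega>. neumann_iter (Z \<omega>) k)"
  unfolding neumann_iter_def
proof (induction k)
  case 0 show ?case using strongly_measurable_const[of M 0] by simp
next
  case (Suc k)
  then show ?case using assms
    by (auto intro!: strongly_measurable_add strongly_measurable_compose strongly_measurable_const)
qed

text \<open>The root is a limit of limits: \<open>sqrt_iter\<close> converges to \<open>Z\<close>,
  and \<open>neumann_iter\<close> formed with \<open>Z\<close> converges to \<open>J\<close>. Both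
  use only sums, products and scalars, under which strong measurability is stable.\<close>

lemma strongly_measurable_inv_sqrt_op:
  fixes A :: "'a \<Rightarrow> 'h::{real_inner,banach,second_countable_topology} \<Rightarrow>\<^sub>L 'h"
  assumes A: "strongly_measurable M A"
    and coer: "\<And>\<omega>. \<omega> \<in> space M \<Longrightarrow> \<exists>c>0. coercive_op c (A \<omega>)"
  shows "strongly_measurable M (\<lambda>\<omega>. inv_sqrt_op (A \<omega>))"
proof -
  let ?S = "\<lambda>\<omega>. id_blinfun - (1 / (norm (A \<omega>) + 1)) *\<^sub>R A \<omega>"
  have "\<exists>Z J. sqrt_iter (?S \<omega>) \<longlonglongrightarrow> Z \<and> neumann_iter Z \<longlonglongrightarrow> J \<and>
      inv_sqrt_op (A \<omega>) = (1 / sqrt (norm (A \<omega>) + 1)) *\<^sub>R J" if "\<omega> \<in> space M" for \<omega>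
    using coer[OF that] inv_sqrt_op_limit by metis
  then obtain Z J where *: "\<And>\<omega>. \<omega> \<in> space M \<Longrightarrow> sqrt_iter (?S \<omega>) \<longlonglongrightarrow> Z \<omega>"
    "\<And>\<omega>. \<omega> \<in> space M \<Longrightarrow> neumann_iter (Z \<omega>) \<longlonglongrightarrow> J \<omega>"
    "\<And>\<omega>. \<omega> \<in> space M \<Longrightarrow> inv_sqrt_op (A \<omega>) = (1 / sqrt (norm (A \<omega>) + 1)) *\<^sub>R J \<omega>"
    by metis
  have [measurable]: "(\<lambda>\<omega>. norm (A \<omega>)) \<in> borel_measurable M" by (rule borel_measurable_norm_op[OF A])
  have "strongly_measurable M ?S"
    by (intro strongly_measurable_diff strongly_measurable_scaleR strongly_measurable_const A) measurable
  then have "strongly_measurable M Z"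
    by (intro strongly_measurable_LIMSEQ[OF strongly_measurable_sqrt_iter *(1)])
  then have "strongly_measurable M J"
    by (intro strongly_measurable_LIMSEQ[OF strongly_measurable_neumann_iter *(2)])
  then have "strongly_measurable M (\<lambda>\<omega>. (1 / sqrt (norm (A \<omega>) + 1)) *\<^sub>R J \<omega>)"
    by (intro strongly_measurable_scaleR) measurable
  then show ?thesis
    unfolding strongly_measurable_def by (simp add: *(3) cong: measurable_cong)
qed

text \<open>If \<open>l \<omega> = 0\<close>, the shifted operator has a kernel and \<open>inv_sqrt_op\<close> takes a junk value, which
  is the same for all such \<open>\<omega>\<close>.\<close>

lemma strongly_measurable_inv_sqrt_op_shift:
  fixes A :: "'a \<Rightarrow> 'h::{real_inner,banach,second_countable_topology} \<Rightarrow>\<^sub>L 'h"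
  assumes A: "strongly_measurable M A" and psd: "\<And>\<omega>. \<omega> \<in> space M \<Longrightarrow> psd_op (A \<omega>)"
    and l: "\<And>\<omega>. \<omega> \<in> space M \<Longrightarrow> is_eigenvalue (A \<omega>) (l \<omega>)" and lm: "l \<in> borel_measurable M"
  shows "strongly_measurable M (\<lambda>\<omega>. inv_sqrt_op (A \<omega> + l \<omega> *\<^sub>R id_blinfun))"
proof -
  \<comment> \<open>Replacing the operator by the identity where \<open>l\<close> is not positive
    makes it coercive everywhere, as \<open>strongly_measurable_inv_sqrt_op\<close> demands.\<close>
  define A' where "A' \<omega> = (if 0 < l \<omega> then A \<omega> + l \<omega> *\<^sub>R id_blinfun else id_blinfun)" for \<omega>
  have AA: "strongly_measurable M (\<lambda>\<omega>. A \<omega> + l \<omega> *\<^sub>R id_blinfun)"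
    by (intro strongly_measurable_add strongly_measurable_scaleR strongly_measurable_const A lm)
  have "strongly_measurable M A'"
    unfolding strongly_measurable_def
  proof
    fix h
    have [measurable]: "(\<lambda>\<omega>. (A \<omega> + l \<omega> *\<^sub>R id_blinfun) h) \<in> borel_measurable M"
      using AA by (simp add: strongly_measurable_def)
    note lm[measurable]
    have "(\<lambda>\<omega>. if 0 < l \<omega> then (A \<omega> + l \<omega> *\<^sub>R id_blinfun) h else h) \<in> borel_measurable M" by measurable
    then show "(\<lambda>\<omega>. A' \<omega> h) \<in> borel_measurable M"
      by (rule measurable_cong[THEN iffD1, rotated]) (simp add: A'_def)
  qed
  moreover have "\<exists>c>0. coercive_op c (A' \<omega>)" if "\<omega> \<in> space M" for \<omega>
  proof (cases "0 < l \<omega>")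
    case True
    then show ?thesis using coercive_psd_shift[OF psd[OF that], of "l \<omega>"] by (auto simp: A'_def)
  next
    case False
    then show ?thesis by (intro exI[of _ 1]) (simp add: A'_def coercive_op_def selfadjoint_op_def)
  qed
  ultimately have B: "strongly_measurable M (\<lambda>\<omega>. inv_sqrt_op (A' \<omega>))"
    by (rule strongly_measurable_inv_sqrt_op)
  have eq: "inv_sqrt_op (A \<omega> + l \<omega> *\<^sub>R id_blinfun) = (if 0 < l \<omega> then inv_sqrt_op (A' \<omega>) else (THE B. False))"
    if w: "\<omega> \<in> space M" for \<omega>
  proof (cases "0 < l \<omega>")
    case False
    then have l0: "l \<omega> = 0" using eigenvalue_psd_nonneg[OF l psd] w by force
    obtain x where "x \<noteq> 0" "A \<omega> x = 0" using l[OF w] by (auto simp: is_eigenvalue_def l0)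
    then show ?thesis using inv_sqrt_op_kernel[of "A \<omega>" x] by (simp add: l0)
  qed (simp add: A'_def)
  show ?thesis
    unfolding strongly_measurable_def
  proof
    fix h
    have [measurable]: "(\<lambda>\<omega>. inv_sqrt_op (A' \<omega>) h) \<in> borel_measurable M"
      using B by (simp add: strongly_measurable_def)
    note lm[measurable]
    have "(\<lambda>\<omega>. if 0 < l \<omega> then inv_sqrt_op (A' \<omega>) h else blinfun_apply (THE B. False) h) \<in> borel_measurable M"
      by measurable
    then show "(\<lambda>\<omega>. inv_sqrt_op (A \<omega> + l \<omega> *\<^sub>R id_blinfun) h) \<in> borel_measurable M"
      by (rule measurable_cong[THEN iffD1, rotated]) (simp add: eq)
  qed
qed

section \<open>Measurability of suprema of series\<close>

text \<open>For nonnegative terms \<open>suminf\<close> is the limit of the partial sums or, on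
  divergence, a fixed default value. The complement of the set is a countable union of existential
  conditions on partial sums, each treated by compactness.\<close>

lemma sets_SUP_suminf_le:
  fixes q :: "nat \<Rightarrow> 'a \<Rightarrow> 'x::{metric_space,second_countable_topology} \<Rightarrow> real"
  assumes I: "compact I" and nonneg: "\<And>p \<omega> t. 0 \<le> q p \<omega> t"
    and cont: "\<And>p \<omega>. \<omega> \<in> space M \<Longrightarrow> continuous_on I (q p \<omega>)"
    and meas: "\<And>p t. t \<in> I \<Longrightarrow> (\<lambda>\<omega>. q p \<omega> t) \<in> borel_measurable M"
  shows "{\<omega>\<in>space M. \<forall>t\<in>I. (\<Sum>p. q p \<omega> t) \<le> x} \<in> sets M"
proof -
  define g where "g n \<omega> t = (\<Sum>p<n. q p \<omega> t)" for n \<omega> t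
  have g_mono: "g n \<omega> t \<le> g m \<omega> t" if "n \<le> m" for n m \<omega> t
    unfolding g_def using that nonneg by (intro sum_mono2) auto
  have g_cont: "continuous_on I (g n \<omega>)" if "\<omega> \<in> space M" for n \<omega>
    unfolding g_def by (intro continuous_on_sum cont that)
  have g_meas[measurable]: "(\<lambda>\<omega>. g n \<omega> t) \<in> borel_measurable M" if "t \<in> I" for n t
    unfolding g_def by (intro borel_measurable_sum meas that)
  define F where "F \<omega> t \<longleftrightarrow> summable (\<lambda>p. q p \<omega> t)" for \<omega> t
  define s where "s \<omega> t = (\<Sum>p. q p \<omega> t)" for \<omega> t
  define junk where "junk = (THE s::real. False)"
  have junk: "s \<omega> t = junk" if "\<not> F \<omega> t" for \<omega> t
    using that unfolding F_def s_def junk_def suminf_def by (metis sums_summable)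
  have g_le: "(F \<omega> t \<and> s \<omega> t \<le> y) \<longleftrightarrow> (\<forall>n. g n \<omega> t \<le> y)" for \<omega> t y
  proof
    assume "F \<omega> t \<and> s \<omega> t \<le> y"
    then show "\<forall>n. g n \<omega> t \<le> y"
      unfolding F_def s_def g_def by (meson nonneg order_trans sum_le_suminf finite_lessThan)
  next
    assume *: "\<forall>n. g n \<omega> t \<le> y"
    then have "F \<omega> t" unfolding F_def
      using nonneg by (intro summableI_nonneg_bounded[of _ y]) (auto simp: g_def)
    moreover have "s \<omega> t \<le> y"
      unfolding s_def using * \<open>F \<omega> t\<close> by (intro suminf_le_const) (auto simp: g_def F_def)
    ultimately show "F \<omega> t \<and> s \<omega> t \<le> y" by simp
  qed
  \<comment> \<open>The bound on all \<open>g k\<close> expresses convergence of the series at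
    \<open>t\<close>. The minimum merges both requirements into one sequence of continuous
    functions, decreasing in \<open>k\<close> because the partial sums increase.\<close>
  have witness: "{\<omega>\<in>space M. \<exists>t\<in>I. y \<le> g n \<omega> t \<and> (\<forall>k. g k \<omega> t \<le> m)} \<in> sets M" for y m n
  proof -
    have "{\<omega>\<in>space M. \<exists>t\<in>I. \<forall>k. 0 \<le> min (g n \<omega> t - y) (m - g k \<omega> t)} \<in> sets M"
    proof (rule sets_compact_witness[OF I])
      show "continuous_on I (\<lambda>t. min (g n \<omega> t - y) (m - g k \<omega> t))" if "\<omega> \<in> space M" for k \<omega>
        by (intro continuous_on_min continuous_on_diff continuous_on_const g_cont that)
      show "min (g n \<omega> t - y) (m - g (Suc k) \<omega> t) \<le> min (g n \<omega> t - y) (m - g k \<omega> t)" for k \<omega> t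
        using g_mono[of k "Suc k" \<omega> t] by linarith
      show "(\<lambda>\<omega>. min (g n \<omega> t - y) (m - g k \<omega> t)) \<in> borel_measurable M" if "t \<in> I" for k t
        using g_meas[OF that] by measurable
    qed auto
    moreover have "(\<forall>k. 0 \<le> min (g n \<omega> t - y) (m - g k \<omega> t)) \<longleftrightarrow> y \<le> g n \<omega> t \<and> (\<forall>k. g k \<omega> t \<le> m)" for \<omega> t
      by auto
    ultimately show ?thesis by simp
  qed
  have witness': "{\<omega>\<in>space M. \<exists>t\<in>I. y \<le> g n \<omega> t} \<in> sets M" for y n
    using sets_compact_witness[OF I sets.top, where f = "\<lambda>k. g n" and r = y] g_cont g_meas by simp
  let ?V = "{\<omega>\<in>space M. \<forall>t\<in>I. s \<omega> t \<le> x}"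
  \<comment> \<open>Strict inequalities are unfolded into closed ones with a margin, the form
    accepted by the compact witness argument.\<close>
  have gt: "y < g n \<omega> t \<longleftrightarrow> (\<exists>j. y + 1 / real (Suc j) \<le> g n \<omega> t)" for y n \<omega> t
  proof
    assume "y < g n \<omega> t"
    then obtain j where "1 / real (Suc j) < g n \<omega> t - y" using nat_approx_posE[of "g n \<omega> t - y"] by auto
    then show "\<exists>j. y + 1 / real (Suc j) \<le> g n \<omega> t" by (intro exI[of _ j]) simp
  next
    assume "\<exists>j. y + 1 / real (Suc j) \<le> g n \<omega> t"
    then obtain j where j: "y + 1 / real (Suc j) \<le> g n \<omega> t" ..
    have "0 < 1 / real (Suc j)" by simp
    then show "y < g n \<omega> t" using j by linarith
  qed
  have "space M - ?V \<in> sets M"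
  \<comment> \<open>If the default exceeds \<open>x\<close>, divergent points violate the bound just
    as large sums do, and partial sums alone decide. Otherwise divergent points satisfy it, so a
    violation must also certify convergence through a bound \<open>m\<close>.\<close>
  proof (cases "x < junk")
    case True
    have "s \<omega> t \<le> x \<longleftrightarrow> (\<forall>n. g n \<omega> t \<le> x)" for \<omega> t
      using g_le[of \<omega> t x] junk[of \<omega> t] True by auto
    then have neg: "\<not> s \<omega> t \<le> x \<longleftrightarrow> (\<exists>n j. x + 1 / real (Suc j) \<le> g n \<omega> t)" for \<omega> t
      unfolding gt[symmetric] by (meson not_le)
    have "space M - ?V = {\<omega>\<in>space M. \<exists>t\<in>I. \<not> s \<omega> t \<le> x}" by blast
    also have "\<dots> = (\<Union>n. \<Union>j. {\<omega>\<in>space M. \<exists>t\<in>I. x + 1 / real (Suc j) \<le> g n \<omega> t})"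
      unfolding neg by blast
    also have "\<dots> \<in> sets M" using witness' by blast
    finally show ?thesis .
  next
    case False
    have neg: "\<not> s \<omega> t \<le> x \<longleftrightarrow> (\<exists>n j m. x + 1 / real (Suc j) \<le> g n \<omega> t \<and> (\<forall>k. g k \<omega> t \<le> real m))" for \<omega> t
    proof
      assume *: "\<not> s \<omega> t \<le> x"
      then have F: "F \<omega> t" using junk[of \<omega> t] False by auto
      obtain m :: nat where "s \<omega> t \<le> real m" using real_arch_simple by blast
      then have "\<forall>k. g k \<omega> t \<le> real m" using g_le F by blast
      moreover obtain n where "x < g n \<omega> t" using g_le[of \<omega> t x] * F by (auto simp: not_le)
      ultimately show "\<exists>n j m. x + 1 / real (Suc j) \<le> g n \<omega> t \<and> (\<forall>k. g k \<omega> t \<le> real m)"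
        using gt by blast
    next
      assume "\<exists>n j m. x + 1 / real (Suc j) \<le> g n \<omega> t \<and> (\<forall>k. g k \<omega> t \<le> real m)"
      then obtain n m where "x < g n \<omega> t" "\<forall>k. g k \<omega> t \<le> real m" using gt by blast
      then show "\<not> s \<omega> t \<le> x" using g_le[of \<omega> t x] g_le[of \<omega> t "real m"] by (meson not_le)
    qed
    have "space M - ?V = {\<omega>\<in>space M. \<exists>t\<in>I. \<not> s \<omega> t \<le> x}" by blast
    also have "\<dots> = (\<Union>n. \<Union>j. \<Union>m.
        {\<omega>\<in>space M. \<exists>t\<in>I. x + 1 / real (Suc j) \<le> g n \<omega> t \<and> (\<forall>k. g k \<omega> t \<le> real m)})"
      unfolding neg by blast
    also have "\<dots> \<in> sets M" using witness by blast
    finally show ?thesis .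
  qed
  then have "space M - (space M - ?V) \<in> sets M" by blast
  moreover have "space M - (space M - ?V) = ?V" by blast
  ultimately show ?thesis by (simp add: s_def)
qed

text \<open>Where the series diverges or the supremum is infinite, \<open>suminf\<close> and \<open>Sup\<close> return unspecified
  constants; measurability holds nevertheless, without completing the measure.\<close>

lemma borel_measurable_SUP_suminf:
  fixes q :: "nat \<Rightarrow> 'a \<Rightarrow> 'x::{metric_space,second_countable_topology} \<Rightarrow> real"
  assumes I: "compact I" "I \<noteq> {}" and nonneg: "\<And>p \<omega> t. 0 \<le> q p \<omega> t"
    and cont: "\<And>p \<omega>. \<omega> \<in> space M \<Longrightarrow> continuous_on I (q p \<omega>)"
    and meas: "\<And>p t. t \<in> I \<Longrightarrow> (\<lambda>\<omega>. q p \<omega> t) \<in> borel_measurable M"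
  shows "(\<lambda>\<omega>. SUP t\<in>I. \<Sum>p. q p \<omega> t) \<in> borel_measurable M"
  unfolding borel_measurable_iff_le
proof
  fix x :: real
  define s where "s \<omega> t = (\<Sum>p. q p \<omega> t)" for \<omega> t
  define V where "V x = {\<omega>\<in>space M. \<forall>t\<in>I. s \<omega> t \<le> x}" for x
  have V: "V x \<in> sets M" for x
    unfolding V_def s_def by (rule sets_SUP_suminf_le[OF I(1) nonneg cont meas])
  \<comment> \<open>\<open>Sup\<close> on the reals is the \<open>LEAST\<close> upper bound; for an
    unbounded set that predicate is constantly false, which identifies the default value.\<close>
  define junk where "junk = (LEAST z::real. False)"
  have bdd: "bdd_above (s \<omega> ` I) \<longleftrightarrow> (\<exists>k::nat. \<forall>t\<in>I. s \<omega> t \<le> real k)" for \<omega>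
  proof
    assume "bdd_above (s \<omega> ` I)"
    then obtain y where "\<forall>t\<in>I. s \<omega> t \<le> y" by (auto simp: bdd_above_def)
    then show "\<exists>k::nat. \<forall>t\<in>I. s \<omega> t \<le> real k" using real_arch_simple[of y] by (meson order_trans)
  qed (auto simp: bdd_above_def)
  have "Sup (s \<omega> ` I) \<le> x \<longleftrightarrow>
      (\<forall>t\<in>I. s \<omega> t \<le> x) \<or> (\<not> (\<exists>k::nat. \<forall>t\<in>I. s \<omega> t \<le> real k) \<and> junk \<le> x)" for \<omega>
  proof (cases "bdd_above (s \<omega> ` I)")
    case True
    then show ?thesis using I(2) bdd by (simp add: cSUP_le_iff)
  next
    case False
    then have "\<not> (\<forall>y\<in>s \<omega> ` I. y \<le> z)" for z by (auto simp: bdd_above_def)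
    then have "(\<lambda>z. \<forall>y\<in>s \<omega> ` I. y \<le> z) = (\<lambda>z. False)" by (simp add: fun_eq_iff)
    then have "Sup (s \<omega> ` I) = junk" unfolding Sup_real_def junk_def by simp
    moreover have "\<not> (\<forall>t\<in>I. s \<omega> t \<le> x)" using False by (auto simp: bdd_above_def)
    moreover have "\<not> (\<exists>k::nat. \<forall>t\<in>I. s \<omega> t \<le> real k)" using False unfolding bdd .
    ultimately show ?thesis by metis
  qed
  then have "{\<omega>\<in>space M. Sup (s \<omega> ` I) \<le> x}
      = V x \<union> (if junk \<le> x then space M - (\<Union>k::nat. V (real k)) else {})"
    by (auto simp: V_def)
  also have "\<dots> \<in> sets M" using V by auto
  finally show "{\<omega>\<in>space M. (SUP t\<in>I. \<Sum>p. q p \<omega> t) \<le> x} \<in> sets M" by (simp add: s_def)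
qed

section \<open>Skorokhod continuity\<close>

text \<open>One-sided limits bound the path near each point, and compactness leaves finitely many
  neighbourhoods. Real suprema along paths are informative only with such a bound.\<close>

lemma cadlag01_bounded:
  assumes x: "x \<in> cadlag01"
  shows "bounded (x ` {0..1})"
proof -
  have loc: "\<exists>d>0. bounded (x ` ({0..1} \<inter> {t - d<..<t + d}))" if t: "t \<in> {0..1}" for t
  proof -
    have R: "\<exists>b>t. bounded (x ` ({0..1} \<inter> {t<..<b}))"
    proof (cases "t < 1")
      case True
      then have "(x \<longlongrightarrow> x t) (at_right t)" using x t by (auto simp: cadlag01_def continuous_within)
      then have "\<forall>\<^sub>F s in at_right t. dist (x s) (x t) < 1" by (rule tendstoD) simp
      then obtain b where b: "b > t" "\<And>s. t < s \<Longrightarrow> s < b \<Longrightarrow> dist (x s) (x t) < 1"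
        unfolding eventually_at_right_field by blast
      have "x ` ({0..1} \<inter> {t<..<b}) \<subseteq> ball (x t) 1"
        using b(2) by (auto simp: dist_commute)
      then show ?thesis using b(1) bounded_subset[OF bounded_ball] by blast
    next
      case False
      then have "{0..1} \<inter> {t<..<t+1} = {}" using t by auto
      then show ?thesis by (intro exI[of _ "t + 1"]) simp
    qed
    have L: "\<exists>a<t. bounded (x ` ({0..1} \<inter> {a<..<t}))"
    proof (cases "0 < t")
      case True
      then have "t \<in> {0<..1}" using t by simp
      then obtain l where "(x \<longlongrightarrow> l) (at_left t)" using x unfolding cadlag01_def by blast
      then have "\<forall>\<^sub>F s in at_left t. dist (x s) l < 1" by (rule tendstoD) simp
      then obtain a where a: "a < t" "\<And>s. a < s \<Longrightarrow> s < t \<Longrightarrow> dist (x s) l < 1"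
        unfolding eventually_at_left_field by blast
      have "x ` ({0..1} \<inter> {a<..<t}) \<subseteq> ball l 1"
        using a(2) by (auto simp: dist_commute)
      then show ?thesis using a(1) bounded_subset[OF bounded_ball] by blast
    next
      case False
      then have "{0..1} \<inter> {t-1<..<t} = {}" using t by auto
      then show ?thesis by (intro exI[of _ "t - 1"]) simp
    qed
    obtain a b where ab: "a < t" "t < b" "bounded (x ` ({0..1} \<inter> {t<..<b}))" "bounded (x ` ({0..1} \<inter> {a<..<t}))"
      using R L by blast
    define d where "d = min (t - a) (b - t)"
    have "x ` ({0..1} \<inter> {t - d<..<t + d}) \<subseteq> x ` ({0..1} \<inter> {t<..<b}) \<union> x ` ({0..1} \<inter> {a<..<t}) \<union> x ` {t}"
      unfolding image_Un[symmetric]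
      by (intro image_mono) (auto simp: d_def)
    moreover have "bounded (x ` ({0..1} \<inter> {t<..<b}) \<union> x ` ({0..1} \<inter> {a<..<t}) \<union> x ` {t})"
      using ab by simp
    ultimately have "bounded (x ` ({0..1} \<inter> {t - d<..<t + d}))" by (rule bounded_subset[rotated])
    then show ?thesis using ab by (intro exI[of _ d]) (auto simp: d_def)
  qed
  then obtain d where d: "\<And>t. t \<in> {0..1} \<Longrightarrow> d t > 0"
      "\<And>t. t \<in> {0..1} \<Longrightarrow> bounded (x ` ({0..1} \<inter> {t - d t<..<t + d t}))" by metis
  obtain T where T: "T \<subseteq> {0..1::real}" "finite T" "{0..1} \<subseteq> (\<Union>t\<in>T. {t - d t<..<t + d t})"
  proof (rule compactE_image[of "{0..1::real}" "{0..1}" "\<lambda>t. {t - d t<..<t + d t}"])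
    show "{0..1} \<subseteq> (\<Union>t\<in>{0..1}. {t - d t<..<t + d t})" using d(1) by force
  qed auto
  have "x ` {0..1} \<subseteq> (\<Union>t\<in>T. x ` ({0..1} \<inter> {t - d t<..<t + d t}))" using T(3) by blast
  moreover have "bounded (\<Union>t\<in>T. x ` ({0..1} \<inter> {t - d t<..<t + d t}))"
    using T(1,2) d(2) by (intro bounded_Union) auto
  ultimately show ?thesis by (rule bounded_subset[rotated])
qed

lemma time_changes01_bij:
  assumes "g \<in> time_changes01"
  shows "g ` {0..1} = {0..1}"
proof -
  have g: "strict_mono_on {0..1} g" "continuous_on {0..1} g" "g 0 = 0" "g 1 = 1"
    using assms by (auto simp: time_changes01_def)
  have mono: "g s \<le> g t" if "s \<in> {0..1}" "t \<in> {0..1}" "s \<le> t" for s t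
    using strict_mono_onD[OF g(1), of s t] that by (cases "s = t") auto
  show ?thesis
  proof (intro equalityI subsetI)
    fix u assume "u \<in> g ` {0..1}"
    then obtain t where t: "t \<in> {0..1}" "u = g t" by blast
    then show "u \<in> {0..1}" using mono[of 0 t] mono[of t 1] g by auto
  next
    fix u :: real assume "u \<in> {0..1}"
    then show "u \<in> g ` {0..1}" using IVT'[of g 0 u 1] g by (auto simp: image_iff)
  qed
qed

text \<open>An infimum below \<open>d\<close> provides a time change; reading pointwise bounds off
  its suprema requires these to be bounded above, which \<open>cadlag01_bounded\<close>
  supplies.\<close>

lemma skorokhod_dist_lessE:
  assumes x: "x \<in> cadlag01" and y: "y \<in> cadlag01" and d: "skorokhod_dist x y < d"
  obtains g where "g \<in> time_changes01" "\<And>t. t \<in> {0..1} \<Longrightarrow> \<bar>g t - t\<bar> < d"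
    "\<And>t. t \<in> {0..1} \<Longrightarrow> norm (x (g t) - y t) < d"
proof -
  have "(\<lambda>t. t) \<in> time_changes01" by (auto simp: time_changes01_def strict_mono_on_def)
  then have ne: "time_changes01 \<noteq> {}" by blast
  obtain g where g: "g \<in> time_changes01"
    "max (SUP t\<in>{0..1}. \<bar>g t - t\<bar>) (SUP t\<in>{0..1}. norm (x (g t) - y t)) < d"
    using cInf_lessD[OF _ d[unfolded skorokhod_dist_def]] ne by auto
  have im: "g t \<in> {0..1}" if "t \<in> {0..1}" for t using time_changes01_bij[OF g(1)] that by blast
  have "bounded (x ` {0..1})" "bounded (y ` {0..1})" using x y by (auto intro: cadlag01_bounded)
  then obtain a b where ab: "\<And>t. t \<in> {0..1} \<Longrightarrow> norm (x t) \<le> a" "\<And>t. t \<in> {0..1} \<Longrightarrow> norm (y t) \<le> b"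
    unfolding bounded_iff by (auto simp: image_iff) (metis atLeastAtMost_iff)
  have bdd1: "bdd_above ((\<lambda>t. \<bar>g t - t\<bar>) ` {0..1})"
    by (intro bdd_aboveI[of _ 1]) (use im in \<open>force simp: abs_le_iff\<close>)
  have bdd2: "bdd_above ((\<lambda>t. norm (x (g t) - y t)) ` {0..1})"
  proof (intro bdd_aboveI[of _ "a + b"])
    fix u assume "u \<in> (\<lambda>t. norm (x (g t) - y t)) ` {0..1}"
    then obtain t where t: "t \<in> {0..1}" "u = norm (x (g t) - y t)" by blast
    then show "u \<le> a + b" using norm_triangle_ineq4[of "x (g t)" "y t"] ab(1)[OF im[OF t(1)]] ab(2)[OF t(1)] by linarith
  qed
  show ?thesis
  proof (rule that[OF g(1)])
    fix t :: real assume t: "t \<in> {0..1}"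
    show "\<bar>g t - t\<bar> < d" using cSUP_upper[OF t bdd1] g(2) by simp
    show "norm (x (g t) - y t) < d" using cSUP_upper[OF t bdd2] g(2) by simp
  qed
qed

text \<open>The parameter \<open>a\<close> has two uses: 1 ties the path down at time 1, and 0 with
  the identity operator gives the maximal norm of the path, needed for tightness.\<close>

definition tied_sup :: "('h::real_normed_vector \<Rightarrow>\<^sub>L 'h) \<Rightarrow> real \<Rightarrow> (real \<Rightarrow> 'h) \<Rightarrow> real" where
  "tied_sup R a x = (SUP t\<in>{0..1}. norm (R (x t - (a * t) *\<^sub>R x 1)))"

lemma tied_sup_bdd:
  fixes R :: "'h::real_normed_vector \<Rightarrow>\<^sub>L 'h"
  assumes "bounded (x ` {0..1})"
  shows "bdd_above ((\<lambda>t. norm (R (x t - (a * t) *\<^sub>R x 1))) ` {0..1})"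
proof -
  obtain b where b: "\<And>t. t \<in> {0..1} \<Longrightarrow> norm (x t) \<le> b"
    using assms unfolding bounded_iff by blast
  show ?thesis
  proof (rule bdd_aboveI2)
    fix t :: real assume t: "t \<in> {0..1}"
    have "norm (x t - (a * t) *\<^sub>R x 1) \<le> norm (x t) + norm ((a * t) *\<^sub>R x 1)"
      by (rule norm_triangle_ineq4)
    also have "norm ((a * t) *\<^sub>R x 1) \<le> \<bar>a\<bar> * 1 * norm (x 1)"
      unfolding norm_scaleR abs_mult using t by (intro mult_right_mono mult_left_mono) auto
    finally have "norm (x t - (a * t) *\<^sub>R x 1) \<le> b + \<bar>a\<bar> * norm (x 1)" using b[OF t] by simp
    then have "norm R * norm (x t - (a * t) *\<^sub>R x 1) \<le> norm R * (b + \<bar>a\<bar> * norm (x 1))"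
      by (intro mult_left_mono) auto
    then show "norm (R (x t - (a * t) *\<^sub>R x 1)) \<le> norm R * (b + \<bar>a\<bar> * norm (x 1))"
      using norm_blinfun order_trans by blast
  qed
qed

text \<open>A time change maps \<open>[0,1]\<close> onto itself, so comparing \<open>x\<close> at
  \<open>g t\<close> with \<open>y\<close> at \<open>t\<close> compares the suprema. It fixes 1,
  which controls the endpoint, and it displaces the linear drift by at most \<open>d\<close> times
  \<open>norm (x 1)\<close>, up to the factor \<open>a\<close>.\<close>

lemma tied_sup_skorokhod:
  assumes x: "x \<in> cadlag01" and y: "y \<in> cadlag01" and d: "skorokhod_dist x y < d"
  shows "\<bar>tied_sup R a y - tied_sup R a x\<bar> \<le> norm R * (d + \<bar>a\<bar> * (d * norm (x 1) + d))"
proof -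
  obtain g where g: "g \<in> time_changes01" "\<And>t. t \<in> {0..1} \<Longrightarrow> \<bar>g t - t\<bar> < d"
    "\<And>t. t \<in> {0..1} \<Longrightarrow> norm (x (g t) - y t) < d"
    using skorokhod_dist_lessE[OF assms] by blast
  let ?F = "\<lambda>x t. R (x t - (a * t) *\<^sub>R x 1)"
  define B where "B = norm R * (d + \<bar>a\<bar> * (d * norm (x 1) + d))"
  have g1: "g 1 = 1" using g(1) by (simp add: time_changes01_def)
  have close: "norm (?F x (g t) - ?F y t) \<le> B" if t: "t \<in> {0..1}" for t
  proof -
    have eq: "(x (g t) - (a * g t) *\<^sub>R x 1) - (y t - (a * t) *\<^sub>R y 1)
        = (x (g t) - y t) - a *\<^sub>R ((g t - t) *\<^sub>R x 1 + t *\<^sub>R (x 1 - y 1))"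
      by (simp add: algebra_simps)
    have "norm ((g t - t) *\<^sub>R x 1 + t *\<^sub>R (x 1 - y 1)) \<le> \<bar>g t - t\<bar> * norm (x 1) + \<bar>t\<bar> * norm (x 1 - y 1)"
      by (rule order_trans[OF norm_triangle_ineq]) simp
    also have "\<dots> \<le> d * norm (x 1) + 1 * d"
      using g(2)[OF t] g(3)[of 1] g1 t by (intro add_mono mult_right_mono mult_mono) auto
    finally have "norm (a *\<^sub>R ((g t - t) *\<^sub>R x 1 + t *\<^sub>R (x 1 - y 1))) \<le> \<bar>a\<bar> * (d * norm (x 1) + d)"
      unfolding norm_scaleR by (intro mult_left_mono) auto
    then have "norm ((x (g t) - (a * g t) *\<^sub>R x 1) - (y t - (a * t) *\<^sub>R y 1))
        \<le> d + \<bar>a\<bar> * (d * norm (x 1) + d)"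
      unfolding eq using g(3)[OF t]
        norm_triangle_ineq4[of "x (g t) - y t" "a *\<^sub>R ((g t - t) *\<^sub>R x 1 + t *\<^sub>R (x 1 - y 1))"]
      by linarith
    then have "norm R * norm ((x (g t) - (a * g t) *\<^sub>R x 1) - (y t - (a * t) *\<^sub>R y 1)) \<le> B"
      unfolding B_def by (intro mult_left_mono) auto
    then show ?thesis unfolding blinfun.diff_right[symmetric] using norm_blinfun order_trans by blast
  qed
  have bx: "bdd_above ((\<lambda>t. norm (?F x t)) ` {0..1})" and by': "bdd_above ((\<lambda>t. norm (?F y t)) ` {0..1})"
    using x y by (auto intro!: tied_sup_bdd cadlag01_bounded)
  have "tied_sup R a y \<le> tied_sup R a x + B"
    unfolding tied_sup_def
  proof (rule cSUP_least)
    fix t :: real assume t: "t \<in> {0..1}"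
    have gt: "g t \<in> {0..1}" using time_changes01_bij[OF g(1)] t by blast
    have "norm (?F y t) \<le> norm (?F x (g t)) + B"
      using close[OF t] norm_triangle_ineq3[of "?F x (g t)" "?F y t"] by linarith
    also have "norm (?F x (g t)) \<le> (SUP t\<in>{0..1}. norm (?F x t))" by (rule cSUP_upper[OF gt bx])
    finally show "norm (?F y t) \<le> (SUP t\<in>{0..1}. norm (?F x t)) + B" by simp
  qed simp
  moreover have "tied_sup R a x \<le> tied_sup R a y + B"
    unfolding tied_sup_def
  proof (rule cSUP_least)
    fix u :: real assume "u \<in> {0..1}"
    then obtain t where t: "t \<in> {0..1}" "u = g t" using time_changes01_bij[OF g(1)] by blast
    have "norm (?F x u) \<le> norm (?F y t) + B"
      using close[OF t(1)] norm_triangle_ineq3[of "?F x (g t)" "?F y t"] unfolding t(2) by linarith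
    also have "norm (?F y t) \<le> (SUP t\<in>{0..1}. norm (?F y t))" by (rule cSUP_upper[OF t(1) by'])
    finally show "norm (?F x u) \<le> (SUP t\<in>{0..1}. norm (?F y t)) + B" by simp
  qed simp
  ultimately show ?thesis unfolding B_def by linarith
qed

lemma skorokhod_continuous_tied_sup:
  assumes "continuous_on UNIV \<psi>"
  shows "skorokhod_continuous (\<lambda>x. \<psi> (tied_sup R a x))"
  unfolding skorokhod_continuous_def
proof (intro ballI allI impI)
  fix x :: "real \<Rightarrow> 'a" and e :: real assume x: "x \<in> cadlag01" and e: "e > 0"
  obtain h where h: "h > 0" "\<And>u. dist u (tied_sup R a x) < h \<Longrightarrow> dist (\<psi> u) (\<psi> (tied_sup R a x)) < e"
    using assms e unfolding continuous_on_iff by (metis UNIV_I)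
  define K where "K = norm R * (1 + \<bar>a\<bar> * (norm (x 1) + 1))"
  define c where "c = K + 1"
  have c: "c > 0" unfolding c_def K_def by (intro add_nonneg_pos mult_nonneg_nonneg add_nonneg_nonneg) auto
  show "\<exists>d>0. \<forall>y\<in>cadlag01. skorokhod_dist x y < d \<longrightarrow> \<bar>\<psi> (tied_sup R a y) - \<psi> (tied_sup R a x)\<bar> < e"
  proof (intro exI conjI ballI impI)
    show "h / c > 0" using h c by simp
    fix y assume y: "y \<in> cadlag01" "skorokhod_dist x y < h / c"
    have "\<bar>tied_sup R a y - tied_sup R a x\<bar> \<le> norm R * (h / c + \<bar>a\<bar> * (h / c * norm (x 1) + h / c))"
      by (rule tied_sup_skorokhod[OF x y])
    also have "\<dots> = (h / c) * K" by (simp add: K_def algebra_simps)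
    also have "\<dots> < (h / c) * c" using h c by (intro mult_strict_left_mono) (auto simp: c_def)
    also have "\<dots> = h" using c by simp
    finally show "\<bar>\<psi> (tied_sup R a y) - \<psi> (tied_sup R a x)\<bar> < e"
      using h(2)[of "tied_sup R a y"] by (simp add: dist_real_def)
  qed
qed

section \<open>Multivariate uniqueness of characteristic functions\<close>

definition tilted_distr :: "'a measure \<Rightarrow> ('a \<Rightarrow> real) \<Rightarrow> ('a \<Rightarrow> real) \<Rightarrow> real measure" where
  "tilted_distr M w X = distr (density M (\<lambda>\<omega>. ennreal (w \<omega>))) borel X"

lemma real_distribution_tilted_distr:
  assumes [measurable]: "X \<in> borel_measurable M"
    and w: "\<And>\<omega>. 0 \<le> w \<omega>" "integrable M w" "(\<integral>\<omega>. w \<omega> \<partial>M) = 1"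
  shows "real_distribution (tilted_distr M w X)"
proof -
  have [measurable]: "w \<in> borel_measurable M" using w(2) by simp
  have "(\<integral>\<^sup>+\<omega>. ennreal (w \<omega>) \<partial>M) = 1"
    using w by (subst nn_integral_eq_integral) auto
  then have "prob_space (density M (\<lambda>\<omega>. ennreal (w \<omega>)))"
    by (intro prob_spaceI) (simp add: emeasure_density)
  then have "prob_space (tilted_distr M w X)"
    unfolding tilted_distr_def by (rule prob_space.prob_space_distr) measurable
  then show ?thesis
    by (simp add: real_distribution_def real_distribution_axioms_def tilted_distr_def)
qed

lemma integral_tilted_distr:
  fixes f :: "real \<Rightarrow> 'd::{banach,second_countable_topology}"
  assumes [measurable]: "X \<in> borel_measurable M" "w \<in> borel_measurable M" "f \<in> borel_measurable borel"
    and w: "\<And>\<omega>. 0 \<le> w \<omega>"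
  shows "(\<integral>x. f x \<partial>tilted_distr M w X) = (\<integral>\<omega>. w \<omega> *\<^sub>R f (X \<omega>) \<partial>M)"
proof -
  have "(\<integral>x. f x \<partial>tilted_distr M w X) = (\<integral>\<omega>. f (X \<omega>) \<partial>density M (\<lambda>\<omega>. ennreal (w \<omega>)))"
    unfolding tilted_distr_def by (rule integral_distr) measurable
  also have "\<dots> = (\<integral>\<omega>. w \<omega> *\<^sub>R f (X \<omega>) \<partial>M)"
    by (rule integral_density) (use w in auto)
  finally show ?thesis .
qed

lemma char_tilted_distr:
  assumes [measurable]: "X \<in> borel_measurable M"
    and w: "\<And>\<omega>. 0 \<le> w \<omega>" "integrable M w"
  shows "char (tilted_distr M w X) t
    = Complex (\<integral>\<omega>. w \<omega> * cos (t * X \<omega>) \<partial>M) (\<integral>\<omega>. w \<omega> * sin (t * X \<omega>) \<partial>M)"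
proof -
  have [measurable]: "w \<in> borel_measurable M" using w(2) by simp
  have "char (tilted_distr M w X) t = (CLINT \<omega>|M. w \<omega> *\<^sub>R iexp (t * X \<omega>))"
    unfolding char_def by (rule integral_tilted_distr) (use w in auto)
  moreover have i: "integrable M (\<lambda>\<omega>. w \<omega> *\<^sub>R iexp (t * X \<omega>))"
    by (rule Bochner_Integration.integrable_bound[OF w(2)]) (use w in auto)
  have "Re (CLINT \<omega>|M. w \<omega> *\<^sub>R iexp (t * X \<omega>)) = (\<integral>\<omega>. w \<omega> * cos (t * X \<omega>) \<partial>M)"
    using integral_bounded_linear[OF bounded_linear_Re i] by (simp add: Re_exp)
  moreover have "Im (CLINT \<omega>|M. w \<omega> *\<^sub>R iexp (t * X \<omega>)) = (\<integral>\<omega>. w \<omega> * sin (t * X \<omega>) \<partial>M)"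
    using integral_bounded_linear[OF bounded_linear_Im i] by (simp add: Im_exp)
  ultimately show ?thesis by (simp add: complex_eq_iff)
qed

text \<open>The cosine identity at \<open>t = 0\<close> gives both weights the same mass
  \<open>m\<close>. Normalising by \<open>m\<close> reduces to Levy's theorem; for
  \<open>m = 0\<close> both weights vanish almost everywhere.\<close>

lemma weighted_Levy_uniqueness:
  fixes X :: "'a \<Rightarrow> real" and Y :: "'b \<Rightarrow> real"
  assumes X[measurable]: "X \<in> borel_measurable M" and Y[measurable]: "Y \<in> borel_measurable N"
    and w: "\<And>\<omega>. 0 \<le> w \<omega>" "integrable M w" and w': "\<And>\<omega>. 0 \<le> w' \<omega>" "integrable N w'"
    and cos: "\<And>t. (\<integral>\<omega>. w \<omega> * cos (t * X \<omega>) \<partial>M) = (\<integral>\<omega>. w' \<omega> * cos (t * Y \<omega>) \<partial>N)"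
    and sin: "\<And>t. (\<integral>\<omega>. w \<omega> * sin (t * X \<omega>) \<partial>M) = (\<integral>\<omega>. w' \<omega> * sin (t * Y \<omega>) \<partial>N)"
    and A[measurable]: "A \<in> sets borel"
  shows "(\<integral>\<omega>. w \<omega> * indicator A (X \<omega>) \<partial>M) = (\<integral>\<omega>. w' \<omega> * indicator A (Y \<omega>) \<partial>N)"
proof -
  have [measurable]: "w \<in> borel_measurable M" "w' \<in> borel_measurable N" using w(2) w'(2) by simp_all
  define m where "m = (\<integral>\<omega>. w \<omega> \<partial>M)"
  have m': "(\<integral>\<omega>. w' \<omega> \<partial>N) = m" using cos[of 0] by (simp add: m_def)
  show ?thesis
  proof (cases "m = 0")
    case True
    have "AE \<omega> in M. w \<omega> = 0"
      using integral_nonneg_eq_0_iff_AE[OF w(2)] w(1) True by (simp add: m_def)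
    then have "(\<integral>\<omega>. w \<omega> * indicator A (X \<omega>) \<partial>M) = (\<integral>\<omega>. 0 \<partial>M)" by (intro integral_cong_AE) auto
    moreover have "AE \<omega> in N. w' \<omega> = 0"
      using integral_nonneg_eq_0_iff_AE[OF w'(2)] w'(1) True m' by simp
    then have "(\<integral>\<omega>. w' \<omega> * indicator A (Y \<omega>) \<partial>N) = (\<integral>\<omega>. 0 \<partial>N)" by (intro integral_cong_AE) auto
    ultimately show ?thesis by simp
  next
    case False
    have "0 \<le> m" unfolding m_def by (intro Bochner_Integration.integral_nonneg w)
    then have m: "m > 0" using False by simp
    let ?w = "\<lambda>\<omega>. w \<omega> / m" and ?w' = "\<lambda>\<omega>. w' \<omega> / m"
    have nw: "0 \<le> ?w \<omega>" for \<omega> using m w(1) by auto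
    have nw': "0 \<le> ?w' \<omega>" for \<omega> using m w'(1) by auto
    have i: "integrable M ?w" "integrable N ?w'" using w(2) w'(2) by auto
    have I: "(\<integral>\<omega>. ?w \<omega> \<partial>M) = 1" "(\<integral>\<omega>. ?w' \<omega> \<partial>N) = 1" using m m' by (simp_all add: m_def)
    have "char (tilted_distr M ?w X) = char (tilted_distr N ?w' Y)"
      by (rule ext) (simp add: char_tilted_distr[OF X nw i(1)] char_tilted_distr[OF Y nw' i(2)] cos sin)
    then have eq: "tilted_distr M ?w X = tilted_distr N ?w' Y"
      by (intro Levy_uniqueness real_distribution_tilted_distr X Y nw nw' i I)
    have "(\<integral>\<omega>. ?w \<omega> *\<^sub>R (indicator A (X \<omega>) :: real) \<partial>M) = (\<integral>\<omega>. ?w' \<omega> *\<^sub>R indicator A (Y \<omega>) \<partial>N)"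
      using integral_tilted_distr[where w = ?w, OF X _ _ nw, where f = "indicator A :: real \<Rightarrow> real"]
        integral_tilted_distr[where w = ?w', OF Y _ _ nw', where f = "indicator A :: real \<Rightarrow> real"] by (simp add: eq)
    then show ?thesis using m by simp
  qed
qed

lemma integral_cos_shift:
  assumes M: "prob_space M" and [measurable]: "S \<in> borel_measurable M"
  shows "(\<integral>\<omega>. cos (S \<omega> + \<theta>) \<partial>M)
    = cos \<theta> * Re (CLINT \<omega>|M. iexp (S \<omega>)) - sin \<theta> * Im (CLINT \<omega>|M. iexp (S \<omega>))"
proof -
  interpret prob_space M by fact
  have i: "integrable M (\<lambda>\<omega>. iexp (S \<omega>))" by (rule integrable_const_bound[of _ 1]) auto
  have c: "integrable M (\<lambda>\<omega>. cos (S \<omega>))" "integrable M (\<lambda>\<omega>. sin (S \<omega>))"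
    by (rule integrable_const_bound[of _ 1]; auto)+
  have "(\<integral>\<omega>. cos (S \<omega> + \<theta>) \<partial>M) = (\<integral>\<omega>. cos \<theta> * cos (S \<omega>) - sin \<theta> * sin (S \<omega>) \<partial>M)"
    by (simp add: cos_add mult.commute)
  also have "\<dots> = cos \<theta> * (\<integral>\<omega>. cos (S \<omega>) \<partial>M) - sin \<theta> * (\<integral>\<omega>. sin (S \<omega>) \<partial>M)"
    using c by simp
  finally show ?thesis
    using integral_bounded_linear[OF bounded_linear_Re i] integral_bounded_linear[OF bounded_linear_Im i]
    by (simp add: Re_exp Im_exp)
qed

text \<open>Product-to-sum formulas rewrite the tilted cosine and sine integrals as integrals of
  \<open>P\<close> against single shifted cosines, the family covered by the induction hypothesis of
  \<open>cramer_wold_indicators\<close>. A sine is a cosine shifted by \<open>pi/2\<close>.\<close>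

lemma integral_tilt_trig:
  assumes M: "prob_space M"
    and [measurable]: "P \<in> borel_measurable M" "F \<in> borel_measurable M" "Z \<in> borel_measurable M"
    and P: "\<And>\<omega>. 0 \<le> P \<omega>" "\<And>\<omega>. P \<omega> \<le> (1::real)"
  shows "(\<integral>\<omega>. (P \<omega> * (1 + cos (F \<omega> + \<theta>))) * cos (t * Z \<omega>) \<partial>M)
      = (\<integral>\<omega>. P \<omega> * cos (t * Z \<omega> + 0) \<partial>M) + (\<integral>\<omega>. P \<omega> * cos (F \<omega> + t * Z \<omega> + \<theta>) \<partial>M) / 2
        + (\<integral>\<omega>. P \<omega> * cos (F \<omega> + (- t) * Z \<omega> + \<theta>) \<partial>M) / 2" (is ?cos)
    and "(\<integral>\<omega>. (P \<omega> * (1 + cos (F \<omega> + \<theta>))) * sin (t * Z \<omega>) \<partial>M)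
      = (\<integral>\<omega>. P \<omega> * cos (t * Z \<omega> + - (pi/2)) \<partial>M) + (\<integral>\<omega>. P \<omega> * cos (F \<omega> + t * Z \<omega> + (\<theta> - pi/2)) \<partial>M) / 2
        - (\<integral>\<omega>. P \<omega> * cos (F \<omega> + (- t) * Z \<omega> + (\<theta> - pi/2)) \<partial>M) / 2" (is ?sin)
    and "integrable M (\<lambda>\<omega>. P \<omega> * (1 + cos (F \<omega> + \<theta>)))"
    and "A \<in> sets borel \<Longrightarrow> (\<integral>\<omega>. indicator A (Z \<omega>) * P \<omega> * cos (F \<omega> + \<theta>) \<partial>M)
      = (\<integral>\<omega>. (P \<omega> * (1 + cos (F \<omega> + \<theta>))) * indicator A (Z \<omega>) \<partial>M) - (\<integral>\<omega>. P \<omega> * indicator A (Z \<omega>) \<partial>M)"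
proof -
  interpret prob_space M by fact
  have i: "integrable M (\<lambda>\<omega>. P \<omega> * h \<omega>)" if [measurable]: "h \<in> borel_measurable M" and h: "\<And>\<omega>. \<bar>h \<omega>\<bar> \<le> 2" for h
  proof (rule integrable_const_bound[of _ 2])
    have "P \<omega> * \<bar>h \<omega>\<bar> \<le> 1 * 2" for \<omega> using P[of \<omega>] h[of \<omega>] by (intro mult_mono) auto
    then show "AE \<omega> in M. norm (P \<omega> * h \<omega>) \<le> 2" using P by (simp add: abs_mult)
  qed measurable
  have c1: "\<bar>cos x\<bar> \<le> 2" for x :: real using abs_cos_le_one[of x] by linarith
  have c2: "\<bar>1 + cos x\<bar> \<le> 2" for x :: real using abs_cos_le_one[of x] by linarith
  have ic: "integrable M (\<lambda>\<omega>. P \<omega> * cos (h \<omega>))" if [measurable]: "h \<in> borel_measurable M" for h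
    by (rule i) (auto intro: c1)
  have sc: "sin x = cos (x - pi/2)" for x :: real by (simp add: cos_diff)
  have e1: "(P \<omega> * (1 + cos (F \<omega> + \<theta>))) * cos (t * Z \<omega>) = P \<omega> * cos (t * Z \<omega> + 0)
      + P \<omega> * cos (F \<omega> + t * Z \<omega> + \<theta>) / 2 + P \<omega> * cos (F \<omega> + (- t) * Z \<omega> + \<theta>) / 2" for \<omega>
  proof -
    have "cos (F \<omega> + \<theta>) * cos (t * Z \<omega>) = cos (F \<omega> + t * Z \<omega> + \<theta>) / 2 + cos (F \<omega> + (- t) * Z \<omega> + \<theta>) / 2"
    proof -
      have "F \<omega> + t * Z \<omega> + \<theta> = (F \<omega> + \<theta>) + t * Z \<omega>" "F \<omega> + (- t) * Z \<omega> + \<theta> = (F \<omega> + \<theta>) - t * Z \<omega>"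
        by simp_all
      then show ?thesis
        unfolding cos_add[of "F \<omega> + \<theta>" "t * Z \<omega>"] cos_diff[of "F \<omega> + \<theta>" "t * Z \<omega>"]
        by (simp only: cos_add[of "F \<omega> + \<theta>" "t * Z \<omega>"] cos_diff[of "F \<omega> + \<theta>" "t * Z \<omega>"]) argo
    qed
    then show ?thesis by (simp add: algebra_simps)
  qed
  show ?cos unfolding e1 by (subst Bochner_Integration.integral_add Bochner_Integration.integral_diff; (simp add: ic)?)+
  have e2: "(P \<omega> * (1 + cos (F \<omega> + \<theta>))) * sin (t * Z \<omega>) = P \<omega> * cos (t * Z \<omega> + - (pi/2))
      + P \<omega> * cos (F \<omega> + t * Z \<omega> + (\<theta> - pi/2)) / 2 - P \<omega> * cos (F \<omega> + (- t) * Z \<omega> + (\<theta> - pi/2)) / 2" for \<omega>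
  proof -
    have s: "cos (t * Z \<omega> + - (pi/2)) = sin (t * Z \<omega>)"
      "cos (F \<omega> + t * Z \<omega> + (\<theta> - pi/2)) = sin (F \<omega> + \<theta> + t * Z \<omega>)"
      "cos (F \<omega> + (- t) * Z \<omega> + (\<theta> - pi/2)) = sin (F \<omega> + \<theta> - t * Z \<omega>)"
      unfolding sc by (simp_all add: algebra_simps)
    show ?thesis
      unfolding s sin_add[of "F \<omega> + \<theta>" "t * Z \<omega>"] sin_diff[of "F \<omega> + \<theta>" "t * Z \<omega>"]
      by (simp add: field_simps)
  qed
  show ?sin unfolding e2 by (subst Bochner_Integration.integral_add Bochner_Integration.integral_diff; (simp add: ic)?)+
  show iw: "integrable M (\<lambda>\<omega>. P \<omega> * (1 + cos (F \<omega> + \<theta>)))"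
    by (rule i) (auto intro: c2)
  assume [measurable]: "A \<in> sets borel"
  have ind: "\<bar>(1 + cos x) * indicator A y\<bar> \<le> 2" "\<bar>indicator A y :: real\<bar> \<le> 2" for x y :: real
    using c2[of x] by (auto simp: indicator_def)
  have "integrable M (\<lambda>\<omega>. P \<omega> * ((1 + cos (F \<omega> + \<theta>)) * indicator A (Z \<omega>)))"
    "integrable M (\<lambda>\<omega>. P \<omega> * indicator A (Z \<omega>))"
    by (rule i; use ind in simp)+
  then show "(\<integral>\<omega>. indicator A (Z \<omega>) * P \<omega> * cos (F \<omega> + \<theta>) \<partial>M)
      = (\<integral>\<omega>. (P \<omega> * (1 + cos (F \<omega> + \<theta>))) * indicator A (Z \<omega>) \<partial>M) - (\<integral>\<omega>. P \<omega> * indicator A (Z \<omega>) \<partial>M)"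
    by (subst Bochner_Integration.integral_diff[symmetric]) (simp_all add: algebra_simps)
qed

text \<open>A multivariate form of Levy's uniqueness theorem. Cosines are replaced by indicators one
  coordinate at a time; the weight \<open>1 + cos\<close> keeps the tilted measures nonnegative.\<close>

lemma cramer_wold_indicators:
  fixes X :: "'i \<Rightarrow> 'a \<Rightarrow> real" and Y :: "'i \<Rightarrow> 'b \<Rightarrow> real"
  assumes M: "prob_space M" and N: "prob_space N"
    and X[measurable]: "\<And>i. X i \<in> borel_measurable M" and Y[measurable]: "\<And>i. Y i \<in> borel_measurable N"
    and char: "\<And>K u. finite K \<Longrightarrow>
      (CLINT \<omega>|M. iexp (\<Sum>k\<in>K. u k * X k \<omega>)) = (CLINT \<omega>|N. iexp (\<Sum>k\<in>K. u k * Y k \<omega>))"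
    and J: "finite J" and A: "\<And>j. j \<in> J \<Longrightarrow> A j \<in> sets borel" and K: "finite K"
  shows "(\<integral>\<omega>. (\<Prod>j\<in>J. indicator (A j) (X j \<omega>)) * cos ((\<Sum>k\<in>K. u k * X k \<omega>) + \<theta>) \<partial>M)
    = (\<integral>\<omega>. (\<Prod>j\<in>J. indicator (A j) (Y j \<omega>)) * cos ((\<Sum>k\<in>K. u k * Y k \<omega>) + \<theta>) \<partial>N)"
  using J A K
proof (induction J arbitrary: K u \<theta> rule: finite_induct)
  case empty
  have [measurable]: "(\<lambda>\<omega>. \<Sum>k\<in>K. u k * X k \<omega>) \<in> borel_measurable M"
    "(\<lambda>\<omega>. \<Sum>k\<in>K. u k * Y k \<omega>) \<in> borel_measurable N" by measurable
  show ?case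
    using integral_cos_shift[OF M, of "\<lambda>\<omega>. \<Sum>k\<in>K. u k * X k \<omega>" \<theta>]
      integral_cos_shift[OF N, of "\<lambda>\<omega>. \<Sum>k\<in>K. u k * Y k \<omega>" \<theta>] char[OF empty(2), of u]
    by simp
next
  case (insert j J)
  interpret M: prob_space M by fact
  interpret N: prob_space N by fact
  have [measurable]: "A j \<in> sets borel" "\<And>i. i \<in> J \<Longrightarrow> A i \<in> sets borel" using insert.prems by auto
  define P where "P \<omega> = (\<Prod>j\<in>J. indicator (A j) (X j \<omega>) :: real)" for \<omega>
  define Q where "Q \<omega> = (\<Prod>j\<in>J. indicator (A j) (Y j \<omega>) :: real)" for \<omega>
  define f where "f = (\<lambda>\<omega>. \<Sum>k\<in>K. u k * X k \<omega>)"
  define g where "g = (\<lambda>\<omega>. \<Sum>k\<in>K. u k * Y k \<omega>)"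
  have [measurable]: "f \<in> borel_measurable M" "g \<in> borel_measurable N" "P \<in> borel_measurable M" "Q \<in> borel_measurable N"
    unfolding f_def g_def P_def Q_def by measurable
  have P: "0 \<le> P \<omega>" "P \<omega> \<le> 1" for \<omega>
    unfolding P_def by (auto intro!: prod_nonneg prod_le_1 simp: indicator_def)
  have Q: "0 \<le> Q \<omega>" "Q \<omega> \<le> 1" for \<omega>
    unfolding Q_def by (auto intro!: prod_nonneg prod_le_1 simp: indicator_def)
  have PQ: "(\<integral>\<omega>. P \<omega> * cos ((\<Sum>k\<in>L. c k * X k \<omega>) + \<phi>) \<partial>M) = (\<integral>\<omega>. Q \<omega> * cos ((\<Sum>k\<in>L. c k * Y k \<omega>) + \<phi>) \<partial>N)"
    if "finite L" for L c \<phi>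
    unfolding P_def Q_def by (rule insert.IH) (use insert.prems that in auto)
  \<comment> \<open>The frequency \<open>t\<close> of the new coordinate is merged into the linear
    form; the two conditional coefficients allow \<open>j\<close> to lie in \<open>K\<close>
    already.\<close>
  have shift: "(\<integral>\<omega>. P \<omega> * cos (f \<omega> + t * X j \<omega> + \<phi>) \<partial>M) = (\<integral>\<omega>. Q \<omega> * cos (g \<omega> + t * Y j \<omega> + \<phi>) \<partial>N)" for t \<phi>
  proof -
    have "(\<Sum>k\<in>insert j K. ((if k \<in> K then u k else 0) + (if k = j then t else 0)) * z k)
        = (\<Sum>k\<in>K. u k * z k) + t * z j" for z :: "'i \<Rightarrow> real"
    proof -
      have "(\<Sum>k\<in>insert j K. ((if k \<in> K then u k else 0) + (if k = j then t else 0)) * z k)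
          = (\<Sum>k\<in>insert j K. (if k \<in> K then u k * z k else 0)) + (\<Sum>k\<in>insert j K. (if k = j then t * z k else 0))"
        by (subst sum.distrib[symmetric]) (intro sum.cong; auto simp: algebra_simps)
      moreover have "(\<Sum>k\<in>insert j K. (if k \<in> K then u k * z k else 0)) = (\<Sum>k\<in>K. u k * z k)"
        using insert.prems(2) by (intro sum.mono_neutral_cong_right) auto
      moreover have "(\<Sum>k\<in>insert j K. (if k = j then t * z k else 0)) = t * z j"
        using insert.prems(2) by (simp add: sum.delta)
      ultimately show ?thesis by simp
    qed
    then show ?thesis
      using PQ[of "insert j K" "\<lambda>k. (if k \<in> K then u k else 0) + (if k = j then t else 0)" \<phi>] insert.prems(2)
      by (simp add: f_def g_def)
  qed
  have shift0: "(\<integral>\<omega>. P \<omega> * cos (t * X j \<omega> + \<phi>) \<partial>M) = (\<integral>\<omega>. Q \<omega> * cos (t * Y j \<omega> + \<phi>) \<partial>N)" for t \<phi>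
    using PQ[of "{j}" "\<lambda>_. t" \<phi>] by simp
  have int1: "integrable M P" "integrable N Q"
    using P Q by (auto intro!: M.integrable_const_bound[of _ 1] N.integrable_const_bound[of _ 1])
  have XY: "X j \<in> borel_measurable M" "Y j \<in> borel_measurable N" by measurable
  have fg: "f \<in> borel_measurable M" "g \<in> borel_measurable N" "P \<in> borel_measurable M" "Q \<in> borel_measurable N" by measurable
  note tM = integral_tilt_trig[OF M fg(3,1) XY(1) P] and tN = integral_tilt_trig[OF N fg(4,2) XY(2) Q]
  have nonneg: "0 \<le> P \<omega> * (1 + cos x)" "0 \<le> Q \<omega>' * (1 + cos x)" for \<omega> \<omega>' and x :: real
proof -
    have "0 \<le> 1 + cos x" using cos_ge_minus_one[of x] by linarith
    then show "0 \<le> P \<omega> * (1 + cos x)" "0 \<le> Q \<omega>' * (1 + cos x)"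
      using P(1) Q(1) by (auto intro!: mult_nonneg_nonneg)
  qed
  \<comment> \<open>The indicator of coordinate \<open>j\<close> is inserted twice, with weight
    \<open>P\<close> and with weight \<open>P (1 + cos)\<close>. Subtracting leaves the signed
    weight \<open>P cos\<close>, to which the uniqueness theorem does not apply directly.\<close>
  have "(\<integral>\<omega>. P \<omega> * indicator (A j) (X j \<omega>) \<partial>M) = (\<integral>\<omega>. Q \<omega> * indicator (A j) (Y j \<omega>) \<partial>N)"
  proof (rule weighted_Levy_uniqueness[OF XY P(1) int1(1) Q(1) int1(2)])
    show "(\<integral>\<omega>. P \<omega> * cos (t * X j \<omega>) \<partial>M) = (\<integral>\<omega>. Q \<omega> * cos (t * Y j \<omega>) \<partial>N)" for t
      using shift0[of t 0] by simp
    show "(\<integral>\<omega>. P \<omega> * sin (t * X j \<omega>) \<partial>M) = (\<integral>\<omega>. Q \<omega> * sin (t * Y j \<omega>) \<partial>N)" for t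
      using shift0[of t "- (pi/2)"] by (simp add: cos_diff)
  qed measurable
  moreover have "(\<integral>\<omega>. (P \<omega> * (1 + cos (f \<omega> + \<theta>))) * indicator (A j) (X j \<omega>) \<partial>M)
      = (\<integral>\<omega>. (Q \<omega> * (1 + cos (g \<omega> + \<theta>))) * indicator (A j) (Y j \<omega>) \<partial>N)"
    by (rule weighted_Levy_uniqueness[OF XY nonneg(1) tM(3) nonneg(2) tN(3)])
      (simp_all only: tM(1,2) tN(1,2) shift shift0 \<open>A j \<in> sets borel\<close>)
  ultimately have "(\<integral>\<omega>. indicator (A j) (X j \<omega>) * P \<omega> * cos (f \<omega> + \<theta>) \<partial>M)
      = (\<integral>\<omega>. indicator (A j) (Y j \<omega>) * Q \<omega> * cos (g \<omega> + \<theta>) \<partial>N)"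
    by (simp only: tM(4) tN(4) \<open>A j \<in> sets borel\<close>)
  then show ?case using insert.hyps by (simp add: P_def Q_def f_def g_def)
qed

text \<open>With the cosine factor trivial, the indicator identity gives equal probabilities of
  cylinder sets, which determine a finite measure on the product space.\<close>

lemma cramer_wold:
  fixes X :: "'i \<Rightarrow> 'a \<Rightarrow> real" and Y :: "'i \<Rightarrow> 'b \<Rightarrow> real"
  assumes M: "prob_space M" and N: "prob_space N"
    and X: "\<And>i. X i \<in> borel_measurable M" and Y: "\<And>i. Y i \<in> borel_measurable N"
    and char: "\<And>K u. finite K \<Longrightarrow>
      (CLINT \<omega>|M. iexp (\<Sum>k\<in>K. u k * X k \<omega>)) = (CLINT \<omega>|N. iexp (\<Sum>k\<in>K. u k * Y k \<omega>))"
  shows "distr M (PiM UNIV (\<lambda>_. borel)) (\<lambda>\<omega> i. X i \<omega>) = distr N (PiM UNIV (\<lambda>_. borel)) (\<lambda>\<omega> i. Y i \<omega>)"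
proof -
  interpret M: prob_space M by fact
  interpret N: prob_space N by fact
  have mX: "(\<lambda>\<omega> i. X i \<omega>) \<in> measurable M (PiM UNIV (\<lambda>_. borel))"
    and mY: "(\<lambda>\<omega> i. Y i \<omega>) \<in> measurable N (PiM UNIV (\<lambda>_. borel))"
    using X Y by (auto intro!: measurable_PiM_single')
  show ?thesis
  proof (rule measure_eqI_PiM_infinite)
    show "finite_measure (distr M (PiM UNIV (\<lambda>_. borel)) (\<lambda>\<omega> i. X i \<omega>))"
      using M.prob_space_distr[OF mX] by (simp add: prob_space_def)
    fix A :: "'i \<Rightarrow> real set" and J assume J: "finite J" "J \<subseteq> UNIV" and A: "\<And>i. i \<in> J \<Longrightarrow> A i \<in> sets borel"
    let ?E = "prod_emb UNIV (\<lambda>_. borel) J (Pi\<^sub>E J A)"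
    have E: "?E \<in> sets (PiM UNIV (\<lambda>_. borel))"
      using J A by (intro sets_PiM_I) auto
    have "measure M ((\<lambda>\<omega> i. X i \<omega>) -` ?E \<inter> space M) = (\<integral>\<omega>. (\<Prod>j\<in>J. indicator (A j) (X j \<omega>)) \<partial>M)"
    proof -
      have "measure M ((\<lambda>\<omega> i. X i \<omega>) -` ?E \<inter> space M) = (\<integral>\<omega>. indicator ((\<lambda>\<omega> i. X i \<omega>) -` ?E \<inter> space M) \<omega> \<partial>M)"
        by simp
      also have "\<dots> = (\<integral>\<omega>. (\<Prod>j\<in>J. indicator (A j) (X j \<omega>)) \<partial>M)"
        using J(1) by (intro Bochner_Integration.integral_cong)
          (auto simp: indicator_def prod_emb_def space_PiM PiE_iff intro!: prod_zero prod.neutral)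
      finally show ?thesis .
    qed
    moreover have "measure N ((\<lambda>\<omega> i. Y i \<omega>) -` ?E \<inter> space N) = (\<integral>\<omega>. (\<Prod>j\<in>J. indicator (A j) (Y j \<omega>)) \<partial>N)"
    proof -
      have "measure N ((\<lambda>\<omega> i. Y i \<omega>) -` ?E \<inter> space N) = (\<integral>\<omega>. indicator ((\<lambda>\<omega> i. Y i \<omega>) -` ?E \<inter> space N) \<omega> \<partial>N)"
        by simp
      also have "\<dots> = (\<integral>\<omega>. (\<Prod>j\<in>J. indicator (A j) (Y j \<omega>)) \<partial>N)"
        using J(1) by (intro Bochner_Integration.integral_cong)
          (auto simp: indicator_def prod_emb_def space_PiM PiE_iff intro!: prod_zero prod.neutral)
      finally show ?thesis .
    qed
    moreover have "(\<integral>\<omega>. (\<Prod>j\<in>J. indicat_real (A j) (X j \<omega>)) \<partial>M) = (\<integral>\<omega>. (\<Prod>j\<in>J. indicat_real (A j) (Y j \<omega>)) \<partial>N)"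
      using cramer_wold_indicators[where A = A and K = "{}" and \<theta> = 0, OF M N X Y char J(1) A] by simp
    ultimately show "emeasure (distr M (PiM UNIV (\<lambda>_. borel)) (\<lambda>\<omega> i. X i \<omega>)) ?E
        = emeasure (distr N (PiM UNIV (\<lambda>_. borel)) (\<lambda>\<omega> i. Y i \<omega>)) ?E"
      by (simp add: emeasure_distr[OF mX E] emeasure_distr[OF mY E] M.emeasure_eq_measure N.emeasure_eq_measure)
  qed simp_all
qed

section \<open>Gaussian families and the long-run covariance\<close>

lemma char_centered_normal:
  assumes N: "prob_space N" and X: "centered_normal N X v" and v: "0 \<le> v"
  shows "(CLINT \<omega>|N. iexp (X \<omega>)) = exp (- v / 2)"
proof (cases "v = 0")
  case True
  interpret prob_space N by fact
  have [measurable]: "X \<in> borel_measurable N" and ae: "AE \<omega> in N. X \<omega> = 0"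
    using X True by (auto simp: centered_normal_def)
  have "(CLINT \<omega>|N. iexp (X \<omega>)) = (CLINT \<omega>|N. 1)"
    by (rule integral_cong_AE) (use ae in \<open>auto elim: eventually_mono\<close>)
  then show ?thesis using True by (simp add: prob_space)
next
  case False
  interpret prob_space N by fact
  define \<sigma> where "\<sigma> = sqrt v"
  have \<sigma>: "0 < \<sigma>" "\<sigma>\<^sup>2 = v" using False v by (auto simp: \<sigma>_def)
  have "distributed N lborel X (normal_density 0 \<sigma>)"
    using X False by (simp add: centered_normal_def \<sigma>_def)
  from normal_density_affine[OF this, of "1 / \<sigma>" 0]
  have Z: "distributed N lborel (\<lambda>\<omega>. X \<omega> / \<sigma>) std_normal_density" using \<sigma> by simp
  then have [measurable]: "(\<lambda>\<omega>. X \<omega> / \<sigma>) \<in> borel_measurable N"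
    using distributed_measurable by fastforce
  have "char std_normal_distribution \<sigma> = (CLINT x|distr N lborel (\<lambda>\<omega>. X \<omega> / \<sigma>). iexp (\<sigma> * x))"
    using distributed_distr_eq_density[OF Z] by (simp add: char_def)
  also have "\<dots> = (CLINT \<omega>|N. iexp (\<sigma> * (X \<omega> / \<sigma>)))"
    by (rule integral_distr) measurable
  also have "\<dots> = (CLINT \<omega>|N. iexp (X \<omega>))" using \<sigma> by simp
  finally show ?thesis by (simp add: char_std_normal_distribution \<sigma>)
qed

lemma brownian_bridge_combination:
  fixes J :: "'j set"
  assumes B: "is_brownian_bridge N B" and J: "finite J" and t: "\<And>j. j \<in> J \<Longrightarrow> t j \<in> {0..1}"
  shows "centered_normal N (\<lambda>\<omega>. \<Sum>j\<in>J. c j * B \<omega> (t j))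
    (\<Sum>j\<in>J. \<Sum>l\<in>J. c j * c l * (min (t j) (t l) - t j * t l))"
proof -
  obtain h where h: "bij_betw h {0..<card J} J" using ex_bij_betw_nat_finite[OF J] by blast
  have re: "(\<Sum>j<card J. f (h j)) = (\<Sum>j\<in>J. f j)" for f :: "'j \<Rightarrow> real"
    using sum.reindex_bij_betw[OF h, of f] by (simp add: atLeast0LessThan)
  have "\<forall>j<card J. t (h j) \<in> {0..1}"
    using t bij_betwE[OF h] by auto
  then have "centered_normal N (\<lambda>\<omega>. \<Sum>j<card J. c (h j) * B \<omega> (t (h j)))
    (\<Sum>j<card J. \<Sum>l<card J. c (h j) * c (h l) * (min (t (h j)) (t (h l)) - t (h j) * t (h l)))"
    using B[unfolded is_brownian_bridge_def, THEN conjunct2, THEN conjunct2, rule_format, of "card J" "\<lambda>j. t (h j)" "\<lambda>j. c (h j)"]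
    by blast
  then show ?thesis
    by (simp only: re[of "\<lambda>j. c j * B _ (t j)"] re[of "\<lambda>l. c _ * c l * (min (t _) (t l) - t _ * t l)"]
        re[of "\<lambda>j. \<Sum>l\<in>J. c j * c l * (min (t j) (t l) - t j * t l)"])
qed

lemma H_brownian_motion_combination:
  fixes W :: "'a \<Rightarrow> real \<Rightarrow> 'h::{real_inner,banach,second_countable_topology}"
  assumes W: "is_H_brownian_motion N W C" and J: "finite J" and t: "\<And>j. j \<in> J \<Longrightarrow> t j \<in> {0..1}"
  shows "centered_normal N (\<lambda>\<omega>. \<Sum>j\<in>J. W \<omega> (t j) \<bullet> h j)
    (\<Sum>j\<in>J. \<Sum>l\<in>J. min (t j) (t l) * (C (h j) \<bullet> h l))"
proof -
  obtain g where g: "bij_betw g {0..<card J} J" using ex_bij_betw_nat_finite[OF J] by blast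
  have re: "(\<Sum>j<card J. f (g j)) = (\<Sum>j\<in>J. f j)" for f :: "'b \<Rightarrow> real"
    using sum.reindex_bij_betw[OF g, of f] by (simp add: atLeast0LessThan)
  have "\<forall>j<card J. t (g j) \<in> {0..1}"
    using t bij_betwE[OF g] by auto
  then have "centered_normal N (\<lambda>\<omega>. \<Sum>j<card J. W \<omega> (t (g j)) \<bullet> h (g j))
    (\<Sum>j<card J. \<Sum>l<card J. min (t (g j)) (t (g l)) * (C (h (g j)) \<bullet> h (g l)))"
    using W[unfolded is_H_brownian_motion_def, THEN conjunct2, THEN conjunct2, rule_format, of "card J" "\<lambda>j. t (g j)" "\<lambda>j. h (g j)"]
    by blast
  then show ?thesis
    by (simp only: re[of "\<lambda>j. W _ (t j) \<bullet> h j"] re[of "\<lambda>l. min (t _) (t l) * (C (h _) \<bullet> h l)"]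
        re[of "\<lambda>j. \<Sum>l\<in>J. min (t j) (t l) * (C (h j) \<bullet> h l)"])
qed

text \<open>The extra index \<open>None\<close>, with time 1 and vector minus the sum of the
  \<open>t j *\<^sub>R h j\<close>, turns tying down into one combination of values of
  \<open>W\<close>. The three contributions involving time 1 are -1, -1 and +1 times the same form,
  which produces the term \<open>- t j * t l\<close>.\<close>

lemma tied_down_brownian_motion_combination:
  fixes W :: "'a \<Rightarrow> real \<Rightarrow> 'h::{real_inner,banach,second_countable_topology}"
  assumes W: "is_H_brownian_motion N W C" and C: "selfadjoint_op C"
    and J: "finite J" and t: "\<And>j. j \<in> J \<Longrightarrow> t j \<in> {0..1}"
  shows "centered_normal N (\<lambda>\<omega>. \<Sum>j\<in>J. (W \<omega> (t j) - t j *\<^sub>R W \<omega> 1) \<bullet> h j)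
    (\<Sum>j\<in>J. \<Sum>l\<in>J. (min (t j) (t l) - t j * t l) * (C (h j) \<bullet> h l))"
proof -
  define s where "s = (\<Sum>j\<in>J. t j *\<^sub>R h j)"
  let ?t = "case_option 1 t" and ?h = "case_option (- s) h" and ?J = "insert None (Some ` J)"
  have sumJ: "(\<Sum>j\<in>?J. f j) = f None + (\<Sum>j\<in>J. f (Some j))" for f :: "'b option \<Rightarrow> real"
    using J by (simp add: sum.reindex)
  have sym: "C s \<bullet> h l = C (h l) \<bullet> s" for l
    using C by (simp add: selfadjoint_op_def inner_commute)
  have Cs: "(\<Sum>j\<in>J. t j * (C (h j) \<bullet> y)) = C s \<bullet> y" for y
    by (simp add: s_def blinfun.sum_right blinfun.scaleR_right inner_sum_left)
  have "centered_normal N (\<lambda>\<omega>. \<Sum>j\<in>?J. W \<omega> (?t j) \<bullet> ?h j)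
    (\<Sum>j\<in>?J. \<Sum>l\<in>?J. min (?t j) (?t l) * (C (?h j) \<bullet> ?h l))"
    by (rule H_brownian_motion_combination[OF W]) (use J t in auto)
  moreover have "(\<Sum>j\<in>?J. W \<omega> (?t j) \<bullet> ?h j) = (\<Sum>j\<in>J. (W \<omega> (t j) - t j *\<^sub>R W \<omega> 1) \<bullet> h j)" for \<omega>
    unfolding sumJ by (simp add: s_def inner_diff_left sum_subtractf inner_sum_right)
  moreover have "(\<Sum>j\<in>?J. \<Sum>l\<in>?J. min (?t j) (?t l) * (C (?h j) \<bullet> ?h l))
      = (\<Sum>j\<in>J. \<Sum>l\<in>J. (min (t j) (t l) - t j * t l) * (C (h j) \<bullet> h l))"
  proof -
    have m: "min 1 (t l) = t l" "min (t l) 1 = t l" if "l \<in> J" for l using t[OF that] by auto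
    have 1: "(\<Sum>l\<in>J. min 1 (t l) * (C (- s) \<bullet> h l)) = - (C s \<bullet> s)"
    proof -
      have "(\<Sum>l\<in>J. min 1 (t l) * (C (- s) \<bullet> h l)) = (\<Sum>l\<in>J. - (t l * (C (h l) \<bullet> s)))"
        by (intro sum.cong) (simp_all add: m blinfun.minus_right sym)
      then show ?thesis by (simp add: sum_negf Cs)
    qed
    have 2: "(\<Sum>j\<in>J. min (t j) 1 * (C (h j) \<bullet> (- s))) = - (C s \<bullet> s)"
    proof -
      have "(\<Sum>j\<in>J. min (t j) 1 * (C (h j) \<bullet> (- s))) = (\<Sum>l\<in>J. - (t l * (C (h l) \<bullet> s)))"
        by (intro sum.cong) (simp_all add: m)
      then show ?thesis by (simp add: sum_negf Cs)
    qed
    have 3: "(\<Sum>j\<in>J. \<Sum>l\<in>J. t j * t l * (C (h j) \<bullet> h l)) = C s \<bullet> s"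
    proof -
      have "(\<Sum>j\<in>J. \<Sum>l\<in>J. t j * t l * (C (h j) \<bullet> h l)) = (\<Sum>l\<in>J. t l * (\<Sum>j\<in>J. t j * (C (h j) \<bullet> h l)))"
        unfolding sum_distrib_left by (subst sum.swap) (simp add: ac_simps)
      then show ?thesis by (simp add: Cs sym)
    qed
    show ?thesis
      unfolding sumJ option.case sum.distrib 1 2
      by (simp add: 3 left_diff_distrib sum_subtractf blinfun.minus_right)
  qed
  ultimately show ?thesis by simp
qed

text \<open>The kernel is the Gram matrix in \<open>L^2\<close> of the functions \<open>f j\<close>,
  the indicator of \<open>[0, t j]\<close> minus its mean on \<open>[0,1]\<close>. It supplies the
  nonnegative variance that \<open>char_centered_normal\<close> requires.\<close>

lemma bridge_kernel_psd:
  fixes J :: "'j set" and t c :: "'j \<Rightarrow> real"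
  assumes "finite J" and t: "\<And>j. j \<in> J \<Longrightarrow> t j \<in> {0..1}"
  shows "0 \<le> (\<Sum>j\<in>J. \<Sum>l\<in>J. c j * c l * (min (t j) (t l) - t j * t l))"
proof -
  define f where "f j s = indicator {0..t j} s - t j * indicator {0..1} s" for j :: 'j and s :: real
  have f_prod: "f j s * f l s = indicator {0..min (t j) (t l)} s - t l * indicator {0..t j} s
      - t j * indicator {0..t l} s + t j * t l * indicator {0..1} s" if "j \<in> J" "l \<in> J" for j l and s :: real
    using t[OF that(1)] t[OF that(2)] by (auto simp: f_def indicator_def algebra_simps)
  have ind: "integrable lborel (\<lambda>s. indicator {0..a::real} s :: real)" for a :: real
    by (rule integrable_real_indicator) (auto simp: emeasure_lborel_Icc_eq)
  have int: "integrable lborel (\<lambda>s. f j s * f l s)" if "j \<in> J" "l \<in> J" for j l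
    unfolding f_prod[OF that] by (intro Bochner_Integration.integrable_add Bochner_Integration.integrable_diff integrable_mult_right ind)
  have f_int: "(\<integral>s. f j s * f l s \<partial>lborel) = min (t j) (t l) - t j * t l" if "j \<in> J" "l \<in> J" for j l
    unfolding f_prod[OF that] using t[OF that(1)] t[OF that(2)]
    by (simp add: ind)
  have "0 \<le> (\<integral>s. (\<Sum>j\<in>J. c j * f j s)\<^sup>2 \<partial>lborel)" by (rule Bochner_Integration.integral_nonneg) simp
  also have "\<dots> = (\<integral>s. (\<Sum>j\<in>J. \<Sum>l\<in>J. c j * c l * (f j s * f l s)) \<partial>lborel)"
    by (simp add: power2_eq_square sum_product ac_simps)
  also have "\<dots> = (\<Sum>j\<in>J. \<Sum>l\<in>J. c j * c l * (\<integral>s. f j s * f l s \<partial>lborel))"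
    using int by (subst Bochner_Integration.integral_sum; (simp add: Bochner_Integration.integral_sum)?)+
  also have "\<dots> = (\<Sum>j\<in>J. \<Sum>l\<in>J. c j * c l * (min (t j) (t l) - t j * t l))"
    by (intro sum.cong refl) (simp add: f_int)
  finally show ?thesis .
qed

text \<open>The variance of a combination of the variables \<open>sqrt (lam p)\<close> times bridge
  \<open>p\<close> at time \<open>t j\<close>, with index pairs \<open>(p, j)\<close>. It determines
  the characteristic functions of both families compared below.\<close>

definition bridge_form :: "(nat \<Rightarrow> real) \<Rightarrow> (nat \<Rightarrow> real) \<Rightarrow> (nat \<times> nat) set \<Rightarrow> (nat \<times> nat \<Rightarrow> real) \<Rightarrow> real" where
  "bridge_form lam t K u = (\<Sum>k\<in>K. \<Sum>l\<in>K. u k * u l * (if fst k = fst l then lam (fst k) else 0)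
        * (min (t (snd k)) (t (snd l)) - t (snd k) * t (snd l)))"

lemma bridge_form_blocks:
  assumes K: "finite K" and lam: "\<And>p. 0 \<le> lam p"
  shows "bridge_form lam t K u = (\<Sum>p\<in>fst ` K. \<Sum>k\<in>{k\<in>K. fst k = p}. \<Sum>l\<in>{l\<in>K. fst l = p}.
      (u k * sqrt (lam p)) * (u l * sqrt (lam p)) * (min (t (snd k)) (t (snd l)) - t (snd k) * t (snd l)))"
proof -
  let ?f = "\<lambda>k l. u k * u l * (if fst k = fst l then lam (fst k) else 0)
        * (min (t (snd k)) (t (snd l)) - t (snd k) * t (snd l))"
  have "bridge_form lam t K u = (\<Sum>p\<in>fst ` K. \<Sum>k\<in>{k\<in>K. fst k = p}. \<Sum>l\<in>K. ?f k l)"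
    unfolding bridge_form_def by (rule sum.image_gen[OF K])
  also have "\<dots> = (\<Sum>p\<in>fst ` K. \<Sum>k\<in>{k\<in>K. fst k = p}. \<Sum>l\<in>{l\<in>K. fst l = p}.
      (u k * sqrt (lam p)) * (u l * sqrt (lam p)) * (min (t (snd k)) (t (snd l)) - t (snd k) * t (snd l)))"
  proof (rule sum.cong[OF refl], rule sum.cong[OF refl])
    fix p k assume k: "k \<in> {k\<in>K. fst k = p}"
    show "(\<Sum>l\<in>K. ?f k l) = (\<Sum>l\<in>{l\<in>K. fst l = p}.
      (u k * sqrt (lam p)) * (u l * sqrt (lam p)) * (min (t (snd k)) (t (snd l)) - t (snd k) * t (snd l)))"
    proof (rule sum.mono_neutral_cong_right[OF K])
      show "\<forall>l\<in>K - {l\<in>K. fst l = p}. ?f k l = 0" using k by auto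
      fix l assume "l \<in> {l\<in>K. fst l = p}"
      then have l: "fst k = p" "fst l = p" using k by auto
      have "sqrt (lam p) * sqrt (lam p) = lam p" using lam[of p] by simp
      then have "(u k * sqrt (lam p)) * (u l * sqrt (lam p)) = u k * u l * lam p" by (simp add: ac_simps)
      then show "?f k l = (u k * sqrt (lam p)) * (u l * sqrt (lam p))
          * (min (t (snd k)) (t (snd l)) - t (snd k) * t (snd l))"
        using l lam[of p] by simp
    qed auto
  qed
  finally show ?thesis .
qed

lemma bridge_form_nonneg:
  assumes K: "finite K" and t: "\<And>j. t j \<in> {0..1}" and lam: "\<And>p. 0 \<le> lam p"
  shows "0 \<le> bridge_form lam t K u"
  unfolding bridge_form_blocks[OF K lam]
  by (intro sum_nonneg bridge_kernel_psd) (use K t in auto)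

text \<open>After grouping by coordinate \<open>p\<close>, independence factors the characteristic
  function, and each factor belongs to a Gaussian combination of a single bridge.\<close>

lemma char_bridge_family:
  fixes B :: "nat \<Rightarrow> 'b \<Rightarrow> real \<Rightarrow> real"
  assumes N: "prob_space N" and B: "\<And>p. is_brownian_bridge N (B p)"
    and indep: "prob_space.indep_vars N (\<lambda>_. PiM UNIV (\<lambda>_::real. borel)) B UNIV"
    and K: "finite K" and t: "\<And>j. t j \<in> {0..1}" and lam: "\<And>p. 0 \<le> lam p"
  shows "(CLINT \<omega>|N. iexp (\<Sum>k\<in>K. u k * (sqrt (lam (fst k)) * B (fst k) \<omega> (t (snd k)))))
    = exp (- bridge_form lam t K u / 2)"
proof -
  interpret prob_space N by fact
  define Kp where "Kp p = {k\<in>K. fst k = p}" for p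
  define S where "S p z = (\<Sum>k\<in>Kp p. (u k * sqrt (lam p)) * z (t (snd k)))" for p and z :: "real \<Rightarrow> real"
  define V where "V p = (\<Sum>k\<in>Kp p. \<Sum>l\<in>Kp p. (u k * sqrt (lam p)) * (u l * sqrt (lam p))
      * (min (t (snd k)) (t (snd l)) - t (snd k) * t (snd l)))" for p
  have Kp: "finite (Kp p)" for p using K by (simp add: Kp_def)
  have charp: "(CLINT \<omega>|N. iexp (S p (B p \<omega>))) = exp (- V p / 2)" for p
    unfolding S_def V_def
    by (intro char_centered_normal[OF N brownian_bridge_combination[OF B Kp]] bridge_kernel_psd Kp t)
  have "indep_vars (\<lambda>_. borel) (\<lambda>p \<omega>. iexp (S p (B p \<omega>))) UNIV"
    unfolding S_def by (rule indep_vars_compose2[OF indep]) measurable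
  then have ind: "indep_vars (\<lambda>_. borel) (\<lambda>p \<omega>. iexp (S p (B p \<omega>))) (fst ` K)"
    by (rule indep_vars_subset) simp
  have Bm: "B p \<in> measurable N (PiM UNIV (\<lambda>_::real. borel))" for p
    using indep by (auto simp: indep_vars_def)
  have "(\<lambda>\<omega>. S p (B p \<omega>)) \<in> borel_measurable N" for p
    by (rule measurable_compose[OF Bm]) (unfold S_def, measurable)
  then have int: "integrable N (\<lambda>\<omega>. iexp (S p (B p \<omega>)))" for p
    by (intro integrable_const_bound[of _ 1]) auto
  have "(\<Sum>k\<in>K. u k * (sqrt (lam (fst k)) * B (fst k) \<omega> (t (snd k)))) = (\<Sum>p\<in>fst ` K. S p (B p \<omega>))" for \<omega>
    unfolding S_def Kp_def by (subst sum.image_gen[OF K, of _ fst]) (auto intro!: sum.cong simp: mult.assoc)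
  then have "(CLINT \<omega>|N. iexp (\<Sum>k\<in>K. u k * (sqrt (lam (fst k)) * B (fst k) \<omega> (t (snd k)))))
      = (CLINT \<omega>|N. (\<Prod>p\<in>fst ` K. iexp (S p (B p \<omega>))))"
    using K by (simp add: sum_distrib_left exp_sum)
  also have "\<dots> = (\<Prod>p\<in>fst ` K. CLINT \<omega>|N. iexp (S p (B p \<omega>)))"
    by (rule indep_vars_lebesgue_integral) (use K ind int in auto)
  also have "\<dots> = (\<Prod>p\<in>fst ` K. complex_of_real (exp (- V p / 2)))" by (simp add: charp)
  also have "\<dots> = complex_of_real (exp (\<Sum>p\<in>fst ` K. - V p / 2))" using K by (simp add: exp_sum)
  also have "(\<Sum>p\<in>fst ` K. - V p / 2) = - (\<Sum>p\<in>fst ` K. V p) / 2" by (simp add: sum_divide_distrib sum_negf)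
  also have "(\<Sum>p\<in>fst ` K. V p) = bridge_form lam t K u"
    unfolding bridge_form_blocks[OF K lam] V_def Kp_def ..
  finally show ?thesis by simp
qed

text \<open>The eigenvector and orthonormality relations remove covariances between different
  coordinates, leaving the same form as for independent bridges.\<close>

lemma char_tied_down_family:
  fixes W :: "'a \<Rightarrow> real \<Rightarrow> 'h::{real_inner,banach,second_countable_topology}" and t :: "nat \<Rightarrow> real"
  assumes sd: "spectral_decomposition v lam C" and N: "prob_space N" and W: "is_H_brownian_motion N W C"
    and K: "finite K" and t: "\<And>j. t j \<in> {0..1}"
  shows "(CLINT \<omega>|N. iexp (\<Sum>k\<in>K. u k * ((W \<omega> (t (snd k)) - t (snd k) *\<^sub>R W \<omega> 1) \<bullet> v (fst k))))
    = exp (- bridge_form lam t K u / 2)"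
proof -
  interpret spectral_decomposition v lam C by fact
  have "centered_normal N (\<lambda>\<omega>. \<Sum>k\<in>K. (W \<omega> (t (snd k)) - t (snd k) *\<^sub>R W \<omega> 1) \<bullet> (u k *\<^sub>R v (fst k)))
    (\<Sum>k\<in>K. \<Sum>l\<in>K. (min (t (snd k)) (t (snd l)) - t (snd k) * t (snd l)) * (C (u k *\<^sub>R v (fst k)) \<bullet> (u l *\<^sub>R v (fst l))))"
    by (rule tied_down_brownian_motion_combination[OF W C_selfadjoint K t])
  moreover have "(\<Sum>k\<in>K. \<Sum>l\<in>K. (min (t (snd k)) (t (snd l)) - t (snd k) * t (snd l)) * (C (u k *\<^sub>R v (fst k)) \<bullet> (u l *\<^sub>R v (fst l))))
      = bridge_form lam t K u"
    unfolding bridge_form_def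
    by (intro sum.cong refl) (simp add: blinfun.scaleR_right C_v orthonormal)
  ultimately have cn: "centered_normal N (\<lambda>\<omega>. \<Sum>k\<in>K. u k * ((W \<omega> (t (snd k)) - t (snd k) *\<^sub>R W \<omega> 1) \<bullet> v (fst k)))
      (bridge_form lam t K u)"
    by simp
  then show ?thesis
    using char_centered_normal[OF N cn] bridge_form_nonneg[OF K t lam_nonneg] by simp
qed

section \<open>Long-run covariance of a stationary sequence\<close>

lemma strictly_stationary_integral:
  fixes f :: "(int \<Rightarrow> 'h::{second_countable_topology,topological_space}) \<Rightarrow> 'd::{banach,second_countable_topology}"
  assumes st: "strictly_stationary M eps" and eps: "\<And>i. eps i \<in> borel_measurable M"
    and f: "f \<in> borel_measurable (PiM UNIV (\<lambda>_. borel))"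
  shows "(\<integral>\<omega>. f (\<lambda>i. eps (i + s) \<omega>) \<partial>M) = (\<integral>\<omega>. f (\<lambda>i. eps i \<omega>) \<partial>M)"
proof -
  have m: "(\<lambda>\<omega> i. eps (i + s) \<omega>) \<in> measurable M (PiM UNIV (\<lambda>_. borel))" for s
    using eps by (auto intro!: measurable_PiM_single')
  show ?thesis
    using integral_distr[OF m[of s] f] integral_distr[OF m[of 0] f] st by (simp add: strictly_stationary_def)
qed

lemma strictly_stationary_nn_integral:
  fixes f :: "(int \<Rightarrow> 'h::{second_countable_topology,topological_space}) \<Rightarrow> ennreal"
  assumes st: "strictly_stationary M eps" and eps: "\<And>i. eps i \<in> borel_measurable M"
    and f: "f \<in> borel_measurable (PiM UNIV (\<lambda>_. borel))"
  shows "(\<integral>\<^sup>+\<omega>. f (\<lambda>i. eps (i + s) \<omega>) \<partial>M) = (\<integral>\<^sup>+\<omega>. f (\<lambda>i. eps i \<omega>) \<partial>M)"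
proof -
  have m: "(\<lambda>\<omega> i. eps (i + s) \<omega>) \<in> measurable M (PiM UNIV (\<lambda>_. borel))" for s
    using eps by (auto intro!: measurable_PiM_single')
  show ?thesis
    using nn_integral_distr[OF m[of s], of f] nn_integral_distr[OF m[of 0], of f] f st
    by (simp add: strictly_stationary_def)
qed

text \<open>The quadratic forms are the variances of partial sums of a stationary process with
  autocovariance \<open>\<gamma>\<close>; dividing by \<open>n\<close>, they approach the total sum.\<close>

lemma infsum_nonneg_of_psd:
  fixes \<gamma> :: "int \<Rightarrow> real"
  assumes sm: "(\<lambda>r. \<bar>\<gamma> r\<bar>) summable_on UNIV"
    and psd: "\<And>n. 0 \<le> (\<Sum>i<n. \<Sum>j<n. \<gamma> (int j - int i))"
  shows "0 \<le> infsum \<gamma> UNIV"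
proof (rule ccontr)
  define s where "s = infsum \<gamma> UNIV"
  assume "\<not> 0 \<le> infsum \<gamma> UNIV"
  then have s: "s < 0" by (simp add: s_def)
  have "(\<gamma> has_sum s) UNIV"
    using abs_summable_summable[of \<gamma> UNIV] sm by (simp add: s_def)
  then have "\<forall>\<^sub>F F in finite_subsets_at_top UNIV. sum \<gamma> F < s / 2"
    unfolding has_sum_def by (rule order_tendstoD) (use s in simp)
  then obtain F where F: "finite F" "\<And>G. finite G \<Longrightarrow> F \<subseteq> G \<Longrightarrow> sum \<gamma> G < s / 2"
    unfolding eventually_finite_subsets_at_top by auto
  define T where "T = infsum (\<lambda>r. \<bar>\<gamma> r\<bar>) UNIV"
  have T: "sum \<gamma> G \<le> T" if "finite G" for G
  proof -
    have "sum \<gamma> G \<le> (\<Sum>r\<in>G. \<bar>\<gamma> r\<bar>)" by (intro sum_mono) simp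
    also have "\<dots> \<le> T" unfolding T_def by (rule finite_sum_le_infsum[OF sm that]) auto
    finally show ?thesis .
  qed
  have T0: "0 \<le> T" using T[of "{}"] by simp
  obtain R :: nat where R: "\<And>r. r \<in> F \<Longrightarrow> \<bar>r\<bar> \<le> int R"
  proof -
    have "finite ((\<lambda>r. nat \<bar>r\<bar>) ` F)" using F(1) by simp
    then obtain R where "\<forall>x\<in>(\<lambda>r. nat \<bar>r\<bar>) ` F. x \<le> R" using finite_nat_set_iff_bounded_le by blast
    then show ?thesis by (intro that[of R]) (auto simp: nat_le_iff)
  qed
  have inner: "(\<Sum>j<n. \<gamma> (int j - int i)) = sum \<gamma> ((\<lambda>j. int j - int i) ` {..<n})" for i n
    by (subst sum.reindex) (auto simp: inj_on_def)
  \<comment> \<open>A row with \<open>R \<le> i < n - R\<close> contains all lags in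
    \<open>F\<close>, so its sum is below \<open>s / 2\<close>; each of the remaining
    \<open>2 * R\<close> rows contributes at most \<open>T\<close>. The negative part grows with
    \<open>n\<close>, the boundary part does not.\<close>
  have bound: "(\<Sum>i<n. \<Sum>j<n. \<gamma> (int j - int i)) \<le> real (n - 2 * R) * (s / 2) + real (2 * R) * T" if n: "2 * R \<le> n" for n
  proof -
    have "(\<Sum>i<n. \<Sum>j<n. \<gamma> (int j - int i)) \<le> (\<Sum>i<n. if i \<in> {R..<n - R} then s / 2 else T)"
    proof (intro sum_mono)
      fix i assume "i \<in> {..<n}"
      show "(\<Sum>j<n. \<gamma> (int j - int i)) \<le> (if i \<in> {R..<n - R} then s / 2 else T)"
      proof (cases "i \<in> {R..<n - R}")
        case True
        have "r \<in> (\<lambda>j. int j - int i) ` {..<n}" if "r \<in> F" for r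
          using R[OF that] True by (intro image_eqI[of _ _ "nat (r + int i)"]) auto
        then have "F \<subseteq> (\<lambda>j. int j - int i) ` {..<n}" by blast
        then show ?thesis unfolding inner using F(2)[of "(\<lambda>j. int j - int i) ` {..<n}"] True by simp
      next
        case False
        then show ?thesis unfolding inner if_not_P[OF False] using T by simp
      qed
    qed
    also have "\<dots> = (\<Sum>i\<in>{R..<n - R}. s / 2) + (\<Sum>i\<in>{..<n} - {R..<n - R}. T)"
    proof -
      have "{..<n} \<inter> {i. i \<in> {R..<n - R}} = {R..<n - R}" "{..<n} \<inter> - {i. i \<in> {R..<n - R}} = {..<n} - {R..<n - R}" by auto
      then show ?thesis by (subst sum.If_cases) auto
    qed
    also have "\<dots> = real (n - 2 * R) * (s / 2) + real (2 * R) * T"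
    proof -
      have "card {R..<n - R} = n - 2 * R" by simp
      moreover have "card ({..<n} - {R..<n - R}) = n - (n - 2 * R)"
        by (subst card_Diff_subset) auto
      ultimately show ?thesis using n by simp
    qed
    finally show ?thesis .
  qed
  obtain m :: nat where m: "2 * real R * T / (- s / 2) < real m" using reals_Archimedean2 by blast
  have "2 * real R * T < real m * (- s / 2)" using m s by (simp add: field_simps)
  moreover have "0 \<le> real m * (s / 2) + real (2 * R) * T"
    using psd[of "m + 2 * R"] bound[of "m + 2 * R"] by simp
  ultimately show False by simp
qed


text \<open>Stationarity carries the moment assumption from \<open>eps 1\<close> to every index, and
  \<open>x^2 \<le> 1 + x powr k\<close> for nonnegative \<open>x\<close> because
  \<open>k > 2\<close>.\<close>

lemma stationary_second_moment:
  fixes eps :: "int \<Rightarrow> 'a \<Rightarrow> 'h::{real_inner,second_countable_topology}"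
  assumes M: "prob_space M" and eps[measurable]: "\<And>i. eps i \<in> borel_measurable M"
    and st: "strictly_stationary M eps"
    and moment: "\<exists>k>2. (\<integral>\<^sup>+\<omega>. ennreal (norm (eps 1 \<omega>) powr k) \<partial>M) < \<infinity>"
  shows "integrable M (\<lambda>\<omega>. (norm (eps i \<omega>))\<^sup>2)"
proof -
  interpret prob_space M by fact
  obtain k :: real where k: "k > 2" "(\<integral>\<^sup>+\<omega>. ennreal (norm (eps 1 \<omega>) powr k) \<partial>M) < \<infinity>"
    using moment by blast
  have "(\<integral>\<^sup>+\<omega>. ennreal ((norm (eps i \<omega>))\<^sup>2) \<partial>M) = (\<integral>\<^sup>+\<omega>. ennreal ((norm (eps (1 + (i - 1)) \<omega>))\<^sup>2) \<partial>M)" by simp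
  also have "\<dots> = (\<integral>\<^sup>+\<omega>. ennreal ((norm (eps 1 \<omega>))\<^sup>2) \<partial>M)"
    by (rule strictly_stationary_nn_integral[OF st eps, where f = "\<lambda>z. ennreal ((norm (z 1))\<^sup>2)"]) measurable
  also have "\<dots> \<le> (\<integral>\<^sup>+\<omega>. 1 + ennreal (norm (eps 1 \<omega>) powr k) \<partial>M)"
  proof (rule nn_integral_mono)
    fix \<omega>
    have "x\<^sup>2 \<le> 1 + x powr k" if "0 \<le> x" for x :: real
    proof (cases "x \<le> 1")
      case True
      then have "x\<^sup>2 \<le> 1" using that by (simp add: power_le_one)
      then show ?thesis using powr_ge_zero[of x k] by linarith
    next
      case False
      then have "x\<^sup>2 = x powr 2" using that by (simp add: powr_numeral)
      also have "\<dots> \<le> x powr k" using False k by (intro powr_mono) auto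
      finally show ?thesis by simp
    qed
    then have "ennreal ((norm (eps 1 \<omega>))\<^sup>2) \<le> ennreal (1 + norm (eps 1 \<omega>) powr k)" by (intro ennreal_leI) simp
    then show "ennreal ((norm (eps 1 \<omega>))\<^sup>2) \<le> 1 + ennreal (norm (eps 1 \<omega>) powr k)" by (simp add: ennreal_plus)
  qed
  also have "\<dots> = 1 + (\<integral>\<^sup>+\<omega>. ennreal (norm (eps 1 \<omega>) powr k) \<partial>M)"
    by (subst nn_integral_add) (simp_all add: emeasure_space_1)
  also have "\<dots> < \<infinity>" using k(2) by (simp add: ennreal_add_less_top)
  finally show ?thesis by (intro integrableI_bounded) simp_all
qed

lemma integrable_inner_scaleR:
  fixes f g :: "'a \<Rightarrow> 'h::{real_inner,banach,second_countable_topology}"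
  assumes [measurable]: "f \<in> borel_measurable M" "g \<in> borel_measurable M"
    and sq: "integrable M (\<lambda>\<omega>. (norm (f \<omega>))\<^sup>2)" "integrable M (\<lambda>\<omega>. (norm (g \<omega>))\<^sup>2)"
  shows "integrable M (\<lambda>\<omega>. norm (f \<omega>) * norm (g \<omega>))"
    and "integrable M (\<lambda>\<omega>. (f \<omega> \<bullet> h) *\<^sub>R g \<omega>)"
    and "integrable M (\<lambda>\<omega>. (f \<omega> \<bullet> h) * (g \<omega> \<bullet> h'))"
proof -
  show *: "integrable M (\<lambda>\<omega>. norm (f \<omega>) * norm (g \<omega>))"
  proof (rule Bochner_Integration.integrable_bound)
    show "integrable M (\<lambda>\<omega>. (norm (f \<omega>))\<^sup>2 + (norm (g \<omega>))\<^sup>2)" using sq by simp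
    have "a * b \<le> a\<^sup>2 + b\<^sup>2" if "0 \<le> a" "0 \<le> b" for a b :: real
      using sum_squares_bound[of a b] mult_nonneg_nonneg[OF that] by (simp add: mult.assoc)
    then show "AE \<omega> in M. norm (norm (f \<omega>) * norm (g \<omega>)) \<le> norm ((norm (f \<omega>))\<^sup>2 + (norm (g \<omega>))\<^sup>2)"
      by simp
  qed measurable
  have fh: "\<bar>f \<omega> \<bullet> h\<bar> \<le> norm (f \<omega>) * norm h" for \<omega> by (rule Cauchy_Schwarz_ineq2)
  show "integrable M (\<lambda>\<omega>. (f \<omega> \<bullet> h) *\<^sub>R g \<omega>)"
  proof (rule Bochner_Integration.integrable_bound)
    show "integrable M (\<lambda>\<omega>. norm h * (norm (f \<omega>) * norm (g \<omega>)))" using * by simp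
    have "\<bar>f \<omega> \<bullet> h\<bar> * norm (g \<omega>) \<le> (norm (f \<omega>) * norm h) * norm (g \<omega>)" for \<omega>
      by (intro mult_right_mono fh) auto
    then show "AE \<omega> in M. norm ((f \<omega> \<bullet> h) *\<^sub>R g \<omega>) \<le> norm (norm h * (norm (f \<omega>) * norm (g \<omega>)))"
      by (simp add: ac_simps)
  qed measurable
  from integrable_inner_left[OF this, of h']
  show "integrable M (\<lambda>\<omega>. (f \<omega> \<bullet> h) * (g \<omega> \<bullet> h'))" by simp
qed

lemma cov_op_apply:
  fixes eps :: "int \<Rightarrow> 'a \<Rightarrow> 'h::{real_inner,banach,second_countable_topology}"
  assumes eps: "\<And>i. eps i \<in> borel_measurable M"
    and sq: "\<And>i. integrable M (\<lambda>\<omega>. (norm (eps i \<omega>))\<^sup>2)"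
  shows "cov_op M eps r h = (\<integral>\<omega>. (eps 0 \<omega> \<bullet> h) *\<^sub>R eps r \<omega> \<partial>M)"
proof -
  have int: "integrable M (\<lambda>\<omega>. norm (eps 0 \<omega>) * norm (eps r \<omega>))"
    "integrable M (\<lambda>\<omega>. (eps 0 \<omega> \<bullet> h) *\<^sub>R eps r \<omega>)" for h
    by (rule integrable_inner_scaleR[OF eps eps sq sq])+
  have "bounded_linear (\<lambda>h. \<integral>\<omega>. (eps 0 \<omega> \<bullet> h) *\<^sub>R eps r \<omega> \<partial>M)"
  proof (rule bounded_linear_intro)
    fix x y
    show "(\<integral>\<omega>. (eps 0 \<omega> \<bullet> (x + y)) *\<^sub>R eps r \<omega> \<partial>M)
        = (\<integral>\<omega>. (eps 0 \<omega> \<bullet> x) *\<^sub>R eps r \<omega> \<partial>M) + (\<integral>\<omega>. (eps 0 \<omega> \<bullet> y) *\<^sub>R eps r \<omega> \<partial>M)"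
      using int(2) by (simp add: inner_add_right scaleR_left_distrib)
    show "(\<integral>\<omega>. (eps 0 \<omega> \<bullet> (c *\<^sub>R x)) *\<^sub>R eps r \<omega> \<partial>M) = c *\<^sub>R (\<integral>\<omega>. (eps 0 \<omega> \<bullet> x) *\<^sub>R eps r \<omega> \<partial>M)" for c
      by (simp flip: scaleR_scaleR)
    have "norm (\<integral>\<omega>. (eps 0 \<omega> \<bullet> x) *\<^sub>R eps r \<omega> \<partial>M) \<le> (\<integral>\<omega>. norm ((eps 0 \<omega> \<bullet> x) *\<^sub>R eps r \<omega>) \<partial>M)"
      by (rule integral_norm_bound)
    also have "\<dots> \<le> (\<integral>\<omega>. norm x * (norm (eps 0 \<omega>) * norm (eps r \<omega>)) \<partial>M)"
    proof (rule integral_mono)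
      show "integrable M (\<lambda>\<omega>. norm ((eps 0 \<omega> \<bullet> x) *\<^sub>R eps r \<omega>))" using int(2) by (rule integrable_norm)
      show "integrable M (\<lambda>\<omega>. norm x * (norm (eps 0 \<omega>) * norm (eps r \<omega>)))" using int(1) by simp
      fix \<omega>
      have "\<bar>eps 0 \<omega> \<bullet> x\<bar> * norm (eps r \<omega>) \<le> (norm (eps 0 \<omega>) * norm x) * norm (eps r \<omega>)"
        by (intro mult_right_mono Cauchy_Schwarz_ineq2) auto
      then show "norm ((eps 0 \<omega> \<bullet> x) *\<^sub>R eps r \<omega>) \<le> norm x * (norm (eps 0 \<omega>) * norm (eps r \<omega>))"
        by (simp add: ac_simps)
    qed
    finally show "norm (\<integral>\<omega>. (eps 0 \<omega> \<bullet> x) *\<^sub>R eps r \<omega> \<partial>M) \<le> norm x * (\<integral>\<omega>. norm (eps 0 \<omega>) * norm (eps r \<omega>) \<partial>M)"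
      by simp
  qed
  then show ?thesis by (simp add: cov_op_def tensor_apply bounded_linear_Blinfun_apply)
qed

text \<open>Evaluating the operator at a basis vector shows that \<open>lam p\<close> is the sum of
  the autocovariances of the projected series. Hence \<open>infsum_nonneg_of_psd\<close> makes it
  nonnegative, and absolute summability over all \<open>p\<close> and lags makes the
  \<open>lam p\<close> summable. Were \<open>lam 0\<close> zero, all would vanish and
  \<open>C\<close> with them.\<close>

lemma long_run_variance_spectral:
  fixes eps :: "int \<Rightarrow> 'a \<Rightarrow> 'h::{real_inner,banach,second_countable_topology}"
  assumes M: "prob_space M" and eps[measurable]: "\<And>i. eps i \<in> borel_measurable M"
    and centered: "\<And>i. integrable M (eps i) \<and> (\<integral>\<omega>. eps i \<omega> \<partial>M) = 0"
    and st: "strictly_stationary M eps"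
    and moment: "\<exists>k>2. (\<integral>\<^sup>+\<omega>. ennreal (norm (eps 1 \<omega>) powr k) \<partial>M) < \<infinity>"
    and cov_summable: "(\<lambda>r. norm (cov_op M eps r)) summable_on UNIV"
    and nz: "(\<Sum>\<^sub>\<infinity>r. cov_op M eps r) \<noteq> 0"
    and on: "\<And>p q. v p \<bullet> v q = (if p = q then 1 else 0)"
    and complete: "closure (span (range v)) = UNIV"
    and lam_decr: "\<And>p. lam (Suc p) \<le> lam p"
    and spectral: "\<And>h. (\<lambda>p. lam p *\<^sub>R (tensor (v p) (v p)) h) sums ((\<Sum>\<^sub>\<infinity>r. cov_op M eps r) h)"
    and cov_proj: "(\<lambda>(p, h::int). \<bar>covariance_rv M (\<lambda>\<omega>. eps 0 \<omega> \<bullet> v p) (\<lambda>\<omega>. eps h \<omega> \<bullet> v p)\<bar>) summable_on UNIV"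
  shows "spectral_decomposition v lam (\<Sum>\<^sub>\<infinity>r. cov_op M eps r)"
proof -
  define C where "C = (\<Sum>\<^sub>\<infinity>r. cov_op M eps r)"
  interpret prob_space M by fact
  interpret orthonormal_basis v by unfold_locales (use on complete in auto)
  have sq: "integrable M (\<lambda>\<omega>. (norm (eps i \<omega>))\<^sup>2)" for i
    by (rule stationary_second_moment[OF M eps st moment])
  define \<gamma> where "\<gamma> p r = (\<integral>\<omega>. (eps 0 \<omega> \<bullet> v p) * (eps r \<omega> \<bullet> v p) \<partial>M)" for p r
  have int: "integrable M (\<lambda>\<omega>. (eps i \<omega> \<bullet> v p) * (eps j \<omega> \<bullet> v p))" for i j p
    by (rule integrable_inner_scaleR(3)[OF eps eps sq sq])
  have cov: "cov_op M eps r (v p) \<bullet> v p = \<gamma> p r" for r p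
  proof -
    have "integrable M (\<lambda>\<omega>. (eps 0 \<omega> \<bullet> v p) *\<^sub>R eps r \<omega>)"
      by (rule integrable_inner_scaleR(2)[OF eps eps sq sq])
    from integral_inner_left[OF this, of "v p"] show ?thesis
      by (simp add: cov_op_apply[OF eps sq] \<gamma>_def)
  qed
  have mean: "(\<integral>\<omega>. eps i \<omega> \<bullet> v p \<partial>M) = 0" for i p
    using centered[of i] by (subst integral_inner_left) auto
  have cov_rv: "covariance_rv M (\<lambda>\<omega>. eps 0 \<omega> \<bullet> v p) (\<lambda>\<omega>. eps h \<omega> \<bullet> v p) = \<gamma> p h" for p h
    by (simp add: covariance_rv_def mean \<gamma>_def)
  have C_sum: "(cov_op M eps has_sum C) UNIV"
    unfolding C_def by (rule has_sum_infsum[OF abs_summable_summable[OF cov_summable]])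
  have C_v: "C (v p) = lam p *\<^sub>R v p" for p
  proof -
    have "(\<lambda>q. lam q *\<^sub>R (tensor (v q) (v q)) (v p)) = (\<lambda>q. if q = p then lam p *\<^sub>R v p else 0)"
      by (auto simp: tensor_apply on)
    then show ?thesis using spectral[of "v p"] sums_single[of p "\<lambda>_. lam p *\<^sub>R v p"]
      unfolding C_def by (metis sums_unique2)
  qed
  have lam_sum: "(\<gamma> p has_sum lam p) UNIV" for p
  proof -
    have "bounded_linear (\<lambda>A. blinfun_apply A (v p) \<bullet> v p)"
      by (rule bounded_linear_compose[OF bounded_linear_inner_left blinfun.bounded_linear_left])
    from has_sum_bounded_linear[OF this C_sum] show ?thesis by (simp add: cov C_v on)
  qed
  have summ: "(\<lambda>x. norm (case x of (p, h) \<Rightarrow> \<gamma> p h)) summable_on UNIV \<times> UNIV"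
    using cov_proj by (simp add: cov_rv split_def)
  have abs_p: "(\<lambda>r. \<bar>\<gamma> p r\<bar>) summable_on UNIV" for p
    using summable_on_SigmaD1[of "\<lambda>p h. \<bar>\<gamma> p h\<bar>" UNIV "\<lambda>_. UNIV" p] summ by (simp add: split_def)
  have "(\<lambda>p. infsum (\<gamma> p) UNIV) summable_on UNIV"
    using summable_on_Sigma_banach[of \<gamma> UNIV "\<lambda>_. UNIV"] abs_summable_summable[OF summ] by simp
  then have "lam summable_on UNIV" using infsumI[OF lam_sum] by simp
  then have lam_lim: "lam \<longlonglongrightarrow> 0" by (intro summable_LIMSEQ_zero summable_on_imp_summable)
  have lam_nonneg: "0 \<le> lam p" for p
  proof -
    have "0 \<le> infsum (\<gamma> p) UNIV"
    proof (rule infsum_nonneg_of_psd[OF abs_p])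
      fix n
      have st': "(\<integral>\<omega>. (eps (int i) \<omega> \<bullet> v p) * (eps (int j) \<omega> \<bullet> v p) \<partial>M) = \<gamma> p (int j - int i)" for i j
        using strictly_stationary_integral[OF st eps, where s = "int i" and f = "\<lambda>z. (z 0 \<bullet> v p) * (z (int j - int i) \<bullet> v p)"]
        by (simp add: \<gamma>_def)
      have "0 \<le> (\<integral>\<omega>. (\<Sum>i<n. eps (int i) \<omega> \<bullet> v p)\<^sup>2 \<partial>M)" by (rule Bochner_Integration.integral_nonneg) simp
      also have "\<dots> = (\<integral>\<omega>. (\<Sum>i<n. \<Sum>j<n. (eps (int i) \<omega> \<bullet> v p) * (eps (int j) \<omega> \<bullet> v p)) \<partial>M)"
        by (simp add: power2_eq_square sum_product)
      also have "\<dots> = (\<Sum>i<n. \<Sum>j<n. \<gamma> p (int j - int i))"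
        using int by (simp add: Bochner_Integration.integral_sum st')
      finally show "0 \<le> (\<Sum>i<n. \<Sum>j<n. \<gamma> p (int j - int i))" .
    qed
    then show ?thesis using infsumI[OF lam_sum] by simp
  qed
  have spec: "(\<lambda>p. (lam p * (h \<bullet> v p)) *\<^sub>R v p) sums C h" for h
    using spectral[of h] by (simp add: tensor_apply inner_commute C_def)
  have "0 < lam 0"
  proof (rule ccontr)
    assume "\<not> 0 < lam 0"
    moreover have "lam p \<le> lam 0" for p using lift_Suc_antimono_le[of lam 0 p] lam_decr by blast
    ultimately have "lam p = 0" for p using lam_nonneg[of p] by (meson antisym not_le order_trans)
    then have "C h = 0" for h using spec[of h] sums_unique2[OF _ sums_zero] by simp
    then have "C = 0" by (intro blinfun_eqI) simp
    then show False using nz by (simp add: C_def)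
  qed
  then show ?thesis unfolding C_def[symmetric]
    by unfold_locales (use lam_decr lam_nonneg lam_lim spec in auto)
qed

section \<open>The law of the limit\<close>

lemma tied_sup_le_iff:
  fixes R :: "'h::real_normed_vector \<Rightarrow>\<^sub>L 'h"
  assumes "bounded (x ` {0..1})"
  shows "tied_sup R a x \<le> c \<longleftrightarrow> (\<forall>t\<in>{0..1}. norm (R (x t - (a * t) *\<^sub>R x 1)) \<le> c)"
  unfolding tied_sup_def by (rule cSUP_le_iff[OF _ tied_sup_bdd[OF assms]]) simp

lemma norm_le_tied_sup:
  fixes R :: "'h::real_normed_vector \<Rightarrow>\<^sub>L 'h"
  assumes "bounded (x ` {0..1})" "t \<in> {0..1}"
  shows "norm (R (x t - (a * t) *\<^sub>R x 1)) \<le> tied_sup R a x"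
  using tied_sup_le_iff[OF assms(1), of R a "tied_sup R a x"] assms(2) by simp

lemma tied_sup_nonneg:
  fixes R :: "'h::real_normed_vector \<Rightarrow>\<^sub>L 'h"
  assumes "bounded (x ` {0..1})"
  shows "0 \<le> tied_sup R a x"
  by (rule order_trans[OF norm_ge_zero norm_le_tied_sup[OF assms, of 0 R a]]) simp

lemma tied_sup_le_dense_iff:
  fixes R :: "'h::real_normed_vector \<Rightarrow>\<^sub>L 'h"
  assumes x: "continuous_on {0..1} x" and D: "closure D = {0..1}"
  shows "tied_sup R a x \<le> c \<longleftrightarrow> (\<forall>t\<in>D. norm (R (x t - (a * t) *\<^sub>R x 1)) \<le> c)"
proof -
  have bd: "bounded (x ` {0..1})"
    by (intro compact_imp_bounded compact_continuous_image x) simp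
  have cont: "continuous_on {0..1} (\<lambda>t. norm (R (x t - (a * t) *\<^sub>R x 1)))"
    by (intro continuous_on_norm blinfun.continuous_on[OF continuous_on_const] continuous_on_diff x
        continuous_on_scaleR continuous_on_mult continuous_on_const continuous_on_id)
  show ?thesis
    unfolding tied_sup_le_iff[OF bd]
    using continuous_le_on_closure[of D "\<lambda>t. norm (R (x t - (a * t) *\<^sub>R x 1))" _ c] cont D closure_subset[of D]
    by auto
qed

lemma unit_interval_dense_seq:
  "\<exists>\<tau> :: nat \<Rightarrow> real. (\<forall>j. \<tau> j \<in> {0..1}) \<and> closure (range \<tau>) = {0..1}"
proof -
  obtain D where D: "countable D" "D \<subseteq> {0..1::real}" "{0..1} \<subseteq> closure D" by (rule separable)
  have ne: "D \<noteq> {}" using D(3) by auto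
  have r: "range (from_nat_into D) = D" using D(1) ne by (rule range_from_nat_into[rotated])
  have "closure D \<subseteq> {0..1}" using D(2) by (rule closure_minimal) simp
  then have "closure D = {0..1}" using D(3) by (rule subset_antisym)
  then have "closure (range (from_nat_into D)) = {0..1}" by (simp only: r)
  moreover have "\<forall>j. from_nat_into D j \<in> {0..1}" using subsetD[OF D(2) from_nat_into[OF ne]] by blast
  ultimately show ?thesis by blast
qed

lemma borel_measurable_tied_sup_continuous:
  fixes W :: "'a \<Rightarrow> real \<Rightarrow> 'h::{real_normed_vector,second_countable_topology}"
  assumes meas: "\<And>t. t \<in> {0..1} \<Longrightarrow> (\<lambda>\<omega>. W \<omega> t) \<in> borel_measurable N"
    and cont: "\<And>\<omega>. \<omega> \<in> space N \<Longrightarrow> continuous_on {0..1} (W \<omega>)"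
  shows "(\<lambda>\<omega>. tied_sup R a (W \<omega>)) \<in> borel_measurable N"
  unfolding borel_measurable_iff_le
proof
  fix c :: real
  obtain \<tau> :: "nat \<Rightarrow> real" where \<tau>: "\<And>j. \<tau> j \<in> {0..1}" "closure (range \<tau>) = {0..1}" using unit_interval_dense_seq by blast
  have [measurable]: "(\<lambda>\<omega>. norm (R (W \<omega> (\<tau> j) - (a * \<tau> j) *\<^sub>R W \<omega> 1))) \<in> borel_measurable N" for j
  proof -
    have [measurable]: "(\<lambda>\<omega>. W \<omega> (\<tau> j)) \<in> borel_measurable N" "(\<lambda>\<omega>. W \<omega> 1) \<in> borel_measurable N"
      using meas \<tau>(1) by auto
    have [measurable]: "blinfun_apply R \<in> borel_measurable borel"
      by (intro borel_measurable_continuous_onI linear_continuous_on blinfun.bounded_linear_right)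
    show ?thesis by measurable
  qed
  have "{\<omega>\<in>space N. tied_sup R a (W \<omega>) \<le> c}
      = {\<omega>\<in>space N. \<forall>j. norm (R (W \<omega> (\<tau> j) - (a * \<tau> j) *\<^sub>R W \<omega> 1)) \<le> c}"
    using tied_sup_le_dense_iff[OF cont \<tau>(2)] by auto
  also have "\<dots> \<in> sets N" by measurable
  finally show "{\<omega>\<in>space N. tied_sup R a (W \<omega>) \<le> c} \<in> sets N" .
qed

lemma partial_sums_le_iff:
  fixes f :: "nat \<Rightarrow> real"
  assumes "f sums s" "\<And>p. 0 \<le> f p"
  shows "s \<le> x \<longleftrightarrow> (\<forall>n. (\<Sum>p<n. f p) \<le> x)"
proof
  assume "s \<le> x"
  then show "\<forall>n. (\<Sum>p<n. f p) \<le> x"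
    using sum_le_suminf[of f] sums_summable[OF assms(1)] sums_unique[OF assms(1)] assms(2)
    by (metis finite_lessThan order_trans)
next
  assume "\<forall>n. (\<Sum>p<n. f p) \<le> x"
  then show "s \<le> x" using assms(1) unfolding sums_def by (intro LIMSEQ_le_const2) auto
qed

lemma square_le_iff: "0 \<le> u \<Longrightarrow> u\<^sup>2 \<le> x \<longleftrightarrow> u \<le> sqrt x" for u x :: real
  by (metis abs_of_nonneg real_sqrt_abs real_sqrt_le_iff)

text \<open>Both functionals are described by one measurable event \<open>E x\<close>, a bound on
  all finite partial sums at the times \<open>\<tau> j\<close>. The coordinate families have the
  same joint law by \<open>cramer_wold\<close>, so the distribution functions agree.\<close>

lemma limit_law:
  fixes W :: "'a \<Rightarrow> real \<Rightarrow> 'h::{real_inner,banach,second_countable_topology}"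
    and B :: "nat \<Rightarrow> 'b \<Rightarrow> real \<Rightarrow> real"
  assumes sd: "spectral_decomposition v lam C"
    and N0: "prob_space N0" and W: "is_H_brownian_motion N0 W C"
    and N: "prob_space N" and B: "\<And>p. is_brownian_bridge N (B p)"
    and indep: "prob_space.indep_vars N (\<lambda>_. PiM UNIV (\<lambda>_::real. borel)) B UNIV"
  shows "distr N borel (\<lambda>\<omega>. SUP t\<in>{0..1}. (\<Sum>p. lam p / (lam p + lam 0) * (B p \<omega> t)\<^sup>2))
      = distr N0 borel (\<lambda>\<omega>. (tied_sup (spectral_decomposition.limit_op lam C) 1 (W \<omega>))\<^sup>2)"
    and "(\<lambda>\<omega>. SUP t\<in>{0..1}. (\<Sum>p. lam p / (lam p + lam 0) * (B p \<omega> t)\<^sup>2)) \<in> borel_measurable N"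
    and "(\<lambda>\<omega>. (tied_sup (spectral_decomposition.limit_op lam C) 1 (W \<omega>))\<^sup>2) \<in> borel_measurable N0"
proof -
  let ?G = "\<lambda>\<omega>. SUP t\<in>{0..1}. (\<Sum>p. lam p / (lam p + lam 0) * (B p \<omega> t)\<^sup>2)"
  let ?\<Phi> = "\<lambda>\<omega>. (tied_sup (spectral_decomposition.limit_op lam C) 1 (W \<omega>))\<^sup>2"
  interpret spectral_decomposition v lam C by fact
  interpret N0: prob_space N0 by fact
  interpret N: prob_space N by fact
  obtain \<tau> :: "nat \<Rightarrow> real" where \<tau>: "\<And>j. \<tau> j \<in> {0..1}" "closure (range \<tau>) = {0..1::real}" using unit_interval_dense_seq by blast
  define q where "q p \<omega> t = lam p / (lam p + lam 0) * (B p \<omega> t)\<^sup>2" for p \<omega> t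
  have pos: "0 < lam p + lam 0" for p using lam_nonneg[of p] lam_0 by simp
  have q_nonneg: "0 \<le> q p \<omega> t" for p \<omega> t using pos[of p] lam_nonneg[of p] by (simp add: q_def)
  have q_cont: "continuous_on {0..1} (q p \<omega>)" if "\<omega> \<in> space N" for p \<omega>
    using B[of p] that unfolding q_def is_brownian_bridge_def by (intro continuous_intros) auto
  have B_meas: "(\<lambda>\<omega>. B p \<omega> t) \<in> borel_measurable N" if "t \<in> {0..1}" for p t
    using B[of p] that unfolding is_brownian_bridge_def by blast
  have W_meas: "(\<lambda>\<omega>. W \<omega> t) \<in> borel_measurable N0" if "t \<in> {0..1}" for t
    using W that unfolding is_H_brownian_motion_def by blast
  have W_cont: "continuous_on {0..1} (W \<omega>)" if "\<omega> \<in> space N0" for \<omega>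
    using W that unfolding is_H_brownian_motion_def by blast
  have mG: "?G \<in> borel_measurable N"
    unfolding q_def[symmetric]
  proof (rule borel_measurable_SUP_suminf)
    show "(\<lambda>\<omega>. q p \<omega> t) \<in> borel_measurable N" if "t \<in> {0..1}" for p t
      using B_meas[OF that] unfolding q_def by measurable
  qed (use q_nonneg q_cont in auto)
  show "?G \<in> borel_measurable N" by (rule mG)
  have [measurable]: "(\<lambda>\<omega>. tied_sup limit_op 1 (W \<omega>)) \<in> borel_measurable N0"
    by (rule borel_measurable_tied_sup_continuous[OF W_meas W_cont])
  have m\<Phi>: "?\<Phi> \<in> borel_measurable N0" by measurable
  show "?\<Phi> \<in> borel_measurable N0" by (rule m\<Phi>)
  define X where "X k \<omega> = (W \<omega> (\<tau> (snd k)) - \<tau> (snd k) *\<^sub>R W \<omega> 1) \<bullet> v (fst k)" for k \<omega>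
  define Y where "Y k \<omega> = sqrt (lam (fst k)) * B (fst k) \<omega> (\<tau> (snd k))" for k \<omega>
  have X_meas: "X k \<in> borel_measurable N0" for k
  proof -
    have [measurable]: "(\<lambda>\<omega>. W \<omega> (\<tau> (snd k))) \<in> borel_measurable N0" "(\<lambda>\<omega>. W \<omega> 1) \<in> borel_measurable N0"
      using W_meas \<tau>(1) by auto
    show ?thesis unfolding X_def by measurable
  qed
  have Y_meas: "Y k \<in> borel_measurable N" for k
    using B_meas[OF \<tau>(1), of "fst k" "snd k"] unfolding Y_def by measurable
  have law: "distr N0 (PiM UNIV (\<lambda>_. borel)) (\<lambda>\<omega> k. X k \<omega>) = distr N (PiM UNIV (\<lambda>_. borel)) (\<lambda>\<omega> k. Y k \<omega>)"
  proof (rule cramer_wold[OF N0 N X_meas Y_meas])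
    fix K :: "(nat \<times> nat) set" and u assume K: "finite K"
    show "(CLINT \<omega>|N0. iexp (\<Sum>k\<in>K. u k * X k \<omega>)) = (CLINT \<omega>|N. iexp (\<Sum>k\<in>K. u k * Y k \<omega>))"
      unfolding X_def Y_def
      by (rule trans[OF char_tied_down_family[OF sd N0 W K \<tau>(1)]
            char_bridge_family[OF N B indep K \<tau>(1) lam_nonneg, symmetric]])
  qed
  define E where "E x = {z \<in> space (PiM UNIV (\<lambda>_. borel)). \<forall>n. \<forall>j::nat. (\<Sum>p<n. (z (p, j))\<^sup>2 / (lam p + lam 0)) \<le> x}"
    for x :: real
  have E: "E x \<in> sets (PiM UNIV (\<lambda>_. borel))" for x
  proof -
    have comp: "(\<lambda>z. z k) \<in> borel_measurable (PiM UNIV (\<lambda>_. borel :: real measure))" for k :: "nat \<times> nat"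
      by (rule measurable_component_singleton) (rule UNIV_I)
    show ?thesis unfolding E_def
      by (rule sets.sets_Collect_countable_All)+
        (intro borel_measurable_le borel_measurable_sum borel_measurable_divide
          borel_measurable_power borel_measurable_const comp)
  qed
  have mX: "(\<lambda>\<omega> k. X k \<omega>) \<in> measurable N0 (PiM UNIV (\<lambda>_. borel))"
    by (rule measurable_PiM_single'[OF X_meas]) simp
  have mY: "(\<lambda>\<omega> k. Y k \<omega>) \<in> measurable N (PiM UNIV (\<lambda>_. borel))"
    by (rule measurable_PiM_single'[OF Y_meas]) simp
  have law': "measure N0 ((\<lambda>\<omega> k. X k \<omega>) -` A \<inter> space N0) = measure N ((\<lambda>\<omega> k. Y k \<omega>) -` A \<inter> space N)"
    if "A \<in> sets (PiM UNIV (\<lambda>_. borel))" for A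
    using measure_distr[OF mX that] measure_distr[OF mY that] law by simp
  have \<Phi>E: "?\<Phi> \<omega> \<le> x \<longleftrightarrow> (\<lambda>k. X k \<omega>) \<in> E x" if w: "\<omega> \<in> space N0" for \<omega> x
  proof -
    have bd: "bounded (W \<omega> ` {0..1})"
      by (intro compact_imp_bounded compact_continuous_image W_cont w) simp
    let ?d = "\<lambda>t. W \<omega> t - (1 * t) *\<^sub>R W \<omega> 1"
    have "?\<Phi> \<omega> \<le> x \<longleftrightarrow> (\<forall>j. (norm (limit_op (?d (\<tau> j))))\<^sup>2 \<le> x)"
    proof (cases "0 \<le> x")
      case True
      have "?\<Phi> \<omega> \<le> x \<longleftrightarrow> tied_sup limit_op 1 (W \<omega>) \<le> sqrt x"
        using square_le_iff[OF tied_sup_nonneg[OF bd]] by simp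
      also have "\<dots> \<longleftrightarrow> (\<forall>j. norm (limit_op (?d (\<tau> j))) \<le> sqrt x)"
        using tied_sup_le_dense_iff[OF W_cont[OF w] \<tau>(2)] by auto
      also have "\<dots> \<longleftrightarrow> (\<forall>j. (norm (limit_op (?d (\<tau> j))))\<^sup>2 \<le> x)"
        by (simp only: square_le_iff[OF norm_ge_zero])
      finally show ?thesis .
    next
      case False
      have "\<not> ?\<Phi> \<omega> \<le> x" using zero_le_power2[of "tied_sup limit_op 1 (W \<omega>)"] False by linarith
      moreover have "\<not> (norm (limit_op (?d (\<tau> 0))))\<^sup>2 \<le> x"
        using zero_le_power2[of "norm (limit_op (?d (\<tau> 0)))"] False by linarith
      ultimately show ?thesis by blast
    qed
    also have "\<dots> \<longleftrightarrow> (\<forall>j n. (\<Sum>p<n. (X (p, j) \<omega>)\<^sup>2 / (lam p + lam 0)) \<le> x)"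
      using partial_sums_le_iff[OF norm_limit_op] pos by (simp add: X_def less_imp_le)
    finally show ?thesis by (auto simp: E_def space_PiM)
  qed
  \<comment> \<open>The equivalence is claimed only for paths whose partial sums share some bound
    \<open>k\<close>; elsewhere \<open>suminf\<close> or \<open>Sup\<close> may return a default
    value.\<close>
  have GE: "?G \<omega> \<le> x \<longleftrightarrow> (\<lambda>k. Y k \<omega>) \<in> E x" if w: "\<omega> \<in> space N" and k: "(\<lambda>k. Y k \<omega>) \<in> E k" for \<omega> x k
  proof -
    have YE: "(\<lambda>k. Y k \<omega>) \<in> E y \<longleftrightarrow> (\<forall>n. \<forall>t\<in>{0..1}. (\<Sum>p<n. q p \<omega> t) \<le> y)" for y
    proof -
      have "(\<lambda>k. Y k \<omega>) \<in> E y \<longleftrightarrow> (\<forall>n. \<forall>t\<in>range \<tau>. (\<Sum>p<n. q p \<omega> t) \<le> y)"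
        using lam_nonneg by (auto simp: E_def space_PiM Y_def q_def power_mult_distrib)
      also have "\<dots> \<longleftrightarrow> (\<forall>n. \<forall>t\<in>{0..1}. (\<Sum>p<n. q p \<omega> t) \<le> y)"
      proof (intro all_cong1 iffI ballI)
        fix n t assume *: "\<forall>t\<in>range \<tau>. (\<Sum>p<n. q p \<omega> t) \<le> y" "t \<in> {0..1::real}"
        have "continuous_on (closure (range \<tau>)) (\<lambda>t. \<Sum>p<n. q p \<omega> t)"
          unfolding \<tau>(2) by (intro continuous_on_sum q_cont w)
        from continuous_le_on_closure[OF this, of t y] show "(\<Sum>p<n. q p \<omega> t) \<le> y"
          using * \<tau>(2) by blast
      qed (use \<tau>(1) in auto)
      finally show ?thesis .
    qed
    have summ: "(\<lambda>p. q p \<omega> t) sums (\<Sum>p. q p \<omega> t)" if "t \<in> {0..1}" for t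
      using k[unfolded YE] that q_nonneg
      by (intro summable_sums summableI_nonneg_bounded[of _ k]) auto
    have le: "(\<Sum>p. q p \<omega> t) \<le> y \<longleftrightarrow> (\<forall>n. (\<Sum>p<n. q p \<omega> t) \<le> y)" if "t \<in> {0..1}" for t y
      by (rule partial_sums_le_iff[OF summ[OF that] q_nonneg])
    have "bdd_above ((\<lambda>t. \<Sum>p. q p \<omega> t) ` {0..1})"
      using k[unfolded YE] by (intro bdd_aboveI2[of _ _ k]) (simp add: le)
    then have "?G \<omega> \<le> x \<longleftrightarrow> (\<forall>t\<in>{0..1}. (\<Sum>p. q p \<omega> t) \<le> x)"
      unfolding q_def[symmetric] by (intro cSUP_le_iff) auto
    also have "\<dots> \<longleftrightarrow> (\<forall>n. \<forall>t\<in>{0..1}. (\<Sum>p<n. q p \<omega> t) \<le> x)" by (auto simp: le)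
    finally show ?thesis unfolding YE .
  qed
  \<comment> \<open>On the side of \<open>W\<close> some integer bound holds at every point of the
    space, since the squared \<open>tied_sup\<close> is a real number. As the laws agree, it holds
    with probability one on the side of the bridges.\<close>
  have "AE \<omega> in N. \<exists>k::nat. (\<lambda>k. Y k \<omega>) \<in> E (real k)"
  proof -
    let ?F = "\<Union>k::nat. E (real k)"
    have F: "?F \<in> sets (PiM UNIV (\<lambda>_. borel))" using E by blast
    have "(\<lambda>\<omega> k. X k \<omega>) -` ?F \<inter> space N0 = space N0"
    proof (intro equalityI subsetI)
      fix \<omega> assume w: "\<omega> \<in> space N0"
      obtain k :: nat where "?\<Phi> \<omega> \<le> real k" using real_arch_simple by blast
      then have "(\<lambda>k. X k \<omega>) \<in> E (real k)" using \<Phi>E[OF w] by simp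
      then show "\<omega> \<in> (\<lambda>\<omega> k. X k \<omega>) -` ?F \<inter> space N0" using w by blast
    qed simp
    then have "N.prob ((\<lambda>\<omega> k. Y k \<omega>) -` ?F \<inter> space N) = 1" using law'[OF F] N0.prob_space by simp
    then have "AE \<omega> in N. \<omega> \<in> (\<lambda>\<omega> k. Y k \<omega>) -` ?F \<inter> space N"
      by (simp only: N.prob_eq_1[OF measurable_sets[OF mY F]])
    then show ?thesis by (rule AE_mp) (rule AE_I2, blast)
  qed
  note ae = this
  have cdf_eq: "measure N {\<omega>\<in>space N. ?G \<omega> \<le> x} = measure N0 {\<omega>\<in>space N0. ?\<Phi> \<omega> \<le> x}" for x
  proof -
    have "measure N {\<omega>\<in>space N. ?G \<omega> \<le> x} = measure N ((\<lambda>\<omega> k. Y k \<omega>) -` E x \<inter> space N)"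
    proof (rule measure_eq_AE)
      show "AE \<omega> in N. (\<omega> \<in> {\<omega>\<in>space N. ?G \<omega> \<le> x}) = (\<omega> \<in> (\<lambda>\<omega> k. Y k \<omega>) -` E x \<inter> space N)"
        using ae
      proof (rule AE_mp, intro AE_I2 impI)
        fix \<omega> assume w: "\<omega> \<in> space N" and "\<exists>k::nat. (\<lambda>k. Y k \<omega>) \<in> E (real k)"
        then obtain k :: nat where k: "(\<lambda>k. Y k \<omega>) \<in> E (real k)" by blast
        show "(\<omega> \<in> {\<omega>\<in>space N. ?G \<omega> \<le> x}) = (\<omega> \<in> (\<lambda>\<omega> k. Y k \<omega>) -` E x \<inter> space N)"
          using GE[OF w k, of x] w by simp
      qed
      show "{\<omega>\<in>space N. ?G \<omega> \<le> x} \<in> sets N" using mG by (rule borel_measurable_le[OF _ borel_measurable_const])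
      show "(\<lambda>\<omega> k. Y k \<omega>) -` E x \<inter> space N \<in> sets N" by (rule measurable_sets[OF mY E])
    qed
    also have "\<dots> = measure N0 ((\<lambda>\<omega> k. X k \<omega>) -` E x \<inter> space N0)" by (rule law'[OF E, symmetric])
    also have "(\<lambda>\<omega> k. X k \<omega>) -` E x \<inter> space N0 = {\<omega>\<in>space N0. ?\<Phi> \<omega> \<le> x}" using \<Phi>E by auto
    finally show ?thesis .
  qed
  show "distr N borel ?G = distr N0 borel ?\<Phi>"
  proof (rule cdf_unique)
    show "real_distribution (distr N borel ?G)" using mG by (rule N.real_distribution_distr)
    show "real_distribution (distr N0 borel ?\<Phi>)" using m\<Phi> by (rule N0.real_distribution_distr)
    show "cdf (distr N borel ?G) = cdf (distr N0 borel ?\<Phi>)"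
    proof
      fix x
      show "cdf (distr N borel ?G) x = cdf (distr N0 borel ?\<Phi>) x"
      proof -
        have "?G -` {..x} \<inter> space N = {\<omega>\<in>space N. ?G \<omega> \<le> x}"
          "?\<Phi> -` {..x} \<inter> space N0 = {\<omega>\<in>space N0. ?\<Phi> \<omega> \<le> x}" by blast+
        then show ?thesis
          unfolding cdf_def measure_distr[OF mG atMost_borel] measure_distr[OF m\<Phi> atMost_borel]
          by (simp only: cdf_eq)
      qed
    qed
  qed
qed

section \<open>The partial sum process\<close>

lemma step_index_le: "t \<in> {0..1} \<Longrightarrow> nat \<lfloor>t * real n\<rfloor> \<le> n"
  using mult_right_mono[of t 1 "real n"] by (simp add: nat_le_iff floor_le_iff)

definition step_path :: "nat \<Rightarrow> (nat \<Rightarrow> 'h) \<Rightarrow> real \<Rightarrow> 'h" where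
  "step_path n s t = s (nat \<lfloor>t * real n\<rfloor>)"

lemma step_path_1: "step_path n s 1 = s n"
  by (simp add: step_path_def)

lemma step_path_bounded: "bounded (step_path n s ` {0..1})"
proof -
  have "step_path n s ` {0..1} \<subseteq> s ` {..n}" using step_index_le by (auto simp: step_path_def)
  then show ?thesis by (rule bounded_subset[rotated]) (simp add: finite_imp_bounded)
qed

lemma step_path_grid: "k \<le> n \<Longrightarrow> 0 < n \<Longrightarrow> step_path n s (real k / real n) = s k"
  by (simp add: step_path_def)

text \<open>The statistic before squaring, in terms of scaled error sums: under the null hypothesis
  the centred sums of \<open>X\<close> reduce to \<open>s k - (k / n) s n\<close>.\<close>

definition max_dev :: "('h::real_normed_vector \<Rightarrow>\<^sub>L 'h) \<Rightarrow> nat \<Rightarrow> (nat \<Rightarrow> 'h) \<Rightarrow> real" where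
  "max_dev R n s = Max ((\<lambda>k. norm (R (s k - (real k / real n) *\<^sub>R s n))) ` {1..<n})"

text \<open>Two errors add up. Changing the operator costs \<open>norm (R' - R)\<close> times
  \<open>2 * m\<close>, a bound for every centred sum; passing from grid points to all times moves
  the drift by at most \<open>1 / n\<close>. The condition \<open>2 \<le> n\<close> makes the
  maximum range over a nonempty set.\<close>

lemma max_dev_close:
  fixes s :: "nat \<Rightarrow> 'h::real_normed_vector"
  assumes n: "2 \<le> n" and s0: "s 0 = 0"
  defines "m \<equiv> tied_sup id_blinfun 0 (step_path n s)"
  shows "\<bar>max_dev R' n s - tied_sup R 1 (step_path n s)\<bar> \<le> norm (R' - R) * (2 * m) + norm R * m / real n"
proof -
  let ?u = "\<lambda>k. s k - (real k / real n) *\<^sub>R s n"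
  note bd = step_path_bounded[of n s]
  have sk: "norm (s k) \<le> m" if "k \<le> n" for k
    using norm_le_tied_sup[OF bd, of "real k / real n" id_blinfun 0] that n
    by (simp add: m_def step_path_grid)
  have m0: "0 \<le> m" by (rule order_trans[OF norm_ge_zero sk[of 0]]) simp
  have fin: "finite ((\<lambda>k. norm (R (?u k))) ` {1..<n})" "(\<lambda>k. norm (R (?u k))) ` {1..<n} \<noteq> {}"
    for R :: "'h \<Rightarrow>\<^sub>L 'h" using n by auto
  have dev: "norm (R (?u k)) \<le> max_dev R n s" if "k \<in> {1..<n}" for R :: "'h \<Rightarrow>\<^sub>L 'h" and k
    unfolding max_dev_def by (rule Max_ge[OF fin(1) imageI[OF that]])
  have dev_le: "max_dev R n s \<le> c" if "\<And>k. k \<in> {1..<n} \<Longrightarrow> norm (R (?u k)) \<le> c" for R :: "'h \<Rightarrow>\<^sub>L 'h" and c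
    unfolding max_dev_def by (rule Max.boundedI[OF fin]) (use that in blast)
  have dev0: "0 \<le> max_dev R n s" for R :: "'h \<Rightarrow>\<^sub>L 'h"
    by (rule order_trans[OF norm_ge_zero dev[of 1]]) (use n in auto)
  have lower: "max_dev R n s \<le> tied_sup R 1 (step_path n s)"
  proof (rule dev_le)
    fix k assume "k \<in> {1..<n}"
    then show "norm (R (?u k)) \<le> tied_sup R 1 (step_path n s)"
      using norm_le_tied_sup[OF bd, of "real k / real n" R 1] by (simp add: step_path_grid step_path_1)
  qed
  have upper: "tied_sup R 1 (step_path n s) \<le> max_dev R n s + norm R * m / real n"
    unfolding tied_sup_le_iff[OF bd]
  proof
    fix t :: real assume t: "t \<in> {0..1}"
    define k where "k = nat \<lfloor>t * real n\<rfloor>"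
    have kn: "k \<le> n" unfolding k_def by (rule step_index_le[OF t])
    have k1: "real k \<le> t * real n" "t * real n < real k + 1"
      using t by (auto simp: k_def)
    have dt: "\<bar>real k / real n - t\<bar> \<le> 1 / real n" 
    proof -
      have "real k / real n - t = (real k - t * real n) / real n" using n by (simp add: diff_divide_distrib)
      moreover have "\<bar>real k - t * real n\<bar> \<le> 1" using k1 by linarith
      ultimately show ?thesis by (simp add: abs_divide divide_right_mono)
    qed
    have e: "step_path n s t - (1 * t) *\<^sub>R step_path n s 1 = ?u k + (real k / real n - t) *\<^sub>R s n"
      unfolding step_path_1 by (simp add: step_path_def k_def algebra_simps)
    have "norm (R (step_path n s t - (1 * t) *\<^sub>R step_path n s 1))
        \<le> norm (R (?u k)) + norm (R ((real k / real n - t) *\<^sub>R s n))"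
      unfolding e blinfun.add_right by (rule norm_triangle_ineq)
    also have "norm (R (?u k)) \<le> max_dev R n s"
    proof (cases "k \<in> {1..<n}")
      case True then show ?thesis by (rule dev)
    next
      case False
      \<comment> \<open>At \<open>k = 0\<close> and \<open>k = n\<close>, which the maximum omits,
        the centred sum vanishes.\<close>
      then have "k = 0 \<or> k = n" using kn by auto
      then have "?u k = 0" using n s0 by auto
      then show ?thesis using dev0[of R] by (simp add: blinfun.zero_right)
    qed
    also have "norm (R ((real k / real n - t) *\<^sub>R s n)) \<le> norm R * norm ((real k / real n - t) *\<^sub>R s n)"
      by (rule norm_blinfun)
    also have "\<dots> \<le> norm R * (1 / real n * m)"
      unfolding norm_scaleR by (intro mult_left_mono mult_mono dt sk) auto
    finally show "norm (R (step_path n s t - (1 * t) *\<^sub>R step_path n s 1)) \<le> max_dev R n s + norm R * m / real n"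
      by simp
  qed
  have u: "norm (?u k) \<le> 2 * m" if "k \<in> {1..<n}" for k
  proof -
    have "norm (?u k) \<le> norm (s k) + real k / real n * norm (s n)"
      by (rule order_trans[OF norm_triangle_ineq4]) simp
    also have "\<dots> \<le> m + 1 * m" using that n by (intro add_mono mult_mono sk) auto
    finally show ?thesis by simp
  qed
  have op: "max_dev F n s \<le> max_dev G n s + norm (F - G) * (2 * m)" for F G :: "'h \<Rightarrow>\<^sub>L 'h"
  proof (rule dev_le)
    fix k assume k: "k \<in> {1..<n}"
    have "norm (F (?u k)) \<le> norm (G (?u k)) + norm ((F - G) (?u k))"
      unfolding blinfun.diff_left by (rule norm_triangle_sub)
    also have "norm ((F - G) (?u k)) \<le> norm (F - G) * (2 * m)"
      by (rule order_trans[OF norm_blinfun mult_left_mono[OF u[OF k]]]) simp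
    finally show "norm (F (?u k)) \<le> max_dev G n s + norm (F - G) * (2 * m)" using dev[OF k, of G] by linarith
  qed
  have "0 \<le> norm R * m / real n" using m0 by simp
  moreover have "max_dev R n s \<le> max_dev R' n s + norm (R' - R) * (2 * m)"
    using op[of R R'] by (simp only: norm_minus_commute)
  ultimately show ?thesis using op[of R' R] lower upper by linarith
qed

text \<open>Step paths are right-continuous, and within one step only the continuous drift varies,
  so rational times decide the supremum. At time 1 no right neighbours exist, but 1 is itself
  rational.\<close>

lemma borel_measurable_tied_sup_step_path:
  fixes s :: "'a \<Rightarrow> nat \<Rightarrow> 'h::{real_normed_vector,second_countable_topology}"
  assumes s: "\<And>k. (\<lambda>\<omega>. s \<omega> k) \<in> borel_measurable M" and n: "0 < n"
  shows "(\<lambda>\<omega>. tied_sup R a (step_path n (s \<omega>))) \<in> borel_measurable M"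
  unfolding borel_measurable_iff_le
proof
  fix c :: real
  let ?f = "\<lambda>\<omega> t. norm (R (step_path n (s \<omega>) t - (a * t) *\<^sub>R step_path n (s \<omega>) 1))"
  have "(\<forall>t\<in>{0..1}. ?f \<omega> t \<le> c) \<longleftrightarrow> (\<forall>t\<in>\<rat> \<inter> {0..1}. ?f \<omega> t \<le> c)" for \<omega>
  proof (intro iffI ballI)
    fix t :: real assume *: "\<forall>t\<in>\<rat> \<inter> {0..1}. ?f \<omega> t \<le> c" and t: "t \<in> {0..1}"
    show "?f \<omega> t \<le> c"
    proof (cases "t = 1")
      case True
      have "(1::real) \<in> \<rat> \<inter> {0..1}" by simp
      from bspec[OF * this] show ?thesis by (simp only: True)
    next
      case False
      define k where "k = nat \<lfloor>t * real n\<rfloor>"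
      have k1: "real k \<le> t * real n" "t * real n < real k + 1" using t by (auto simp: k_def)
      define h where "h q = norm (R (s \<omega> k - (a * q) *\<^sub>R s \<omega> n))" for q
      have hf: "?f \<omega> q = h q" if "t \<le> q" "q * real n < real k + 1" for q
      proof -
        have "real k \<le> q * real n" using k1 mult_right_mono[OF that(1), of "real n"] by simp
        then have "nat \<lfloor>q * real n\<rfloor> = k" using that(2) by linarith
        then show ?thesis by (simp add: h_def step_path_def)
      qed
      have hc: "isCont h t"
        unfolding h_def by (intro continuous_intros blinfun.continuous) 
      define b where "b = min 1 ((real k + 1) / real n)"
      have b: "t < b" using t False k1(2) n by (auto simp: b_def field_simps)
      have "h t \<le> c"
      proof (rule ccontr)
        assume "\<not> h t \<le> c"
        then have "\<forall>\<^sub>F q in at t. c < h q" using hc by (intro order_tendstoD(1)) (auto simp: isCont_def)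
        then have "\<forall>\<^sub>F q in at_right t. c < h q" by (simp add: eventually_at_split)
        then obtain b' where b': "b' > t" "\<And>q. t < q \<Longrightarrow> q < b' \<Longrightarrow> c < h q"
          unfolding eventually_at_right_field by blast
        obtain q where q: "q \<in> \<rat>" "t < q" "q < min b b'"
          using Rats_dense_in_real[of t "min b b'"] b b' by auto
        have "q * real n < real k + 1" using q n by (auto simp: b_def field_simps)
        moreover have "q \<in> \<rat> \<inter> {0..1}" using q t by (auto simp: b_def)
        ultimately have "?f \<omega> q \<le> c" "?f \<omega> q = h q" using * hf[of q] q(2) by (blast, simp)
        moreover have "c < h q" by (rule b'(2)) (use q in auto)
        ultimately show False by linarith
      qed
      moreover have "?f \<omega> t = h t" by (rule hf) (use k1 in auto)
      ultimately show ?thesis by (simp only:)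
    qed
  qed auto
  then have "{\<omega>\<in>space M. tied_sup R a (step_path n (s \<omega>)) \<le> c} = {\<omega>\<in>space M. \<forall>t\<in>\<rat> \<inter> {0..1}. ?f \<omega> t \<le> c}"
    by (simp only: tied_sup_le_iff[OF step_path_bounded])
  also have "\<dots> \<in> sets M"
  proof (rule sets.sets_Collect_countable_All')
    show "countable (\<rat> \<inter> {0..1::real})" by (rule countable_subset[OF _ countable_rat]) auto
    fix t :: real
    have [measurable]: "(\<lambda>\<omega>. s \<omega> k) \<in> borel_measurable M" for k by (rule s)
    have [measurable]: "blinfun_apply R \<in> borel_measurable borel"
      by (intro borel_measurable_continuous_onI linear_continuous_on blinfun.bounded_linear_right)
    show "{\<omega>\<in>space M. ?f \<omega> t \<le> c} \<in> sets M" unfolding step_path_def by measurable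
  qed
  finally show "{\<omega>\<in>space M. tied_sup R a (step_path n (s \<omega>)) \<le> c} \<in> sets M" .
qed

section \<open>Test functions and the comparison of expectations\<close>

text \<open>Squaring is not uniformly continuous, but \<open>cts_step x y\<close> is constant beyond
  \<open>y\<close>, so arguments may be truncated at \<open>c\<close>, where squaring is Lipschitz
  with constant \<open>2 * c\<close>. The added 1 avoids division by zero when
  \<open>c = 0\<close>.\<close>

lemma cts_step_square_uniform:
  assumes xy: "x < y" and e: "e > 0"
  obtains d where "d > 0" "\<And>u w. \<bar>u - w\<bar> < d \<Longrightarrow> \<bar>cts_step x y (u\<^sup>2) - cts_step x y (w\<^sup>2)\<bar> < e"
proof -
  obtain d0 where d0: "d0 > 0" "\<And>u w. dist u w < d0 \<Longrightarrow> dist (cts_step x y u) (cts_step x y w) < e"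
    using cts_step_uniformly_continuous[OF xy] e unfolding uniformly_continuous_on_def by (metis UNIV_I)
  define c where "c = sqrt (max 0 y)"
  have c: "0 \<le> c" "c\<^sup>2 = max 0 y" by (auto simp: c_def)
  define g where "g u = min \<bar>u\<bar> c" for u
  have gb: "0 \<le> g u" "g u \<le> c" for u using c by (auto simp: g_def)
  have trunc: "cts_step x y (u\<^sup>2) = cts_step x y ((g u)\<^sup>2)" for u
  proof (cases "\<bar>u\<bar> \<le> c")
    case False
    then have "c\<^sup>2 \<le> \<bar>u\<bar>\<^sup>2" using c by (intro power_mono) auto
    then show ?thesis using False c(2) xy by (auto simp: g_def cts_step_def min_def)
  qed (simp add: g_def min_def)
  show ?thesis
  proof (rule that[of "d0 / (2 * c + 1)"])
    show "d0 / (2 * c + 1) > 0" using d0 c by simp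
    fix u w :: real assume uw: "\<bar>u - w\<bar> < d0 / (2 * c + 1)"
    have "\<bar>(g u)\<^sup>2 - (g w)\<^sup>2\<bar> = \<bar>g u - g w\<bar> * (g u + g w)"
    proof -
      have "(g u)\<^sup>2 - (g w)\<^sup>2 = (g u - g w) * (g u + g w)" by (simp add: power2_eq_square algebra_simps)
      moreover have "\<bar>g u + g w\<bar> = g u + g w" using gb[of u] gb[of w] by simp
      ultimately show ?thesis by (simp only: abs_mult)
    qed
    also have "\<dots> \<le> \<bar>u - w\<bar> * (2 * c)"
      using gb[of u] gb[of w] by (intro mult_mono) (auto simp: g_def min_def)
    also have "\<dots> \<le> \<bar>u - w\<bar> * (2 * c + 1)" by (intro mult_left_mono) auto
    also have "\<dots> < d0" using uw c by (simp add: field_simps)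
    finally show "\<bar>cts_step x y (u\<^sup>2) - cts_step x y (w\<^sup>2)\<bar> < e"
      unfolding trunc[of u] trunc[of w] using d0(2)[of "(g u)\<^sup>2" "(g w)\<^sup>2"] by (simp add: dist_real_def)
  qed
qed


text \<open>A continuous bounded substitute for the indicator of \<open>u > K\<close>, since
  \<open>D_weak_conv\<close> speaks of continuous functionals only.\<close>

definition ramp :: "real \<Rightarrow> real \<Rightarrow> real" where
  "ramp K u = min 1 (max 0 (u - K))"

lemma ramp_bounds: "0 \<le> ramp K u" "ramp K u \<le> 1"
  by (auto simp: ramp_def)

lemma ramp_ge: "K + 1 < u \<Longrightarrow> 1 \<le> ramp K u"
  by (auto simp: ramp_def)

lemma ramp_tendsto_0:
  assumes N: "prob_space N" and Z: "Z \<in> borel_measurable N"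
  shows "(\<lambda>K::nat. \<integral>\<omega>. ramp (real K) (Z \<omega>) \<partial>N) \<longlonglongrightarrow> 0"
proof -
  interpret prob_space N by fact
  note Z[measurable]
  have m: "(\<lambda>\<omega>. ramp (real K) (Z \<omega>)) \<in> borel_measurable N" for K
    unfolding ramp_def by measurable
  have "(\<lambda>K::nat. \<integral>\<omega>. ramp (real K) (Z \<omega>) \<partial>N) \<longlonglongrightarrow> (\<integral>\<omega>. 0 \<partial>N)"
  proof (rule integral_dominated_convergence[where w = "\<lambda>_. 1"])
    show "AE \<omega> in N. (\<lambda>K::nat. ramp (real K) (Z \<omega>)) \<longlonglongrightarrow> 0"
    proof (rule AE_I2)
      fix \<omega>
      obtain K0 :: nat where "Z \<omega> \<le> real K0" using real_arch_simple by blast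
      then have "ramp (real K) (Z \<omega>) = 0" if "K \<ge> K0" for K
        using that by (auto simp: ramp_def)
      then have "\<forall>\<^sub>F K in sequentially. ramp (real K) (Z \<omega>) = 0"
        by (auto simp: eventually_sequentially)
      then show "(\<lambda>K::nat. ramp (real K) (Z \<omega>)) \<longlonglongrightarrow> 0" by (rule tendsto_eventually)
    qed
    show "AE \<omega> in N. norm (ramp (real K) (Z \<omega>)) \<le> 1" for K
      using ramp_bounds by simp
  qed (use m in auto)
  then show ?thesis by simp
qed

lemma cts_step_bounds:
  assumes "x < y"
  shows "0 \<le> cts_step x y u" "cts_step x y u \<le> 1"
  using assms by (auto simp: cts_step_def divide_simps)

text \<open>Slutsky's argument: an operator perturbation of size \<open>h\<close> changes the statistic by at most
  \<open>2 h m\<close>, where \<open>m\<close> is the tight maximum of the partial sum process.\<close>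

lemma expectation_max_dev_close:
  fixes s :: "nat \<Rightarrow> 'a \<Rightarrow> nat \<Rightarrow> 'h::{real_normed_vector,second_countable_topology}"
    and R :: "'h \<Rightarrow>\<^sub>L 'h"
  assumes M: "prob_space M" and s: "\<And>n k. (\<lambda>\<omega>. s n \<omega> k) \<in> borel_measurable M"
    and s0: "\<And>n \<omega>. s n \<omega> 0 = 0"
    and T: "\<And>n. (\<lambda>\<omega>. max_dev (Rn n \<omega>) n (s n \<omega>)) \<in> borel_measurable M"
    and tight: "\<And>e. e > 0 \<Longrightarrow> \<exists>K\<ge>0. \<forall>\<^sub>F n in sequentially.
        (\<integral>\<omega>. ramp K (tied_sup id_blinfun 0 (step_path n (s n \<omega>))) \<partial>M) < e"
    and conv: "\<And>h e. h > 0 \<Longrightarrow> e > 0 \<Longrightarrow> \<exists>G. \<forall>\<^sub>F n in sequentially. G n \<in> sets M \<and> measure M (G n) < e \<and>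
        (\<forall>\<omega>\<in>space M - G n. norm (Rn n \<omega> - R) \<le> h)"
    and xy: "x < y"
  shows "(\<lambda>n. (\<integral>\<omega>. cts_step x y ((max_dev (Rn n \<omega>) n (s n \<omega>))\<^sup>2) \<partial>M)
      - (\<integral>\<omega>. cts_step x y ((tied_sup R 1 (step_path n (s n \<omega>)))\<^sup>2) \<partial>M)) \<longlonglongrightarrow> 0"
proof (rule LIMSEQ_I)
  interpret prob_space M by fact
  fix e :: real assume e: "e > 0"
  obtain d where d: "d > 0" "\<And>u w. \<bar>u - w\<bar> < d \<Longrightarrow> \<bar>cts_step x y (u\<^sup>2) - cts_step x y (w\<^sup>2)\<bar> < e / 4"
    using cts_step_square_uniform[OF xy, of "e / 4"] e by auto
  define m where "m n \<omega> = tied_sup id_blinfun 0 (step_path n (s n \<omega>))" for n \<omega>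
  obtain K where K: "K \<ge> 0" "\<forall>\<^sub>F n in sequentially. (\<integral>\<omega>. ramp K (m n \<omega>) \<partial>M) < e / 4"
    using tight[of "e / 4"] e by (auto simp: m_def)
  \<comment> \<open>With \<open>m \<le> K + 1\<close> the operator error
    \<open>h * (2 * (K + 1))\<close> is \<open>d / 2\<close>; the grid error is below
    \<open>d / 2\<close> for large \<open>n\<close>.\<close>
  define h where "h = d / (4 * (K + 1))"
  have h: "h > 0" using d K by (simp add: h_def)
  obtain G where G: "\<forall>\<^sub>F n in sequentially. G n \<in> sets M \<and> measure M (G n) < e / 4 \<and>
        (\<forall>\<omega>\<in>space M - G n. norm (Rn n \<omega> - R) \<le> h)"
    using conv[OF h, of "e / 4"] e by auto
  have "(\<lambda>n. norm R * (K + 1) / real n) \<longlonglongrightarrow> 0" by (rule lim_const_over_n)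
  then have "\<forall>\<^sub>F n in sequentially. norm R * (K + 1) / real n < d / 2"
    by (rule order_tendstoD) (use d in simp)
  with K(2) G eventually_ge_at_top[of 2]
  have "\<forall>\<^sub>F n in sequentially. norm ((\<integral>\<omega>. cts_step x y ((max_dev (Rn n \<omega>) n (s n \<omega>))\<^sup>2) \<partial>M)
      - (\<integral>\<omega>. cts_step x y ((tied_sup R 1 (step_path n (s n \<omega>)))\<^sup>2) \<partial>M) - 0) < e"
  proof eventually_elim
    case (elim n)
    then have n: "2 \<le> n" and Gn[measurable]: "G n \<in> sets M" by auto
    let ?F = "\<lambda>\<omega>. cts_step x y ((max_dev (Rn n \<omega>) n (s n \<omega>))\<^sup>2)"
    let ?H = "\<lambda>\<omega>. cts_step x y ((tied_sup R 1 (step_path n (s n \<omega>)))\<^sup>2)"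
    have cm[measurable]: "cts_step x y \<in> borel_measurable borel"
      unfolding cts_step_def[abs_def] by measurable
    note T[of n, measurable]
    have mm[measurable]: "m n \<in> borel_measurable M"
      unfolding m_def using borel_measurable_tied_sup_step_path[OF s, of n id_blinfun 0] n by simp
    have hm[measurable]: "(\<lambda>\<omega>. tied_sup R 1 (step_path n (s n \<omega>))) \<in> borel_measurable M"
      using borel_measurable_tied_sup_step_path[OF s, of n R 1] n by simp
    have iF: "integrable M ?F" and iH: "integrable M ?H"
      using cts_step_bounds[OF xy] by (auto intro!: integrable_const_bound[of _ 1])
    \<comment> \<open>A majorant of the difference: \<open>e / 4\<close> from uniform continuity,
      the indicator for a poor operator estimate, the ramp for a large maximum. Each contributes at
      most \<open>e / 4\<close> in expectation.\<close>
    define b where "b \<omega> = e / 4 + indicator (G n) \<omega> + ramp K (m n \<omega>)" for \<omega>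
    have iw: "integrable M (\<lambda>\<omega>. ramp K (m n \<omega>))"
    proof (rule integrable_const_bound[of _ 1])
      show "(\<lambda>\<omega>. ramp K (m n \<omega>)) \<in> borel_measurable M" unfolding ramp_def by measurable
    qed (use ramp_bounds in simp)
    have ii: "integrable M (indicat_real (G n))"
      by (rule integrable_real_indicator) (simp_all add: emeasure_eq_measure)
    have ib: "integrable M b" unfolding b_def
      by (intro Bochner_Integration.integrable_add iw ii integrable_const)
    have bound: "\<bar>?F \<omega> - ?H \<omega>\<bar> \<le> b \<omega>" if w: "\<omega> \<in> space M" for \<omega>
    proof (cases "\<omega> \<in> G n \<or> K + 1 < m n \<omega>")
      case True
      have "\<bar>?F \<omega> - ?H \<omega>\<bar> \<le> 1"
        using cts_step_bounds[OF xy, of "(max_dev (Rn n \<omega>) n (s n \<omega>))\<^sup>2"]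
          cts_step_bounds[OF xy, of "(tied_sup R 1 (step_path n (s n \<omega>)))\<^sup>2"] by linarith
      moreover have "1 \<le> indicator (G n) \<omega> + ramp K (m n \<omega>)"
        using True ramp_ge[of K "m n \<omega>"] ramp_bounds(1)[of K "m n \<omega>"]
        by (auto simp: indicator_def)
      ultimately show ?thesis using e by (simp add: b_def)
    next
      case False
      then have mK: "m n \<omega> \<le> K + 1" and Rh: "norm (Rn n \<omega> - R) \<le> h" using elim w by auto
      have m0: "0 \<le> m n \<omega>" unfolding m_def by (rule tied_sup_nonneg[OF step_path_bounded])
      have "\<bar>max_dev (Rn n \<omega>) n (s n \<omega>) - tied_sup R 1 (step_path n (s n \<omega>))\<bar>
          \<le> norm (Rn n \<omega> - R) * (2 * m n \<omega>) + norm R * m n \<omega> / real n"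
        unfolding m_def by (rule max_dev_close[where s = "s n \<omega>", OF n s0])
      also have "\<dots> \<le> h * (2 * (K + 1)) + norm R * (K + 1) / real n"
        using h m0 mK Rh K(1) by (intro add_mono mult_mono divide_right_mono mult_left_mono) auto
      also have "h * (2 * (K + 1)) = d / 2" using K(1) by (simp add: h_def field_simps)
      also have "d / 2 + norm R * (K + 1) / real n < d" using elim by linarith
      finally have "\<bar>?F \<omega> - ?H \<omega>\<bar> < e / 4" by (rule d(2))
      then show ?thesis using ramp_bounds(1)[of K "m n \<omega>"] by (simp add: b_def indicator_def)
    qed
    have "norm ((\<integral>\<omega>. ?F \<omega> \<partial>M) - (\<integral>\<omega>. ?H \<omega> \<partial>M) - 0) = \<bar>\<integral>\<omega>. ?F \<omega> - ?H \<omega> \<partial>M\<bar>"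
      using iF iH by simp
    also have "\<dots> \<le> (\<integral>\<omega>. \<bar>?F \<omega> - ?H \<omega>\<bar> \<partial>M)" by (rule integral_abs_bound)
    also have "\<dots> \<le> (\<integral>\<omega>. b \<omega> \<partial>M)"
      using iF iH ib bound by (intro integral_mono) auto
    also have "\<dots> = e / 4 + measure M (G n) + (\<integral>\<omega>. ramp K (m n \<omega>) \<partial>M)"
      unfolding b_def using iw ii by (simp add: prob_space)
    also have "\<dots> < e" using elim e by linarith
    finally show ?case .
  qed
  then show "\<exists>n0. \<forall>n\<ge>n0. norm ((\<integral>\<omega>. cts_step x y ((max_dev (Rn n \<omega>) n (s n \<omega>))\<^sup>2) \<partial>M)
      - (\<integral>\<omega>. cts_step x y ((tied_sup R 1 (step_path n (s n \<omega>)))\<^sup>2) \<partial>M) - 0) < e"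
    by (simp add: eventually_sequentially)
qed

section \<open>Weak convergence of the weighted statistic\<close>

theorem theorem2p1:
  fixes M :: "'a measure"
    and eps :: "int \<Rightarrow> 'a \<Rightarrow> 'h::{real_inner, banach, second_countable_topology}"
    and mu :: "nat \<Rightarrow> nat \<Rightarrow> 'h"
    and X :: "nat \<Rightarrow> nat \<Rightarrow> 'a \<Rightarrow> 'h"
    and lam :: "nat \<Rightarrow> real"
    and v :: "nat \<Rightarrow> 'h"
    and est :: "nat \<Rightarrow> (nat \<Rightarrow> 'h) \<Rightarrow> ('h \<Rightarrow>\<^sub>L 'h)"
    and Chat :: "nat \<Rightarrow> 'a \<Rightarrow> ('h \<Rightarrow>\<^sub>L 'h)"
    and lamhat :: "nat \<Rightarrow> 'a \<Rightarrow> real"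
  assumes M: "prob_space M"
    \<comment> \<open>(A1)\<close>
    and eps_meas: "\<And>i. eps i \<in> borel_measurable M"
    and centered: "\<And>i. integrable M (eps i) \<and> (\<integral>\<omega>. eps i \<omega> \<partial>M) = 0"
    and stationary: "strictly_stationary M eps"
    and moment: "\<exists>k>2. (\<integral>\<^sup>+\<omega>. ennreal (norm (eps 1 \<omega>) powr k) \<partial>M) < \<infinity>"
    and cov_summable: "(\<lambda>r. norm (cov_op M eps r)) summable_on UNIV"
    and lrv_nonzero: "(\<Sum>\<^sub>\<infinity>r. cov_op M eps r) \<noteq> 0"
    and v_orthonormal: "\<And>p q. v p \<bullet> v q = (if p = q then 1 else 0)"
    and v_complete: "closure (span (range v)) = UNIV"
    and lam_decr: "\<And>p. lam (Suc p) \<le> lam p"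
    and spectral: "\<And>h. (\<lambda>p. lam p *\<^sub>R (tensor (v p) (v p)) h) sums ((\<Sum>\<^sub>\<infinity>r. cov_op M eps r) h)"
    and cov_proj_summable: "(\<lambda>(p, h::int). \<bar>covariance_rv M (\<lambda>\<omega>. eps 0 \<omega> \<bullet> v p) (\<lambda>\<omega>. eps h \<omega> \<bullet> v p)\<bar>)
                              summable_on UNIV"
    \<comment> \<open>(A2)\<close>
    and fclt: "\<exists>N W. prob_space N \<and> is_H_brownian_motion N W (\<Sum>\<^sub>\<infinity>r. cov_op M eps r) \<and>
                D_weak_conv M (\<lambda>n \<omega> t. (1 / sqrt (real n)) *\<^sub>R (\<Sum>i=1..nat \<lfloor>t * real n\<rfloor>. eps (int i) \<omega>)) N W"
    \<comment> \<open>model and null hypothesis\<close>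
    and model: "\<And>n i \<omega>. X n i \<omega> = mu n i + eps (int i) \<omega>"
    and H0: "\<And>n i. 1 \<le> i \<Longrightarrow> i \<le> n \<Longrightarrow> mu n i = mu n 1"
    \<comment> \<open>the estimator\<close>
    and Chat_def: "\<And>n \<omega>. Chat n \<omega> = est n (\<lambda>i. if i \<in> {1..n} then X n i \<omega> else 0)"
    and Chat_meas: "\<And>n h. (\<lambda>\<omega>. Chat n \<omega> h) \<in> borel_measurable M"
    and Chat_psd: "\<And>n \<omega>. psd_op (Chat n \<omega>)"
    and Chat_consistent: "\<And>e. e > 0 \<Longrightarrow>
          (\<lambda>n. measure M {\<omega>\<in>space M. norm (Chat n \<omega> - (\<Sum>\<^sub>\<infinity>r. cov_op M eps r)) > e}) \<longlonglongrightarrow> 0"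
    and lamhat_eig: "\<And>n \<omega>. is_eigenvalue (Chat n \<omega>) (lamhat n \<omega>)"
    and lamhat_max: "\<And>n \<omega> l. is_eigenvalue (Chat n \<omega>) l \<Longrightarrow> l \<le> lamhat n \<omega>"
  shows "\<forall>(N :: 'b measure) (B :: nat \<Rightarrow> 'b \<Rightarrow> real \<Rightarrow> real).
           prob_space N \<and> (\<forall>p. is_brownian_bridge N (B p)) \<and>
           prob_space.indep_vars N (\<lambda>_. PiM UNIV (\<lambda>_::real. borel)) B UNIV \<longrightarrow>
           weak_conv_m
             (\<lambda>n. distr M borel (\<lambda>\<omega>.
                (Max ((\<lambda>k. norm (inv_sqrt_op (Chat n \<omega> + lamhat n \<omega> *\<^sub>R id_blinfun)
                     ((1 / sqrt (real n)) *\<^sub>R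
                       (\<Sum>i=1..k. X n i \<omega> - (1 / real n) *\<^sub>R (\<Sum>j=1..n. X n j \<omega>))))) ` {1..<n})) ^ 2))
             (distr N borel (\<lambda>\<omega>. SUP t\<in>{0..1}.
                (\<Sum>p. lam p / (lam p + lam 0) * (B p \<omega> t)^2)))"
proof (intro allI impI, elim conjE)
  fix N :: "'b measure" and B :: "nat \<Rightarrow> 'b \<Rightarrow> real \<Rightarrow> real"
  assume N: "prob_space N" and B: "\<forall>p. is_brownian_bridge N (B p)"
    and indep: "prob_space.indep_vars N (\<lambda>_. PiM UNIV (\<lambda>_::real. borel)) B UNIV"
  define C where "C = (\<Sum>\<^sub>\<infinity>r. cov_op M eps r)"
  interpret prob_space M by (rule M)
  have sd: "spectral_decomposition v lam C"
    unfolding C_def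
    by (rule long_run_variance_spectral[OF M eps_meas centered stationary moment cov_summable lrv_nonzero
          v_orthonormal v_complete lam_decr spectral cov_proj_summable])
  then interpret spectral_decomposition v lam C .
  obtain N0 :: "'c measure" and W where N0: "prob_space N0" and W: "is_H_brownian_motion N0 W C"
    and conv_W: "D_weak_conv M (\<lambda>n \<omega> t. (1 / sqrt (real n)) *\<^sub>R (\<Sum>i=1..nat \<lfloor>t * real n\<rfloor>. eps (int i) \<omega>)) N0 W"
    using fclt unfolding C_def by blast
  define s where "s n \<omega> k = (1 / sqrt (real n)) *\<^sub>R (\<Sum>i=1..k. eps (int i) \<omega>)" for n \<omega> and k :: nat
  define Rn where "Rn n \<omega> = inv_sqrt_op (Chat n \<omega> + lamhat n \<omega> *\<^sub>R id_blinfun)" for n \<omega>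
  define T where "T n \<omega> = Max ((\<lambda>k. norm (Rn n \<omega> ((1 / sqrt (real n)) *\<^sub>R
    (\<Sum>i=1..k. X n i \<omega> - (1 / real n) *\<^sub>R (\<Sum>j=1..n. X n j \<omega>))))) ` {1..<n})" for n \<omega>
  have s_meas: "(\<lambda>\<omega>. s n \<omega> k) \<in> borel_measurable M" for n k
    unfolding s_def using eps_meas by measurable
  have Chat_strong: "strongly_measurable M (Chat n)" for n
    using Chat_meas by (simp add: strongly_measurable_def)
  have lamhat_meas: "lamhat n \<in> borel_measurable M" for n
    by (rule borel_measurable_max_eigenvalue[OF Chat_strong Chat_psd lamhat_eig lamhat_max])
  have Rn_meas: "strongly_measurable M (Rn n)" for n
    unfolding Rn_def[abs_def]
    by (rule strongly_measurable_inv_sqrt_op_shift[OF Chat_strong Chat_psd lamhat_eig lamhat_meas])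
  have T_meas: "T n \<in> borel_measurable M" for n
  proof -
    have [measurable]: "eps i \<in> borel_measurable M" for i by (rule eps_meas)
    have X_meas[measurable]: "X n i \<in> borel_measurable M" for i
      using model by (simp add: model[abs_def] fun_eq_iff cong: measurable_cong)
    have "(\<lambda>\<omega>. norm (Rn n \<omega> ((1 / sqrt (real n)) *\<^sub>R
        (\<Sum>i=1..k. X n i \<omega> - (1 / real n) *\<^sub>R (\<Sum>j=1..n. X n j \<omega>))))) \<in> borel_measurable M" for k
      by (intro measurable_compose[OF _ borel_measurable_norm] strongly_measurable_apply[OF Rn_meas]) measurable
    \<comment> \<open>For \<open>n < 2\<close> the index set is empty and \<open>Max\<close> a
      default value, which is constant in \<open>\<omega>\<close>.\<close>
    then show ?thesis unfolding T_def[abs_def] by (intro borel_measurable_Max) auto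
  qed
  have T_dev: "T n \<omega> = max_dev (Rn n \<omega>) n (s n \<omega>)" for n \<omega>
    unfolding T_def max_dev_def
  proof (intro arg_cong[where f = Max] image_cong refl arg_cong[where f = norm] arg_cong[where f = "blinfun_apply (Rn n \<omega>)"])
    fix k assume k: "k \<in> {1..<n}"
    then have n: "real n \<noteq> 0" and kn: "k < n" by auto
    have X: "X n i \<omega> = mu n 1 + eps (int i) \<omega>" if "i \<in> {1..n}" for i
      using model H0[of i n] that by simp
    \<comment> \<open>The common mean cancels in the centred sums: \<open>k\<close> copies of it are
      removed by \<open>k / n\<close> times \<open>n\<close> copies.\<close>
    have sumX: "(\<Sum>i=1..j. X n i \<omega>) = real j *\<^sub>R mu n 1 + (\<Sum>i=1..j. eps (int i) \<omega>)" if "j \<le> n" for j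
    proof -
      have "(\<Sum>i=1..j. X n i \<omega>) = (\<Sum>i=1..j. mu n 1 + eps (int i) \<omega>)"
        using that by (intro sum.cong refl X) auto
      then show ?thesis by (simp add: sum.distrib sum_constant_scaleR)
    qed
    have "(\<Sum>i=1..k. X n i \<omega> - (1 / real n) *\<^sub>R (\<Sum>j=1..n. X n j \<omega>))
        = (\<Sum>i=1..k. X n i \<omega>) - (real k / real n) *\<^sub>R (\<Sum>j=1..n. X n j \<omega>)"
      by (simp add: sum_subtractf sum_constant_scaleR)
    also have "\<dots> = (\<Sum>i=1..k. eps (int i) \<omega>) - (real k / real n) *\<^sub>R (\<Sum>i=1..n. eps (int i) \<omega>)"
      unfolding sumX[OF less_imp_le[OF kn]] sumX[OF le_refl] using n by (simp add: scaleR_right_distrib)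
    finally show "(1 / sqrt (real n)) *\<^sub>R (\<Sum>i=1..k. X n i \<omega> - (1 / real n) *\<^sub>R (\<Sum>j=1..n. X n j \<omega>))
        = s n \<omega> k - (real k / real n) *\<^sub>R s n \<omega> n"
      unfolding s_def by (simp add: scaleR_right_diff_distrib)
  qed
  \<comment> \<open>The process in (A2) is literally \<open>step_path n (s n \<omega>)\<close>, so
    weak convergence applies to bounded continuous functions of \<open>tied_sup\<close>.\<close>
  have conv_functional: "(\<lambda>n. \<integral>\<omega>. \<psi> (tied_sup R a (step_path n (s n \<omega>))) \<partial>M) \<longlonglongrightarrow> (\<integral>\<omega>. \<psi> (tied_sup R a (W \<omega>)) \<partial>N0)"
    if "continuous_on UNIV \<psi>" "\<And>u. 0 \<le> \<psi> u" "\<And>u. \<psi> u \<le> (1::real)" for \<psi> :: "real \<Rightarrow> real" and R and a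
  proof -
    have "bounded ((\<lambda>x. \<psi> (tied_sup R a x)) ` cadlag01)"
      by (rule boundedI[of _ 1]) (use that in auto)
    then show ?thesis
      using conv_W[unfolded D_weak_conv_def, rule_format, of "\<lambda>x. \<psi> (tied_sup R a x)"]
        skorokhod_continuous_tied_sup[OF that(1), of R a]
      by (simp add: step_path_def[abs_def] s_def[abs_def])
  qed
  have W_meas: "(\<lambda>\<omega>. W \<omega> t) \<in> borel_measurable N0" if "t \<in> {0..1}" for t
    using W that unfolding is_H_brownian_motion_def by blast
  have W_cont: "continuous_on {0..1} (W \<omega>)" if "\<omega> \<in> space N0" for \<omega>
    using W that unfolding is_H_brownian_motion_def by blast
  have mW: "(\<lambda>\<omega>. tied_sup id_blinfun 0 (W \<omega>)) \<in> borel_measurable N0"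
    by (rule borel_measurable_tied_sup_continuous[OF W_meas W_cont])
  \<comment> \<open>Tightness comes from the limit: its paths have a finite maximum, so a large
    \<open>K\<close> makes the ramp expectation small there, and convergence transfers this to large
    \<open>n\<close>.\<close>
  have tight: "\<exists>K\<ge>0. \<forall>\<^sub>F n in sequentially.
        (\<integral>\<omega>. ramp K (tied_sup id_blinfun 0 (step_path n (s n \<omega>))) \<partial>M) < e" if e: "e > 0" for e
  proof -
    have "\<forall>\<^sub>F K::nat in sequentially. (\<integral>\<omega>. ramp (real K) (tied_sup id_blinfun 0 (W \<omega>)) \<partial>N0) < e"
      by (rule order_tendstoD(2)[OF ramp_tendsto_0[OF N0 mW] e])
    then obtain K :: nat where K: "(\<integral>\<omega>. ramp (real K) (tied_sup id_blinfun 0 (W \<omega>)) \<partial>N0) < e"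
      by (auto simp: eventually_sequentially)
    have "continuous_on UNIV (ramp (real K))"
      unfolding ramp_def[abs_def] by (intro continuous_intros)
    from conv_functional[OF this ramp_bounds, of id_blinfun 0]
    have "\<forall>\<^sub>F n in sequentially.
        (\<integral>\<omega>. ramp (real K) (tied_sup id_blinfun 0 (step_path n (s n \<omega>))) \<partial>M) < e"
      by (rule order_tendstoD(2)) (rule K)
    then show ?thesis by (intro exI[of _ "real K"]) simp
  qed
  \<comment> \<open>Outside the event that the estimator is further than \<open>d\<close> from
    \<open>C\<close>, the deterministic modulus of \<open>inv_sqrt_op_continuous\<close>
    applies.\<close>
  have conv_op: "\<exists>G. \<forall>\<^sub>F n in sequentially. G n \<in> sets M \<and> measure M (G n) < e \<and>
        (\<forall>\<omega>\<in>space M - G n. norm (Rn n \<omega> - limit_op) \<le> h)" if h: "h > 0" and e: "e > 0" for h e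
  proof -
    obtain d where d: "d > 0" "\<And>A l. psd_op A \<Longrightarrow> norm (A - C) \<le> d \<Longrightarrow> is_eigenvalue A l \<Longrightarrow>
      (\<And>l'. is_eigenvalue A l' \<Longrightarrow> l' \<le> l) \<Longrightarrow> norm (inv_sqrt_op (A + l *\<^sub>R id_blinfun) - limit_op) \<le> h"
      by (rule inv_sqrt_op_continuous[OF h]) blast
    define G where "G n = {\<omega>\<in>space M. norm (Chat n \<omega> - C) > d}" for n
    have "G n \<in> sets M" for n
    proof -
      have [measurable]: "(\<lambda>\<omega>. norm (Chat n \<omega> - C)) \<in> borel_measurable M"
        by (intro borel_measurable_norm_op strongly_measurable_diff Chat_strong strongly_measurable_const)
      show ?thesis unfolding G_def by measurable
    qed
    moreover have "\<forall>\<^sub>F n in sequentially. measure M (G n) < e"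
      unfolding G_def C_def by (rule order_tendstoD(2)[OF Chat_consistent[OF d(1)] e])
    moreover have "norm (Rn n \<omega> - limit_op) \<le> h" if "\<omega> \<in> space M - G n" for n \<omega>
      unfolding Rn_def
      by (rule d(2)[OF Chat_psd _ lamhat_eig lamhat_max]) (use that in \<open>auto simp: G_def\<close>)
    ultimately show ?thesis by (intro exI[of _ G]) simp
  qed
  note law = limit_law[OF sd N0 W N B[rule_format] indep]
  let ?G = "\<lambda>\<omega>. SUP t\<in>{0..1}. (\<Sum>p. lam p / (lam p + lam 0) * (B p \<omega> t)^2)"
  have T2: "(\<lambda>\<omega>. (T n \<omega>)\<^sup>2) \<in> borel_measurable M" for n using T_meas[of n] by measurable
  have "weak_conv_m (\<lambda>n. distr M borel (\<lambda>\<omega>. (T n \<omega>)\<^sup>2)) (distr N borel ?G)"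
  \<comment> \<open>Weak convergence on the line is tested on piecewise linear steps: with the
    limiting operator the expectations converge by (A2), and the difference to the actual statistic
    tends to zero.\<close>
  proof (rule integral_cts_step_conv_imp_weak_conv)
    show "real_distribution (distr M borel (\<lambda>\<omega>. (T n \<omega>)\<^sup>2))" for n
      by (rule real_distribution_distr[OF T2])
    show "real_distribution (distr N borel ?G)"
      by (rule prob_space.real_distribution_distr[OF N law(2)])
    fix x y :: real assume xy: "x < y"
    have cm: "cts_step x y \<in> borel_measurable borel"
      unfolding cts_step_def[abs_def] by measurable
    have "continuous_on UNIV (cts_step x y)"
      by (rule uniformly_continuous_imp_continuous[OF cts_step_uniformly_continuous[OF xy]])
    then have "continuous_on UNIV (\<lambda>u. cts_step x y (u\<^sup>2))"
      by (rule continuous_on_compose2) (auto intro!: continuous_intros)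
    from conv_functional[OF this cts_step_bounds[OF xy], of limit_op 1]
    have 1: "(\<lambda>n. \<integral>\<omega>. cts_step x y ((tied_sup limit_op 1 (step_path n (s n \<omega>)))\<^sup>2) \<partial>M)
        \<longlonglongrightarrow> (\<integral>\<omega>. cts_step x y ((tied_sup limit_op 1 (W \<omega>))\<^sup>2) \<partial>N0)" .
    have 2: "(\<lambda>n. (\<integral>\<omega>. cts_step x y ((T n \<omega>)\<^sup>2) \<partial>M)
        - (\<integral>\<omega>. cts_step x y ((tied_sup limit_op 1 (step_path n (s n \<omega>)))\<^sup>2) \<partial>M)) \<longlonglongrightarrow> 0"
      unfolding T_dev
    proof (rule expectation_max_dev_close[OF M s_meas _ _ tight conv_op xy])
      show "s n \<omega> 0 = 0" for n \<omega> by (simp add: s_def)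
      show "(\<lambda>\<omega>. max_dev (Rn n \<omega>) n (s n \<omega>)) \<in> borel_measurable M" for n
        using T_meas[of n] by (simp add: T_dev[abs_def])
    qed
    have "(\<lambda>n. \<integral>\<omega>. cts_step x y ((T n \<omega>)\<^sup>2) \<partial>M) \<longlonglongrightarrow> (\<integral>\<omega>. cts_step x y ((tied_sup limit_op 1 (W \<omega>))\<^sup>2) \<partial>N0)"
      using tendsto_add[OF 2 1] by simp
    then show "(\<lambda>n. integral\<^sup>L (distr M borel (\<lambda>\<omega>. (T n \<omega>)\<^sup>2)) (cts_step x y))
        \<longlonglongrightarrow> integral\<^sup>L (distr N borel ?G) (cts_step x y)"
      unfolding law(1) by (simp add: integral_distr[OF T2 cm] integral_distr[OF law(3) cm])
  qed
  then show "weak_conv_m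
             (\<lambda>n. distr M borel (\<lambda>\<omega>.
                (Max ((\<lambda>k. norm (inv_sqrt_op (Chat n \<omega> + lamhat n \<omega> *\<^sub>R id_blinfun)
                     ((1 / sqrt (real n)) *\<^sub>R
                       (\<Sum>i=1..k. X n i \<omega> - (1 / real n) *\<^sub>R (\<Sum>j=1..n. X n j \<omega>))))) ` {1..<n})) ^ 2))
             (distr N borel ?G)"
    unfolding T_def Rn_def .
qed

end
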